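(* Let $\Bbbk$ be an algebraically closed field of characteristic zero, $N > 1$ an odd integer, and $q \in \Bbbk$ a primitive $N$-th root of unity. Then $\overline{U}_q(\mathfrak{sl}_2)$ has no non-trivial normal right coideal subalgebras.
   Context: $\overline{U}_q(\mathfrak{sl}_2)$ is the algebra generated by $K, E, F$ subject to $K^N = 1$, $KE = q^2 EK$, $KF = q^{-2}FK$, $E^N = F^N = 0$, $EF - FE = (K - K^{-1})/(q - q^{-1})$; it is a Hopf algebra with $\Delta(K) = K \otimes K$, $\Delta(E) = E \otimes K + 1 \otimes E$, $\Delta(F) = F \otimes 1 + K^{-1} \otimes F$, $\varepsilon(K)=1$, $\varepsilon(E)=\varepsilon(F)=0$, $S(K) = K^{-1}$, $S(E) = -EK^{-1}$, $S(F) = -KF$. A right coideal subalgebra of a Hopf algebra $H$ is a (unital) subalgebra $A$ with $\Delta(A) \subset A \otimes H$. It is normal if $S(h_{(1)})\, a\, h_{(2)} \in A$ for all $a \in A$, $h \in H$. The trivial normal right coideal subalgebras are $\Bbbk$ and $H$. *)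

theory Defs
  imports
    "HOL-Library.Poly_Mapping"
    "HOL-Computational_Algebra.Polynomial"
    "HOL-Algebra.Algebra"
begin

section \<open>Algebras over a field\<close>

text \<open>
  Scalars range over a type of class \<^class>\<open>field\<close>.  An associative unital algebra is
  represented by a record of type \<^type>\<open>module\<close>, i.e. a ring together with scalar
  multiplication; the locale \<^locale>\<open>algebra\<close> is not used as it requires commutativity.
\<close>

definition monoid_algebra ::
    "('m, 'n) monoid_scheme \<Rightarrow> ('k::field, 'm \<Rightarrow>\<^sub>0 'k) module" where
  "monoid_algebra M =
    \<lparr>carrier = {f. Poly_Mapping.keys f \<subseteq> carrier M},
     monoid.mult = (\<lambda>f g. \<Sum>u\<in>Poly_Mapping.keys f. \<Sum>v\<in>Poly_Mapping.keys g.
               Poly_Mapping.single (u \<otimes>\<^bsub>M\<^esub> v) (Poly_Mapping.lookup f u * Poly_Mapping.lookup g v)),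
     one = Poly_Mapping.single \<one>\<^bsub>M\<^esub> 1,
     ring.zero = 0,
     add = (+),
     smult = (\<lambda>c f. Poly_Mapping.map (\<lambda>x. c * x) f)\<rparr>"

definition quot_algebra :: "('k, 'a, 'z) module_scheme \<Rightarrow> 'a set \<Rightarrow> ('k, 'a set) module" where
  "quot_algebra A I =
    ring.extend (A Quot I)
      (module.fields (\<lambda>c C. \<Union>x\<in>C. I +>\<^bsub>A\<^esub> (c \<odot>\<^bsub>A\<^esub> x)))"

definition opposite_algebra :: "('k, 'a) module \<Rightarrow> ('k, 'a) module" where
  "opposite_algebra A = A\<lparr>monoid.mult := \<lambda>x y. y \<otimes>\<^bsub>A\<^esub> x\<rparr>"

definition base_algebra :: "('k::field, 'k) module" where
  "base_algebra =
    \<lparr>carrier = UNIV, monoid.mult = (*), one = 1, ring.zero = 0, add = (+), smult = (*)\<rparr>"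


subsection \<open>Free algebras\<close>

definition free_monoid :: "'g list monoid" where
  "free_monoid = \<lparr>carrier = UNIV, monoid.mult = (@), one = []\<rparr>"

definition free_algebra :: "('k::field, 'g list \<Rightarrow>\<^sub>0 'k) module" where
  "free_algebra = monoid_algebra free_monoid"

definition free_gen :: "'g \<Rightarrow> 'g list \<Rightarrow>\<^sub>0 'k::field" where
  "free_gen g = Poly_Mapping.single [g] 1"

text \<open>The algebra homomorphism from the free algebra to \<open>B\<close> sending each generator \<open>g\<close> to \<open>\<phi> g\<close>.\<close>

definition free_lift ::
    "('k::field, 'b, 'z) module_scheme \<Rightarrow> ('g \<Rightarrow> 'b) \<Rightarrow> ('g list \<Rightarrow>\<^sub>0 'k) \<Rightarrow> 'b" where
  "free_lift B \<phi> f =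
    (\<Oplus>\<^bsub>B\<^esub>w\<in>Poly_Mapping.keys f.
       Poly_Mapping.lookup f w \<odot>\<^bsub>B\<^esub> foldr (\<lambda>g b. \<phi> g \<otimes>\<^bsub>B\<^esub> b) w \<one>\<^bsub>B\<^esub>)"


subsection \<open>Tensor products\<close>

text \<open>
  The tensor product of \<open>A\<close> and \<open>B\<close> is the free vector space on \<open>carrier A \<times> carrier B\<close> modulo the
  bilinearity relations.  With the multiplication \<open>(a, b) (a', b') = (a a', b b')\<close> on basis
  elements, this free vector space is the monoid algebra of the product monoid, and the span of
  the bilinearity relations is the two-sided ideal generated by them.
\<close>

definition tensor_relators ::
    "('k::field, 'a, 'y) module_scheme \<Rightarrow> ('k, 'b, 'z) module_scheme \<Rightarrow> ('a \<times> 'b \<Rightarrow>\<^sub>0 'k) set" where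
  "tensor_relators A B =
    {Poly_Mapping.single (a \<oplus>\<^bsub>A\<^esub> a', b) 1 - Poly_Mapping.single (a, b) 1
       - Poly_Mapping.single (a', b) 1 | a a' b.
       a \<in> carrier A \<and> a' \<in> carrier A \<and> b \<in> carrier B} \<union>
    {Poly_Mapping.single (a, b \<oplus>\<^bsub>B\<^esub> b') 1 - Poly_Mapping.single (a, b) 1
       - Poly_Mapping.single (a, b') 1 | a b b'.
       a \<in> carrier A \<and> b \<in> carrier B \<and> b' \<in> carrier B} \<union>
    {Poly_Mapping.single (c \<odot>\<^bsub>A\<^esub> a, b) 1 - Poly_Mapping.single (a, b) c | c a b.
       a \<in> carrier A \<and> b \<in> carrier B} \<union>
    {Poly_Mapping.single (a, c \<odot>\<^bsub>B\<^esub> b) 1 - Poly_Mapping.single (a, b) c | c a b.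
       a \<in> carrier A \<and> b \<in> carrier B}"

definition tensor_ideal ::
    "('k::field, 'a, 'y) module_scheme \<Rightarrow> ('k, 'b, 'z) module_scheme \<Rightarrow> ('a \<times> 'b \<Rightarrow>\<^sub>0 'k) set" where
  "tensor_ideal A B = Idl\<^bsub>monoid_algebra (A \<times>\<times> B)\<^esub> (tensor_relators A B)"

definition tensor_algebra ::
    "('k::field, 'a, 'y) module_scheme \<Rightarrow> ('k, 'b, 'z) module_scheme
      \<Rightarrow> ('k, ('a \<times> 'b \<Rightarrow>\<^sub>0 'k) set) module" where
  "tensor_algebra A B = quot_algebra (monoid_algebra (A \<times>\<times> B)) (tensor_ideal A B)"

definition pure_tensor ::
    "('k::field, 'a, 'y) module_scheme \<Rightarrow> ('k, 'b, 'z) module_scheme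
      \<Rightarrow> 'a \<Rightarrow> 'b \<Rightarrow> ('a \<times> 'b \<Rightarrow>\<^sub>0 'k) set" where
  "pure_tensor A B a b =
    tensor_ideal A B +>\<^bsub>monoid_algebra (A \<times>\<times> B)\<^esub> Poly_Mapping.single (a, b) 1"


section \<open>Normal right coideal subalgebras of Hopf algebras\<close>

text \<open>
  The record carries the structure maps only; \<open>comult H\<close> takes values in
  \<open>tensor_algebra H H\<close>.  The Hopf algebra axioms are not part of the type.
\<close>

record (overloaded) ('k, 'h) hopf_algebra = "('k, 'h) module" +
  comult :: "'h \<Rightarrow> ('h \<times> 'h \<Rightarrow>\<^sub>0 'k) set"
  counit :: "'h \<Rightarrow> 'k"
  antipode :: "'h \<Rightarrow> 'h"

text \<open>
  \<open>sweedler H h n x y\<close> says that \<open>\<Delta>(h) = \<Sum>i<n. x i \<otimes> y i\<close>, i.e. that \<open>(x, y)\<close> is a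
  choice of components \<open>h\<^sub>(\<^sub>1\<^sub>) \<otimes> h\<^sub>(\<^sub>2\<^sub>)\<close>.
\<close>

definition sweedler ::
    "('k::field, 'h) hopf_algebra \<Rightarrow> 'h \<Rightarrow> nat \<Rightarrow> (nat \<Rightarrow> 'h) \<Rightarrow> (nat \<Rightarrow> 'h) \<Rightarrow> bool" where
  "sweedler H h n x y \<longleftrightarrow>
    x \<in> {..<n} \<rightarrow> carrier H \<and> y \<in> {..<n} \<rightarrow> carrier H \<and>
    comult H h = (\<Oplus>\<^bsub>tensor_algebra H H\<^esub>i\<in>{..<n}. pure_tensor H H (x i) (y i))"

definition is_subalgebra :: "('k, 'h, 'z) module_scheme \<Rightarrow> 'h set \<Rightarrow> bool" where
  "is_subalgebra H A \<longleftrightarrow> subring A H \<and> (\<forall>c. \<forall>a\<in>A. c \<odot>\<^bsub>H\<^esub> a \<in> A)"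

text \<open>The subspace \<open>A \<otimes> H\<close> of \<open>H \<otimes> H\<close>.\<close>

definition tensor_left_sub ::
    "('k::field, 'h, 'z) module_scheme \<Rightarrow> 'h set \<Rightarrow> ('h \<times> 'h \<Rightarrow>\<^sub>0 'k) set set" where
  "tensor_left_sub H A =
    {\<Oplus>\<^bsub>tensor_algebra H H\<^esub>i\<in>{..<n}. pure_tensor H H (x i) (y i) | (n::nat) x y.
       x \<in> {..<n} \<rightarrow> A \<and> y \<in> {..<n} \<rightarrow> carrier H}"

definition right_coideal_subalgebra :: "('k::field, 'h) hopf_algebra \<Rightarrow> 'h set \<Rightarrow> bool" where
  "right_coideal_subalgebra H A \<longleftrightarrow>
    is_subalgebra H A \<and> comult H ` A \<subseteq> tensor_left_sub H A"

text \<open>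
  The element \<open>S(h\<^sub>(\<^sub>1\<^sub>)) a h\<^sub>(\<^sub>2\<^sub>)\<close> does not depend on the chosen expression of \<open>\<Delta>(h)\<close> as
  a sum of pure tensors.
\<close>

definition normal_right_coideal_subalgebra ::
    "('k::field, 'h) hopf_algebra \<Rightarrow> 'h set \<Rightarrow> bool" where
  "normal_right_coideal_subalgebra H A \<longleftrightarrow>
    right_coideal_subalgebra H A \<and>
    (\<forall>a\<in>A. \<forall>h\<in>carrier H. \<forall>n x y. sweedler H h n x y \<longrightarrow>
       (\<Oplus>\<^bsub>H\<^esub>i\<in>{..<n}. antipode H (x i) \<otimes>\<^bsub>H\<^esub> a \<otimes>\<^bsub>H\<^esub> y i) \<in> A)"

definition scalars :: "('k, 'h, 'z) module_scheme \<Rightarrow> 'h set" where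
  "scalars H = range (\<lambda>c. c \<odot>\<^bsub>H\<^esub> \<one>\<^bsub>H\<^esub>)"

definition trivial_subalgebra :: "('k, 'h, 'z) module_scheme \<Rightarrow> 'h set \<Rightarrow> bool" where
  "trivial_subalgebra H A \<longleftrightarrow> A = scalars H \<or> A = carrier H"


section \<open>The small quantum group\<close>

datatype uq_generator = gen_K | gen_E | gen_F

text \<open>
  Each relation \<open>l = r\<close> is rendered as the element \<open>l - r\<close> of the free algebra.  In the relation
  for \<open>E F - F E\<close> the inverse of \<open>K\<close> is written \<open>K ^ (N - 1)\<close>, in view of \<open>K ^ N = 1\<close>.
\<close>

definition uq_relators :: "nat \<Rightarrow> 'k::field \<Rightarrow> (uq_generator list \<Rightarrow>\<^sub>0 'k) set" where
  "uq_relators N q =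
    (let A = free_algebra; K = free_gen gen_K; E = free_gen gen_E; F = free_gen gen_F in
     {K [^]\<^bsub>A\<^esub> N \<ominus>\<^bsub>A\<^esub> \<one>\<^bsub>A\<^esub>,
      K \<otimes>\<^bsub>A\<^esub> E \<ominus>\<^bsub>A\<^esub> (q ^ 2) \<odot>\<^bsub>A\<^esub> (E \<otimes>\<^bsub>A\<^esub> K),
      K \<otimes>\<^bsub>A\<^esub> F \<ominus>\<^bsub>A\<^esub> (inverse q ^ 2) \<odot>\<^bsub>A\<^esub> (F \<otimes>\<^bsub>A\<^esub> K),
      E [^]\<^bsub>A\<^esub> N,
      F [^]\<^bsub>A\<^esub> N,
      (E \<otimes>\<^bsub>A\<^esub> F \<ominus>\<^bsub>A\<^esub> F \<otimes>\<^bsub>A\<^esub> E) \<ominus>\<^bsub>A\<^esub>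
        inverse (q - inverse q) \<odot>\<^bsub>A\<^esub> (K \<ominus>\<^bsub>A\<^esub> K [^]\<^bsub>A\<^esub> (N - 1))})"

definition uq_ideal :: "nat \<Rightarrow> 'k::field \<Rightarrow> (uq_generator list \<Rightarrow>\<^sub>0 'k) set" where
  "uq_ideal N q = Idl\<^bsub>free_algebra\<^esub> (uq_relators N q)"

definition uq_algebra :: "nat \<Rightarrow> 'k::field \<Rightarrow> ('k, (uq_generator list \<Rightarrow>\<^sub>0 'k) set) module" where
  "uq_algebra N q = quot_algebra free_algebra (uq_ideal N q)"

definition uq_gen :: "nat \<Rightarrow> 'k::field \<Rightarrow> uq_generator \<Rightarrow> (uq_generator list \<Rightarrow>\<^sub>0 'k) set" where
  "uq_gen N q g = uq_ideal N q +>\<^bsub>free_algebra\<^esub> free_gen g"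

text \<open>
  The structure maps are given on generators, extended multiplicatively (antimultiplicatively
  for the antipode) to the free algebra, and then passed to the quotient: a homomorphism that
  vanishes on the ideal is constant on each coset, and \<^const>\<open>the_elem\<close> picks its value there.
\<close>

fun uq_comult_gen :: "nat \<Rightarrow> 'k::field \<Rightarrow> uq_generator \<Rightarrow>
    ((uq_generator list \<Rightarrow>\<^sub>0 'k) set \<times> (uq_generator list \<Rightarrow>\<^sub>0 'k) set \<Rightarrow>\<^sub>0 'k) set" where
  "uq_comult_gen N q gen_K =
    (let U = uq_algebra N q; K = uq_gen N q gen_K in
     pure_tensor U U K K)"
| "uq_comult_gen N q gen_E =
    (let U = uq_algebra N q; K = uq_gen N q gen_K; E = uq_gen N q gen_E in
     pure_tensor U U E K \<oplus>\<^bsub>tensor_algebra U U\<^esub> pure_tensor U U \<one>\<^bsub>U\<^esub> E)"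
| "uq_comult_gen N q gen_F =
    (let U = uq_algebra N q; K = uq_gen N q gen_K; F = uq_gen N q gen_F in
     pure_tensor U U F \<one>\<^bsub>U\<^esub> \<oplus>\<^bsub>tensor_algebra U U\<^esub> pure_tensor U U (inv\<^bsub>U\<^esub> K) F)"

fun uq_counit_gen :: "uq_generator \<Rightarrow> 'k::field" where
  "uq_counit_gen gen_K = 1"
| "uq_counit_gen gen_E = 0"
| "uq_counit_gen gen_F = 0"

fun uq_antipode_gen ::
    "nat \<Rightarrow> 'k::field \<Rightarrow> uq_generator \<Rightarrow> (uq_generator list \<Rightarrow>\<^sub>0 'k) set" where
  "uq_antipode_gen N q gen_K =
    (let U = uq_algebra N q in inv\<^bsub>U\<^esub> (uq_gen N q gen_K))"
| "uq_antipode_gen N q gen_E =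
    (let U = uq_algebra N q in \<ominus>\<^bsub>U\<^esub> (uq_gen N q gen_E \<otimes>\<^bsub>U\<^esub> inv\<^bsub>U\<^esub> (uq_gen N q gen_K)))"
| "uq_antipode_gen N q gen_F =
    (let U = uq_algebra N q in \<ominus>\<^bsub>U\<^esub> (uq_gen N q gen_K \<otimes>\<^bsub>U\<^esub> uq_gen N q gen_F))"

definition uq_sl2 :: "nat \<Rightarrow> 'k::field \<Rightarrow> ('k, (uq_generator list \<Rightarrow>\<^sub>0 'k) set) hopf_algebra" where
  "uq_sl2 N q =
    (let U = uq_algebra N q in
     module.extend U (hopf_algebra.fields
       (\<lambda>C. the_elem (free_lift (tensor_algebra U U) (uq_comult_gen N q) ` C))
       (\<lambda>C. the_elem (free_lift base_algebra uq_counit_gen ` C))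
       (\<lambda>C. the_elem (free_lift (opposite_algebra U) (uq_antipode_gen N q) ` C))))"

definition primitive_root_of_unity :: "nat \<Rightarrow> 'k::field \<Rightarrow> bool" where
  "primitive_root_of_unity N q \<longleftrightarrow> q ^ N = 1 \<and> (\<forall>m. 0 < m \<and> m < N \<longrightarrow> q ^ m \<noteq> 1)"

end

theory Submission
  imports Defs
begin

text \<open>
  Let \<open>\<rho>\<close> be the two-dimensional representation of \<open>U\<close>.  The matrix entries of the algebra homomorphism
  \<open>\<Psi> = (id \<otimes> \<rho>) \<circ> \<Delta> : U \<rightarrow> M\<^sub>2(U)\<close> are linear maps \<open>U \<rightarrow> U\<close> that preserve every right coideal \<open>A\<close>.
  On the monomials \<open>F\<^sup>a E\<^sup>b K\<^sup>c\<close> three of them act, up to nonzero scalars, by a diagonal map, by lowering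
  \<open>b\<close> and by lowering \<open>a\<close> (and \<open>c\<close>).  If \<open>A\<close> is also stable under conjugation by \<open>K\<close> and contains a
  non-scalar, it contains one that is homogeneous for both diagonal maps; the lowering maps turn it
  into \<open>E\<close>, \<open>F K\<close> or a power of \<open>K\<close> other than \<open>1\<close>.  The adjoint action of \<open>E\<close> and \<open>F\<close> then produces all
  generators.  Only the spanning half of the PBW theorem is needed: the argument works with some
  expression of an element in the monomials, not with a unique one.
\<close>

section \<open>Algebras over a field and their quotients\<close>

text \<open>For any \<open>\<rho>\<close>, the map \<open>id \<otimes> \<rho>\<close> sends
  \<open>a \<otimes> h\<close> to \<open>a\<close> times a scalar matrix, so its entries stay in
  \<open>A\<close> as soon as \<open>\<Delta>(A) \<subseteq> A \<otimes> U\<close>. Conjugation by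
  \<open>K\<close> and the diagonal entry scale \<open>F^a E^b K^c\<close> by
  \<open>q^(2(a-b))\<close> and \<open>q^(b+c)\<close>. Since N is odd, \<open>q^2\<close> is again
  a primitive N-th root of unity, and a homogeneous element has at most one monomial for each b.
  Lowering the largest b to 0 isolates one \<open>F^a K^c\<close>, and lowering a leaves
  \<open>K^(c-a)\<close>. The obstacle is a = c, where this power is 1: for a > 0 the lowering has
  to stop at \<open>F K\<close>, and for a = c = 0 it has to stop at \<open>E\<close>, where exactly
  one further monomial, \<open>F^(N-1) K\<close>, can interfere. A separate burden is that
  \<open>\<Delta>\<close>, the antipode and \<open>\<rho>\<close> are prescribed on generators only.
  Each of them exists once the images of \<open>K\<close>, \<open>E\<close>, \<open>F\<close>
  satisfy the six relations in the target algebra; for \<open>\<Delta>\<close> the nilpotency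
  relations rest on the vanishing of Gaussian binomial coefficients at a root of unity.\<close>

locale field_algebra = ring R for R :: "('k::field, 'a, 'z) module_scheme" (structure) +
  assumes smult_closed [simp, intro]: "x \<in> carrier R \<Longrightarrow> c \<odot> x \<in> carrier R"
    and smult_l_distr: "x \<in> carrier R \<Longrightarrow> (c + d) \<odot> x = c \<odot> x \<oplus> d \<odot> x"
    and smult_r_distr: "x \<in> carrier R \<Longrightarrow> y \<in> carrier R \<Longrightarrow> c \<odot> (x \<oplus> y) = c \<odot> x \<oplus> c \<odot> y"
    and smult_assoc: "x \<in> carrier R \<Longrightarrow> (c * d) \<odot> x = c \<odot> (d \<odot> x)"
    and smult_one [simp]: "x \<in> carrier R \<Longrightarrow> 1 \<odot> x = x"
    and smult_mult_l: "x \<in> carrier R \<Longrightarrow> y \<in> carrier R \<Longrightarrow> (c \<odot> x) \<otimes> y = c \<odot> (x \<otimes> y)"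
    and smult_mult_r: "x \<in> carrier R \<Longrightarrow> y \<in> carrier R \<Longrightarrow> x \<otimes> (c \<odot> y) = c \<odot> (x \<otimes> y)"
begin

lemma smult_smult: "x \<in> carrier R \<Longrightarrow> c \<odot> (d \<odot> x) = (c * d) \<odot> x"
  by (simp add: smult_assoc)

lemma smult_zero_l [simp]: "x \<in> carrier R \<Longrightarrow> 0 \<odot> x = \<zero>"
  using smult_l_distr[of x 0 0] by (metis add.l_cancel_one' smult_closed add_0)

lemma smult_zero_r [simp]: "c \<odot> \<zero> = \<zero>"
  using smult_r_distr[of \<zero> \<zero> c] by (metis add.l_cancel_one' smult_closed l_zero zero_closed)

lemma smult_uminus_l: "x \<in> carrier R \<Longrightarrow> (- c) \<odot> x = \<ominus> (c \<odot> x)"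
  using smult_l_distr[of x "- c" c] by (simp add: minus_equality)

lemma a_inv_eq_smult: "x \<in> carrier R \<Longrightarrow> \<ominus> x = (- 1) \<odot> x"
  by (simp add: smult_uminus_l)

lemma minus_eq_smult: "x \<in> carrier R \<Longrightarrow> y \<in> carrier R \<Longrightarrow> x \<ominus> y = x \<oplus> (- 1) \<odot> y"
  by (simp add: a_inv_eq_smult a_minus_def)

lemma smult_finsum:
  "f \<in> I \<rightarrow> carrier R \<Longrightarrow> c \<odot> (\<Oplus>i\<in>I. f i) = (\<Oplus>i\<in>I. c \<odot> f i)"
proof (induction I rule: infinite_finite_induct)
  case (insert i I)
  then have "f \<in> I \<rightarrow> carrier R" "f i \<in> carrier R" "(\<lambda>i. c \<odot> f i) \<in> I \<rightarrow> carrier R" by auto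
  with insert show ?case by (simp add: smult_r_distr)
qed simp_all

lemma smult_pow:
  "x \<in> carrier R \<Longrightarrow> (c \<odot> x) [^] (n::nat) = (c ^ n) \<odot> (x [^] n)"
  by (induction n) (simp_all add: smult_mult_l smult_mult_r smult_smult mult.commute)

end

lemma field_algebraI:
  fixes R :: "('k::field, 'a, 'z) module_scheme" (structure)
  assumes "ring R"
    and "\<And>c x. x \<in> carrier R \<Longrightarrow> c \<odot> x \<in> carrier R"
    and "\<And>c d x. x \<in> carrier R \<Longrightarrow> (c + d) \<odot> x = c \<odot> x \<oplus> d \<odot> x"
    and "\<And>c x y. x \<in> carrier R \<Longrightarrow> y \<in> carrier R \<Longrightarrow> c \<odot> (x \<oplus> y) = c \<odot> x \<oplus> c \<odot> y"
    and "\<And>c d x. x \<in> carrier R \<Longrightarrow> (c * d) \<odot> x = c \<odot> (d \<odot> x)"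
    and "\<And>x. x \<in> carrier R \<Longrightarrow> 1 \<odot> x = x"
    and "\<And>c x y. x \<in> carrier R \<Longrightarrow> y \<in> carrier R \<Longrightarrow> (c \<odot> x) \<otimes> y = c \<odot> (x \<otimes> y)"
    and "\<And>c x y. x \<in> carrier R \<Longrightarrow> y \<in> carrier R \<Longrightarrow> x \<otimes> (c \<odot> y) = c \<odot> (x \<otimes> y)"
  shows "field_algebra R"
  using assms by (simp add: field_algebra_def field_algebra_axioms_def)

locale field_algebra_hom = A: field_algebra A + B: field_algebra B
  for A :: "('k::field, 'a, 'y) module_scheme" and B :: "('k, 'b, 'z) module_scheme" +
  fixes h :: "'a \<Rightarrow> 'b"
  assumes ring_hom: "h \<in> ring_hom A B"
    and hom_smult [simp]: "x \<in> carrier A \<Longrightarrow> h (c \<odot>\<^bsub>A\<^esub> x) = c \<odot>\<^bsub>B\<^esub> h x"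

sublocale field_algebra_hom \<subseteq> ring_hom_ring A B h
  by (intro ring_hom_ringI2 A.ring_axioms B.ring_axioms ring_hom)

context field_algebra_hom
begin

lemma hom_minus [simp]:
  "x \<in> carrier A \<Longrightarrow> y \<in> carrier A \<Longrightarrow> h (x \<ominus>\<^bsub>A\<^esub> y) = h x \<ominus>\<^bsub>B\<^esub> h y"
  by (simp add: a_minus_def)

text \<open>The kernel is an ideal, hence contains the ideal generated by any of its subsets. This
  reduces the existence of maps out of a quotient to a check on relators.\<close>

lemma Idl_kernel:
  assumes "S \<subseteq> carrier A" "\<And>x. x \<in> S \<Longrightarrow> h x = \<zero>\<^bsub>B\<^esub>" "x \<in> Idl\<^bsub>A\<^esub> S"
  shows "h x = \<zero>\<^bsub>B\<^esub>"
proof -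
  have "S \<subseteq> a_kernel A B h"
    unfolding a_kernel_def' using assms(1,2) by blast
  then have "Idl\<^bsub>A\<^esub> S \<subseteq> a_kernel A B h"
    by (rule A.genideal_minimal[OF kernel_is_ideal])
  from subsetD[OF this assms(3)] show ?thesis
    unfolding a_kernel_def' by simp
qed

text \<open>The evaluation rule behind all structure maps of \<open>uq_sl2\<close>, which apply
  \<open>the_elem\<close> to the image of a coset.\<close>

lemma the_elem_coset:
  assumes "ideal I A" "\<And>x. x \<in> I \<Longrightarrow> h x = \<zero>\<^bsub>B\<^esub>" "x \<in> carrier A"
  shows "the_elem (h ` (I +>\<^bsub>A\<^esub> x)) = h x"
proof -
  interpret ideal I A by fact
  have "h y = h x" if "y \<in> I +>\<^bsub>A\<^esub> x" for y
    using that assms(2,3) by (auto simp: a_r_coset_def r_coset_def a_Hcarr)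
  moreover have "x \<in> I +>\<^bsub>A\<^esub> x"
    using assms(3) by (rule a_rcos_self)
  ultimately have "h ` (I +>\<^bsub>A\<^esub> x) = {h x}" by blast
  then show ?thesis by simp
qed

end

lemma quot_algebra_simps [simp]:
  "carrier (quot_algebra A I) = carrier (A Quot I)"
  "monoid.mult (quot_algebra A I) = monoid.mult (A Quot I)"
  "one (quot_algebra A I) = one (A Quot I)"
  "ring.zero (quot_algebra A I) = ring.zero (A Quot I)"
  "add (quot_algebra A I) = add (A Quot I)"
  "smult (quot_algebra A I) = (\<lambda>c C. \<Union>x\<in>C. I +>\<^bsub>A\<^esub> (c \<odot>\<^bsub>A\<^esub> x))"
  by (simp_all add: quot_algebra_def ring.extend_def module.fields_def)

text \<open>Needed because \<open>quot_algebra\<close> extends the record \<open>A Quot I\<close> by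
  a scalar multiplication: the ring axioms involve the common fields only.\<close>

lemma ring_cong:
  assumes "ring R" "carrier S = carrier R" "monoid.mult S = monoid.mult R" "one S = one R"
    "ring.zero S = ring.zero R" "add S = add R"
  shows "ring S"
proof -
  interpret ring R by fact
  show ?thesis
    by (intro ringI abelian_groupI monoidI)
      (auto simp: assms(2-) a_ac m_assoc l_distr r_distr intro!: bexI[of _ "\<ominus>\<^bsub>R\<^esub> x" for x])
qed

locale algebra_ideal = field_algebra A + ideal I A
  for A :: "('k::field, 'a, 'z) module_scheme" and I
begin

abbreviation cls where "cls x \<equiv> I +>\<^bsub>A\<^esub> x"

text \<open>A ring ideal is a subspace, because scaling by \<open>c\<close> is multiplication by the
  element \<open>c \<odot> \<one>\<close>.\<close>

lemma smult_ideal: "x \<in> I \<Longrightarrow> c \<odot>\<^bsub>A\<^esub> x \<in> I"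
  using I_l_closed[of x "c \<odot>\<^bsub>A\<^esub> \<one>\<^bsub>A\<^esub>"] a_Hcarr[of x] by (simp add: smult_mult_l)

text \<open>The scalar action on the quotient is a union over all representatives of a coset; by
  \<open>smult_ideal\<close> each of them contributes the same coset.\<close>

lemma smult_cls:
  assumes "x \<in> carrier A"
  shows "c \<odot>\<^bsub>quot_algebra A I\<^esub> cls x = cls (c \<odot>\<^bsub>A\<^esub> x)"
proof -
  have *: "cls (c \<odot>\<^bsub>A\<^esub> y) = cls (c \<odot>\<^bsub>A\<^esub> x)" if "y \<in> cls x" for y
  proof -
    have "\<exists>i\<in>I. y = i \<oplus>\<^bsub>A\<^esub> x"
      using that unfolding a_r_coset_def' by simp
    then obtain i where i: "i \<in> I" "y = i \<oplus>\<^bsub>A\<^esub> x" by blast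
    then have "c \<odot>\<^bsub>A\<^esub> y = c \<odot>\<^bsub>A\<^esub> i \<oplus>\<^bsub>A\<^esub> c \<odot>\<^bsub>A\<^esub> x"
      using assms by (simp add: smult_r_distr a_Hcarr)
    then have "c \<odot>\<^bsub>A\<^esub> y \<in> cls (c \<odot>\<^bsub>A\<^esub> x)"
      using smult_ideal[OF i(1)] unfolding a_r_coset_def' by simp blast
    then show ?thesis
      using a_repr_independence[OF _ smult_closed[OF assms] a_subgroup] by simp
  qed
  have "cls x \<noteq> {}" using a_rcos_self[OF assms] by blast
  then show ?thesis
    unfolding quot_algebra_simps using * by (rule SUP_eq_const)
qed

lemma carrier_quot: "carrier (quot_algebra A I) = cls ` carrier A"
  by (auto simp: FactRing_simps)

lemma cls_carrier: "x \<in> carrier A \<Longrightarrow> cls x \<in> carrier (quot_algebra A I)"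
  by (simp only: carrier_quot imageI)

lemma cls_mult: "x \<in> carrier A \<Longrightarrow> y \<in> carrier A \<Longrightarrow>
    cls x \<otimes>\<^bsub>quot_algebra A I\<^esub> cls y = cls (x \<otimes>\<^bsub>A\<^esub> y)"
  by (simp add: FactRing_def rcoset_mult_add)

lemma cls_add: "x \<in> carrier A \<Longrightarrow> y \<in> carrier A \<Longrightarrow>
    cls x \<oplus>\<^bsub>quot_algebra A I\<^esub> cls y = cls (x \<oplus>\<^bsub>A\<^esub> y)"
  by (simp add: FactRing_def a_rcos_sum)

lemma cls_one: "\<one>\<^bsub>quot_algebra A I\<^esub> = cls \<one>\<^bsub>A\<^esub>"
  by (simp add: FactRing_def)

lemma cls_eq_iff: "x \<in> carrier A \<Longrightarrow> y \<in> carrier A \<Longrightarrow> cls x = cls y \<longleftrightarrow> x \<ominus>\<^bsub>A\<^esub> y \<in> I"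
  using quotient_eq_iff_same_a_r_cos[OF is_ideal] by blast

lemma cls_ideal: "x \<in> I \<Longrightarrow> cls x = \<zero>\<^bsub>quot_algebra A I\<^esub>"
  by (simp add: FactRing_def a_rcos_const)

lemma field_algebra_quot: "field_algebra (quot_algebra A I)"
proof (rule field_algebraI)
  show "ring (quot_algebra A I)"
    using quotient_is_ring by (rule ring_cong) simp_all
qed (auto simp only: carrier_quot smult_cls cls_mult cls_add smult_closed m_closed add.m_closed imageI
       smult_l_distr smult_r_distr smult_assoc smult_one smult_mult_l smult_mult_r)

lemma field_algebra_hom_cls: "field_algebra_hom A (quot_algebra A I) cls"
proof -
  interpret Q: field_algebra "quot_algebra A I" by (rule field_algebra_quot)
  show ?thesis
    by unfold_locales
      (auto intro!: ring_hom_memI simp: cls_mult cls_add cls_one cls_carrier smult_cls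
        simp del: quot_algebra_simps)
qed

text \<open>The universal property of the quotient, for the map in its \<open>the_elem\<close> form,
  so that it applies verbatim to the comultiplication, the antipode and maps out of a tensor
  product.\<close>

lemma induced_hom:
  assumes "field_algebra_hom A B h" "\<And>x. x \<in> I \<Longrightarrow> h x = \<zero>\<^bsub>B\<^esub>"
  shows "field_algebra_hom (quot_algebra A I) B (\<lambda>C. the_elem (h ` C))"
proof -
  interpret h: field_algebra_hom A B h by fact
  interpret Q: field_algebra "quot_algebra A I" by (rule field_algebra_quot)
  have v: "the_elem (h ` cls x) = h x" if "x \<in> carrier A" for x
    using h.the_elem_coset[OF is_ideal assms(2) that] .
  show ?thesis
    by unfold_locales
      (auto intro!: ring_hom_memI simp: cls_mult cls_add cls_one smult_cls carrier_quot v
        simp del: quot_algebra_simps)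
qed

end

section \<open>Monoid algebras and free algebras\<close>

lemma lookup_scale: "Poly_Mapping.lookup (Poly_Mapping.map (\<lambda>x. c * x) f) u = c * Poly_Mapping.lookup f u"
  for c :: "'k::field"
  by (simp add: map.rep_eq when_def)

lemma keys_scale: "Poly_Mapping.keys (Poly_Mapping.map (\<lambda>x. c * x) f) \<subseteq> Poly_Mapping.keys f"
  for c :: "'k::field"
  by (auto simp: in_keys_iff lookup_scale)

lemma scale_single:
  "Poly_Mapping.map (\<lambda>x. c * x) (Poly_Mapping.single u a) = Poly_Mapping.single u (c * a)"
  for c :: "'k::field"
  by (rule poly_mapping_eqI) (simp add: lookup_scale lookup_single when_def)

lemma scale_sum:
  "Poly_Mapping.map (\<lambda>x. c * x) (\<Sum>i\<in>I. f i) = (\<Sum>i\<in>I. Poly_Mapping.map (\<lambda>x. c * x) (f i))"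
  for c :: "'k::field"
  by (rule poly_mapping_eqI) (simp add: lookup_scale lookup_sum sum_distrib_left)

lemma keys_add_subset:
  "Poly_Mapping.keys f \<subseteq> S \<Longrightarrow> Poly_Mapping.keys g \<subseteq> S \<Longrightarrow> Poly_Mapping.keys (f + g) \<subseteq> S"
  using keys_add[of f g] by blast

lemma sum_single_lookup: "(\<Sum>u\<in>Poly_Mapping.keys f. Poly_Mapping.single u (Poly_Mapping.lookup f u)) = f"
  by (rule poly_mapping_eqI) (simp add: lookup_sum lookup_single when_def in_keys_iff)

text \<open>Keeping the keys inside \<open>S\<close> throughout the induction makes the closure
  facts for the carrier available in every case.\<close>

lemma poly_mapping_single_induct [consumes 1, case_names zero single add]:
  fixes f :: "'a \<Rightarrow>\<^sub>0 'k::comm_monoid_add"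
  assumes "Poly_Mapping.keys f \<subseteq> S" "P 0"
    and single: "\<And>u c. u \<in> S \<Longrightarrow> P (Poly_Mapping.single u c)"
    and add: "\<And>f g. Poly_Mapping.keys f \<subseteq> S \<Longrightarrow> Poly_Mapping.keys g \<subseteq> S \<Longrightarrow> P f \<Longrightarrow> P g \<Longrightarrow> P (f + g)"
  shows "P f"
proof -
  have *: "P (\<Sum>u\<in>U. Poly_Mapping.single u (Poly_Mapping.lookup f u)) \<and>
      Poly_Mapping.keys (\<Sum>u\<in>U. Poly_Mapping.single u (Poly_Mapping.lookup f u)) \<subseteq> S"
    if "finite U" "U \<subseteq> S" for U
    using that
  proof (induction U)
    case (insert u U)
    have "Poly_Mapping.keys (Poly_Mapping.single u (Poly_Mapping.lookup f u)) \<subseteq> S"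
      using insert.prems by simp
    then show ?case
      using insert keys_add[of "Poly_Mapping.single u (Poly_Mapping.lookup f u)" "\<Sum>u\<in>U. Poly_Mapping.single u (Poly_Mapping.lookup f u)"]
      by (auto intro!: add single)
  qed (simp add: assms(2))
  show ?thesis
    using *[OF _ assms(1)] by (simp add: sum_single_lookup)
qed

lemma monoid_algebra_simps [simp]:
  "carrier (monoid_algebra M) = {f. Poly_Mapping.keys f \<subseteq> carrier M}"
  "one (monoid_algebra M) = Poly_Mapping.single \<one>\<^bsub>M\<^esub> 1"
  "ring.zero (monoid_algebra M) = 0"
  "add (monoid_algebra M) = (+)"
  "smult (monoid_algebra M) = (\<lambda>c f. Poly_Mapping.map (\<lambda>x. c * x) f)"
  by (simp_all add: monoid_algebra_def)

text \<open>Sums over the exact key sets do not match up under addition, where keys can cancel.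
  Larger index sets let both sides of a distributive law run over the same indices.\<close>

lemma monoid_algebra_mult:
  assumes "finite U" "finite V" "Poly_Mapping.keys f \<subseteq> U" "Poly_Mapping.keys g \<subseteq> V"
  shows "f \<otimes>\<^bsub>monoid_algebra M\<^esub> g =
    (\<Sum>u\<in>U. \<Sum>v\<in>V. Poly_Mapping.single (u \<otimes>\<^bsub>M\<^esub> v) (Poly_Mapping.lookup f u * Poly_Mapping.lookup g v))"
proof -
  have "f \<otimes>\<^bsub>monoid_algebra M\<^esub> g =
      (\<Sum>u\<in>Poly_Mapping.keys f. \<Sum>v\<in>V. Poly_Mapping.single (u \<otimes>\<^bsub>M\<^esub> v) (Poly_Mapping.lookup f u * Poly_Mapping.lookup g v))"
    unfolding monoid_algebra_def monoid.select_convs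
    using assms by (intro sum.cong sum.mono_neutral_left) (auto simp: in_keys_iff)
  also have "\<dots> = (\<Sum>u\<in>U. \<Sum>v\<in>V. Poly_Mapping.single (u \<otimes>\<^bsub>M\<^esub> v) (Poly_Mapping.lookup f u * Poly_Mapping.lookup g v))"
    using assms by (intro sum.mono_neutral_left) (auto simp: in_keys_iff)
  finally show ?thesis .
qed

lemma monoid_algebra_mult_single [simp]:
  "Poly_Mapping.single u a \<otimes>\<^bsub>monoid_algebra M\<^esub> Poly_Mapping.single v b =
    Poly_Mapping.single (u \<otimes>\<^bsub>M\<^esub> v) (a * b)"
  by (subst monoid_algebra_mult[of "{u}" "{v}"]) auto

lemma monoid_algebra_add_mult:
  "(f + g) \<otimes>\<^bsub>monoid_algebra M\<^esub> h = f \<otimes>\<^bsub>monoid_algebra M\<^esub> h + g \<otimes>\<^bsub>monoid_algebra M\<^esub> h"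
proof -
  let ?U = "Poly_Mapping.keys f \<union> Poly_Mapping.keys g" and ?V = "Poly_Mapping.keys h"
  note e = monoid_algebra_mult[of ?U ?V _ _ M]
  show ?thesis
    by (subst (1 2 3) e)
      (use keys_add[of f g] in \<open>auto simp: lookup_add distrib_right single_add sum.distrib\<close>)
qed

lemma monoid_algebra_mult_add:
  "h \<otimes>\<^bsub>monoid_algebra M\<^esub> (f + g) = h \<otimes>\<^bsub>monoid_algebra M\<^esub> f + h \<otimes>\<^bsub>monoid_algebra M\<^esub> g"
proof -
  let ?U = "Poly_Mapping.keys f \<union> Poly_Mapping.keys g" and ?V = "Poly_Mapping.keys h"
  note e = monoid_algebra_mult[of ?V ?U _ _ M]
  show ?thesis
    by (subst (1 2 3) e)
      (use keys_add[of f g] in \<open>auto simp: lookup_add distrib_left single_add sum.distrib\<close>)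
qed

lemma monoid_algebra_zero_mult [simp]:
  "0 \<otimes>\<^bsub>monoid_algebra M\<^esub> f = 0" "f \<otimes>\<^bsub>monoid_algebra M\<^esub> 0 = 0"
  by (simp_all add: monoid_algebra_def)

lemma monoid_algebra_scale_mult:
  "Poly_Mapping.map (\<lambda>x. c * x) f \<otimes>\<^bsub>monoid_algebra M\<^esub> g =
    Poly_Mapping.map (\<lambda>x. c * x) (f \<otimes>\<^bsub>monoid_algebra M\<^esub> g)"
  "f \<otimes>\<^bsub>monoid_algebra M\<^esub> Poly_Mapping.map (\<lambda>x. c * x) g =
    Poly_Mapping.map (\<lambda>x. c * x) (f \<otimes>\<^bsub>monoid_algebra M\<^esub> g)"
proof -
  note e = monoid_algebra_mult[of "Poly_Mapping.keys f" "Poly_Mapping.keys g" _ _ M]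
  show "Poly_Mapping.map (\<lambda>x. c * x) f \<otimes>\<^bsub>monoid_algebra M\<^esub> g =
    Poly_Mapping.map (\<lambda>x. c * x) (f \<otimes>\<^bsub>monoid_algebra M\<^esub> g)"
    by (subst (1 2) e) (simp_all add: keys_scale lookup_scale scale_sum scale_single mult.assoc)
  show "f \<otimes>\<^bsub>monoid_algebra M\<^esub> Poly_Mapping.map (\<lambda>x. c * x) g =
    Poly_Mapping.map (\<lambda>x. c * x) (f \<otimes>\<^bsub>monoid_algebra M\<^esub> g)"
    by (subst (1 2) e) (simp_all add: keys_scale lookup_scale scale_sum scale_single mult.left_commute)
qed

lemma scale_add:
  "Poly_Mapping.map (\<lambda>x. c * x) (f + g) = Poly_Mapping.map (\<lambda>x. c * x) f + Poly_Mapping.map (\<lambda>x. c * x) g"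
  "Poly_Mapping.map (\<lambda>x. (c + d) * x) f = Poly_Mapping.map (\<lambda>x. c * x) f + Poly_Mapping.map (\<lambda>x. d * x) f"
  "Poly_Mapping.map (\<lambda>x. (c * d) * x) f = Poly_Mapping.map (\<lambda>x. c * x) (Poly_Mapping.map (\<lambda>x. d * x) f)"
  for c :: "'k::field"
  by (rule poly_mapping_eqI, simp only: lookup_scale lookup_add, simp only: distrib_left distrib_right mult.assoc)+

lemma scale_one: "Poly_Mapping.map ((*) 1) f = f" for f :: "'a \<Rightarrow>\<^sub>0 'k::field"
  by (rule poly_mapping_eqI) (simp only: lookup_scale, simp)

context Group.monoid
begin

lemma monoid_algebra_closed:
  assumes "Poly_Mapping.keys f \<subseteq> carrier G" "Poly_Mapping.keys g \<subseteq> carrier G"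
  shows "Poly_Mapping.keys (f \<otimes>\<^bsub>monoid_algebra G\<^esub> g) \<subseteq> carrier G"
  using assms(1)
proof (induction rule: poly_mapping_single_induct)
  case (single u c)
  show ?case using assms(2)
  proof (induction rule: poly_mapping_single_induct)
    case (add f g)
    then show ?case by (simp add: monoid_algebra_mult_add keys_add_subset)
  qed (use single in auto)
next
  case (add f f')
  then show ?case by (simp add: monoid_algebra_add_mult keys_add_subset)
qed simp

lemma monoid_algebra_assoc:
  assumes "Poly_Mapping.keys f \<subseteq> carrier G" "Poly_Mapping.keys g \<subseteq> carrier G" "Poly_Mapping.keys h \<subseteq> carrier G"
  shows "(f \<otimes>\<^bsub>monoid_algebra G\<^esub> g) \<otimes>\<^bsub>monoid_algebra G\<^esub> h = f \<otimes>\<^bsub>monoid_algebra G\<^esub> (g \<otimes>\<^bsub>monoid_algebra G\<^esub> h)"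
  using assms(1)
proof (induction rule: poly_mapping_single_induct)
  case u: (single u a)
  show ?case using assms(2)
  proof (induction rule: poly_mapping_single_induct)
    case v: (single v b)
    show ?case using assms(3)
    proof (induction rule: poly_mapping_single_induct)
      case (single w c)
      then show ?case using u v by (simp add: m_assoc mult.assoc)
    qed (simp_all add: monoid_algebra_mult_add)
  qed (simp_all add: monoid_algebra_add_mult monoid_algebra_mult_add)
qed (simp_all add: monoid_algebra_add_mult)

lemma monoid_algebra_one:
  assumes "Poly_Mapping.keys f \<subseteq> carrier G"
  shows "Poly_Mapping.single \<one> 1 \<otimes>\<^bsub>monoid_algebra G\<^esub> f = f" "f \<otimes>\<^bsub>monoid_algebra G\<^esub> Poly_Mapping.single \<one> 1 = f"
  using assms
  by (induction rule: poly_mapping_single_induct)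
    (simp_all add: monoid_algebra_add_mult monoid_algebra_mult_add)

lemma field_algebra_monoid_algebra: "field_algebra (monoid_algebra G :: ('k::field, _) module)"
proof (rule field_algebraI)
  let ?A = "monoid_algebra G :: ('k, _) module"
  show "ring ?A"
  proof (intro ringI abelian_groupI monoidI)
    show "\<exists>y\<in>carrier ?A. y \<oplus>\<^bsub>?A\<^esub> x = \<zero>\<^bsub>?A\<^esub>" if "x \<in> carrier ?A" for x
      using that by (intro bexI[of _ "- x"]) auto
  qed (simp_all add: keys_add_subset monoid_algebra_closed monoid_algebra_assoc monoid_algebra_one
      monoid_algebra_add_mult monoid_algebra_mult_add add.assoc add.commute add.left_commute)
qed (simp_all add: scale_add scale_one monoid_algebra_scale_mult subset_trans[OF keys_scale])

end

text \<open>The common form of \<open>free_lift\<close>, with words as basis, and of a map on the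
  free vector space that underlies a tensor product, with pairs as basis.\<close>

definition lin_ext :: "('k::field, 'b, 'z) module_scheme \<Rightarrow> ('m \<Rightarrow> 'b) \<Rightarrow> ('m \<Rightarrow>\<^sub>0 'k) \<Rightarrow> 'b" where
  "lin_ext B g f = (\<Oplus>\<^bsub>B\<^esub>w\<in>Poly_Mapping.keys f. Poly_Mapping.lookup f w \<odot>\<^bsub>B\<^esub> g w)"

context field_algebra
begin

lemma lin_ext_superset:
  assumes "g \<in> U \<rightarrow> carrier R" "finite U" "Poly_Mapping.keys f \<subseteq> U"
  shows "lin_ext R g f = (\<Oplus>w\<in>U. Poly_Mapping.lookup f w \<odot> g w)"
  unfolding lin_ext_def
  using assms by (intro add.finprod_mono_neutral_cong_left) (auto simp: in_keys_iff Pi_iff)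

lemma lin_ext_closed:
  assumes "g \<in> S \<rightarrow> carrier R" "Poly_Mapping.keys f \<subseteq> S"
  shows "lin_ext R g f \<in> carrier R"
  unfolding lin_ext_def using assms by (intro finsum_closed) (auto simp: Pi_iff)

lemma lin_ext_zero [simp]: "lin_ext R g 0 = \<zero>"
  by (simp add: lin_ext_def)

lemma lin_ext_single:
  assumes "g u \<in> carrier R"
  shows "lin_ext R g (Poly_Mapping.single u c) = c \<odot> g u"
  using assms by (subst lin_ext_superset[of _ "{u}"]) auto

lemma lin_ext_add:
  assumes "g \<in> S \<rightarrow> carrier R" "Poly_Mapping.keys f \<subseteq> S" "Poly_Mapping.keys f' \<subseteq> S"
  shows "lin_ext R g (f + f') = lin_ext R g f \<oplus> lin_ext R g f'"
proof -
  let ?U = "Poly_Mapping.keys f \<union> Poly_Mapping.keys f'"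
  have g: "g \<in> ?U \<rightarrow> carrier R" using assms by blast
  then have "(\<Oplus>w\<in>?U. Poly_Mapping.lookup (f + f') w \<odot> g w) = (\<Oplus>w\<in>?U. Poly_Mapping.lookup f w \<odot> g w \<oplus> Poly_Mapping.lookup f' w \<odot> g w)"
    by (intro add.finprod_cong') (auto simp: lookup_add smult_l_distr Pi_iff)
  also have "\<dots> = (\<Oplus>w\<in>?U. Poly_Mapping.lookup f w \<odot> g w) \<oplus> (\<Oplus>w\<in>?U. Poly_Mapping.lookup f' w \<odot> g w)"
    using g by (intro finsum_addf) (auto simp: Pi_iff)
  finally show ?thesis
    using g keys_add[of f f'] by (simp add: lin_ext_superset[of g ?U])
qed

lemma lin_ext_scale:
  assumes "g \<in> S \<rightarrow> carrier R" "Poly_Mapping.keys f \<subseteq> S"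
  shows "lin_ext R g (Poly_Mapping.map (\<lambda>x. c * x) f) = c \<odot> lin_ext R g f"
proof -
  let ?U = "Poly_Mapping.keys f"
  have g: "g \<in> ?U \<rightarrow> carrier R" using assms by blast
  then have "(\<Oplus>w\<in>?U. (c * Poly_Mapping.lookup f w) \<odot> g w) = (\<Oplus>w\<in>?U. c \<odot> (Poly_Mapping.lookup f w \<odot> g w))"
    by (intro add.finprod_cong') (auto simp: smult_assoc Pi_iff)
  also have "\<dots> = c \<odot> (\<Oplus>w\<in>?U. Poly_Mapping.lookup f w \<odot> g w)"
    using g by (intro smult_finsum[symmetric]) (auto simp: Pi_iff)
  finally show ?thesis
    using g keys_scale[of c f] by (simp add: lin_ext_superset[of g ?U] lookup_scale)
qed

text \<open>The universal property of the monoid algebra. It is applied to the monoid of words and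
  to the product of two multiplicative monoids.\<close>

lemma lin_ext_hom:
  fixes M (structure)
  assumes "Group.monoid M" and g: "g \<in> carrier M \<rightarrow> carrier R" "g \<one>\<^bsub>M\<^esub> = \<one>"
    and gm: "\<And>u v. u \<in> carrier M \<Longrightarrow> v \<in> carrier M \<Longrightarrow> g (u \<otimes>\<^bsub>M\<^esub> v) = g u \<otimes> g v"
  shows "field_algebra_hom (monoid_algebra M) R (lin_ext R g)"
proof -
  interpret M: Group.monoid M by fact
  interpret A: field_algebra "monoid_algebra M" by (rule M.field_algebra_monoid_algebra)
  note cl = lin_ext_closed[OF g(1)]
  have s: "lin_ext R g (Poly_Mapping.single u c) = c \<odot> g u" if "u \<in> carrier M" for u c
    using g that by (intro lin_ext_single) auto
  have m: "lin_ext R g (f \<otimes>\<^bsub>monoid_algebra M\<^esub> f') = lin_ext R g f \<otimes> lin_ext R g f'"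
    if f: "Poly_Mapping.keys f \<subseteq> carrier M" "Poly_Mapping.keys f' \<subseteq> carrier M" for f f'
    using f(1)
  proof (induction rule: poly_mapping_single_induct)
    case u: (single u c)
    have gu: "g u \<in> carrier R" using g u by auto
    show ?case using f(2)
    proof (induction rule: poly_mapping_single_induct)
      case (single v d)
      have "g v \<in> carrier R" using g single by auto
      then show ?case using u single gu gm
        by (simp add: s smult_mult_l smult_mult_r smult_smult mult.commute)
    next
      case (add h h')
      then show ?case
        using u gu by (simp add: monoid_algebra_mult_add lin_ext_add[OF g(1)] M.monoid_algebra_closed cl r_distr)
    qed (use u gu in \<open>simp add: s\<close>)
  next
    case (add h h')
    then show ?case
      using f(2) by (simp add: monoid_algebra_add_mult lin_ext_add[OF g(1)] M.monoid_algebra_closed cl l_distr)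
  qed (use f(2) cl in simp)
  show ?thesis
    by unfold_locales
      (auto intro!: ring_hom_memI simp: cl m lin_ext_add[OF g(1)] lin_ext_scale[OF g(1)] s g(2))
qed

end

lemma monoid_free_monoid: "Group.monoid free_monoid"
  by (rule monoidI) (simp_all add: free_monoid_def)

lemma field_algebra_free_algebra: "field_algebra (free_algebra :: ('k::field, 'g list \<Rightarrow>\<^sub>0 'k) module)"
  unfolding free_algebra_def
  by (rule monoid.field_algebra_monoid_algebra) (rule monoid_free_monoid)

interpretation free_algebra: field_algebra "free_algebra :: ('k::field, 'g list \<Rightarrow>\<^sub>0 'k) module"
  by (rule field_algebra_free_algebra)

lemma carrier_free_algebra [simp]: "carrier free_algebra = UNIV"
  by (simp add: free_algebra_def free_monoid_def)

context field_algebra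
begin

lemma word_closed:
  assumes "range \<phi> \<subseteq> carrier R"
  shows "foldr (\<lambda>g b. \<phi> g \<otimes> b) w \<one> \<in> carrier R"
  using assms by (induction w) auto

lemma free_lift_hom:
  assumes "range \<phi> \<subseteq> carrier R"
  shows "field_algebra_hom free_algebra R (free_lift R \<phi>)"
proof -
  let ?g = "\<lambda>w. foldr (\<lambda>g b. \<phi> g \<otimes> b) w \<one>"
  have c: "\<phi> g \<in> carrier R" for g using assms by blast
  have m: "?g (u @ v) = ?g u \<otimes> ?g v" for u v
    by (induction u) (simp_all add: m_assoc word_closed[OF assms] c)
  have "free_lift R \<phi> = lin_ext R ?g"
    by (simp add: free_lift_def lin_ext_def fun_eq_iff)
  then show ?thesis
    unfolding free_algebra_def
    using lin_ext_hom[OF monoid_free_monoid, of ?g] word_closed[OF assms] m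
    by (simp add: free_monoid_def)
qed

lemma free_lift_gen:
  assumes "range \<phi> \<subseteq> carrier R"
  shows "free_lift R \<phi> (free_gen g) = \<phi> g"
proof -
  have "\<phi> g \<in> carrier R" using assms by blast
  then show ?thesis
    using lin_ext_single[of "\<lambda>w. foldr (\<lambda>g b. \<phi> g \<otimes> b) w \<one>" "[g]" 1]
    by (simp add: free_lift_def lin_ext_def free_gen_def)
qed

end

section \<open>Matrix, opposite and tensor product algebras\<close>

text \<open>The matrix with rows \<open>(a, b)\<close> and \<open>(c, d)\<close> is the tuple \<open>(a, b, c, d)\<close>.\<close>

definition mat2 :: "('k::field, 'b, 'z) module_scheme \<Rightarrow> ('k, 'b \<times> 'b \<times> 'b \<times> 'b) module" where
  "mat2 R = \<lparr>carrier = carrier R \<times> carrier R \<times> carrier R \<times> carrier R,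
     monoid.mult = (\<lambda>(a, b, c, d) (a', b', c', d').
       (a \<otimes>\<^bsub>R\<^esub> a' \<oplus>\<^bsub>R\<^esub> b \<otimes>\<^bsub>R\<^esub> c', a \<otimes>\<^bsub>R\<^esub> b' \<oplus>\<^bsub>R\<^esub> b \<otimes>\<^bsub>R\<^esub> d',
        c \<otimes>\<^bsub>R\<^esub> a' \<oplus>\<^bsub>R\<^esub> d \<otimes>\<^bsub>R\<^esub> c', c \<otimes>\<^bsub>R\<^esub> b' \<oplus>\<^bsub>R\<^esub> d \<otimes>\<^bsub>R\<^esub> d')),
     one = (\<one>\<^bsub>R\<^esub>, \<zero>\<^bsub>R\<^esub>, \<zero>\<^bsub>R\<^esub>, \<one>\<^bsub>R\<^esub>),
     ring.zero = (\<zero>\<^bsub>R\<^esub>, \<zero>\<^bsub>R\<^esub>, \<zero>\<^bsub>R\<^esub>, \<zero>\<^bsub>R\<^esub>),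
     add = (\<lambda>(a, b, c, d) (a', b', c', d').
       (a \<oplus>\<^bsub>R\<^esub> a', b \<oplus>\<^bsub>R\<^esub> b', c \<oplus>\<^bsub>R\<^esub> c', d \<oplus>\<^bsub>R\<^esub> d')),
     smult = (\<lambda>k (a, b, c, d). (k \<odot>\<^bsub>R\<^esub> a, k \<odot>\<^bsub>R\<^esub> b, k \<odot>\<^bsub>R\<^esub> c, k \<odot>\<^bsub>R\<^esub> d))\<rparr>"

lemma mat2_simps [simp]:
  "carrier (mat2 R) = carrier R \<times> carrier R \<times> carrier R \<times> carrier R"
  "(a, b, c, d) \<otimes>\<^bsub>mat2 R\<^esub> (a', b', c', d') =
       (a \<otimes>\<^bsub>R\<^esub> a' \<oplus>\<^bsub>R\<^esub> b \<otimes>\<^bsub>R\<^esub> c', a \<otimes>\<^bsub>R\<^esub> b' \<oplus>\<^bsub>R\<^esub> b \<otimes>\<^bsub>R\<^esub> d',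
        c \<otimes>\<^bsub>R\<^esub> a' \<oplus>\<^bsub>R\<^esub> d \<otimes>\<^bsub>R\<^esub> c', c \<otimes>\<^bsub>R\<^esub> b' \<oplus>\<^bsub>R\<^esub> d \<otimes>\<^bsub>R\<^esub> d')"
  "\<one>\<^bsub>mat2 R\<^esub> = (\<one>\<^bsub>R\<^esub>, \<zero>\<^bsub>R\<^esub>, \<zero>\<^bsub>R\<^esub>, \<one>\<^bsub>R\<^esub>)"
  "\<zero>\<^bsub>mat2 R\<^esub> = (\<zero>\<^bsub>R\<^esub>, \<zero>\<^bsub>R\<^esub>, \<zero>\<^bsub>R\<^esub>, \<zero>\<^bsub>R\<^esub>)"
  "(a, b, c, d) \<oplus>\<^bsub>mat2 R\<^esub> (a', b', c', d') =
       (a \<oplus>\<^bsub>R\<^esub> a', b \<oplus>\<^bsub>R\<^esub> b', c \<oplus>\<^bsub>R\<^esub> c', d \<oplus>\<^bsub>R\<^esub> d')"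
  "k \<odot>\<^bsub>mat2 R\<^esub> (a, b, c, d) = (k \<odot>\<^bsub>R\<^esub> a, k \<odot>\<^bsub>R\<^esub> b, k \<odot>\<^bsub>R\<^esub> c, k \<odot>\<^bsub>R\<^esub> d)"
  by (simp_all add: mat2_def)

lemma (in field_algebra) field_algebra_mat2: "field_algebra (mat2 R)"
proof (rule field_algebraI)
  show "ring (mat2 R)"
  proof (intro ringI abelian_groupI monoidI)
    show "\<exists>y\<in>carrier (mat2 R). y \<oplus>\<^bsub>mat2 R\<^esub> x = \<zero>\<^bsub>mat2 R\<^esub>" if "x \<in> carrier (mat2 R)" for x
      using that by (cases x) (auto simp: l_neg intro!: bexI[of _ "\<ominus> a" for a])
  qed (auto simp: a_ac m_assoc l_distr r_distr)
qed (auto simp: smult_l_distr smult_r_distr smult_assoc smult_mult_l smult_mult_r)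

lemma opposite_algebra_simps [simp]:
  "carrier (opposite_algebra A) = carrier A"
  "x \<otimes>\<^bsub>opposite_algebra A\<^esub> y = y \<otimes>\<^bsub>A\<^esub> x"
  "\<one>\<^bsub>opposite_algebra A\<^esub> = \<one>\<^bsub>A\<^esub>"
  "\<zero>\<^bsub>opposite_algebra A\<^esub> = \<zero>\<^bsub>A\<^esub>"
  "x \<oplus>\<^bsub>opposite_algebra A\<^esub> y = x \<oplus>\<^bsub>A\<^esub> y"
  "k \<odot>\<^bsub>opposite_algebra A\<^esub> x = k \<odot>\<^bsub>A\<^esub> x"
  by (simp_all add: opposite_algebra_def)

lemma field_algebra_opposite:
  assumes "field_algebra A"
  shows "field_algebra (opposite_algebra A)"
proof -
  interpret field_algebra A by fact
  show ?thesis
  proof (rule field_algebraI)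
    show "ring (opposite_algebra A)"
    proof (intro ringI abelian_groupI monoidI)
      show "\<exists>y\<in>carrier (opposite_algebra A). y \<oplus>\<^bsub>opposite_algebra A\<^esub> x = \<zero>\<^bsub>opposite_algebra A\<^esub>"
        if "x \<in> carrier (opposite_algebra A)" for x
        using that by (auto simp: l_neg intro!: bexI[of _ "\<ominus>\<^bsub>A\<^esub> x"])
    qed (auto simp: a_ac m_assoc l_distr r_distr)
  qed (auto simp: smult_l_distr smult_r_distr smult_assoc smult_mult_l smult_mult_r)
qed

lemma base_algebra_simps [simp]:
  "carrier base_algebra = UNIV" "x \<otimes>\<^bsub>base_algebra\<^esub> y = x * y" "\<one>\<^bsub>base_algebra\<^esub> = 1"
  "\<zero>\<^bsub>base_algebra\<^esub> = 0" "x \<oplus>\<^bsub>base_algebra\<^esub> y = x + y" "x \<odot>\<^bsub>base_algebra\<^esub> y = x * y"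
  by (simp_all add: base_algebra_def)

lemma field_algebra_base_algebra: "field_algebra (base_algebra :: ('k::field, 'k) module)"
proof (rule field_algebraI)
  show "ring (base_algebra :: ('k::field, 'k) module)"
  proof (intro ringI abelian_groupI monoidI)
    show "\<exists>y\<in>carrier base_algebra. y \<oplus>\<^bsub>base_algebra\<^esub> x = \<zero>\<^bsub>base_algebra\<^esub>" for x :: 'k
      by (auto intro!: exI[of _ "- x"])
  qed (simp_all add: algebra_simps)
qed (simp_all add: algebra_simps)

section \<open>Tensor products: calculation with pure tensors and maps out of the product\<close>

locale algebra_pair = A: field_algebra A + B: field_algebra B
  for A :: "('k::field, 'a, 'y) module_scheme" and B :: "('k, 'b, 'z) module_scheme"
begin

abbreviation MA :: "('k, 'a \<times> 'b \<Rightarrow>\<^sub>0 'k) module" where "MA \<equiv> monoid_algebra (A \<times>\<times> B)"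

lemma monoid_pair: "Group.monoid (A \<times>\<times> B)"
  by (intro DirProd_monoid A.monoid_axioms B.monoid_axioms)

lemma carrier_MA: "f \<in> carrier MA \<longleftrightarrow> Poly_Mapping.keys f \<subseteq> carrier A \<times> carrier B"
  by (simp add: DirProd_def)

lemma relators_carrier: "tensor_relators A B \<subseteq> carrier MA"
proof -
  have d: "Poly_Mapping.keys (f - g) \<subseteq> S" if "Poly_Mapping.keys f \<subseteq> S" "Poly_Mapping.keys g \<subseteq> S"
    for f g :: "'a \<times> 'b \<Rightarrow>\<^sub>0 'k" and S
    using that keys_diff[of f g] by blast
  have s: "Poly_Mapping.keys (Poly_Mapping.single p c) \<subseteq> S" if "p \<in> S" for p S and c :: 'k
    using that by simp
  show ?thesis
    unfolding tensor_relators_def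
    by ((rule subsetI, unfold carrier_MA, elim UnE CollectE exE conjE); hypsubst;
        (intro d s SigmaI; simp))
qed

sublocale MA: field_algebra MA
  by (rule monoid.field_algebra_monoid_algebra[OF monoid_pair])

sublocale T: algebra_ideal MA "tensor_ideal A B"
  unfolding tensor_ideal_def algebra_ideal_def
  by (intro conjI MA.field_algebra_axioms MA.genideal_ideal relators_carrier)

abbreviation T where "T \<equiv> tensor_algebra A B"
abbreviation pure where "pure \<equiv> pure_tensor A B"

lemma pure_conv_cls: "pure a b = T.cls (Poly_Mapping.single (a, b) 1)"
  by (simp add: pure_tensor_def)

sublocale TA: field_algebra T
  unfolding tensor_algebra_def by (rule T.field_algebra_quot)

lemma single_carrier: "a \<in> carrier A \<Longrightarrow> b \<in> carrier B \<Longrightarrow> Poly_Mapping.single (a, b) c \<in> carrier MA"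
  by (simp add: DirProd_def)

lemma pure_closed [simp, intro]: "a \<in> carrier A \<Longrightarrow> b \<in> carrier B \<Longrightarrow> pure a b \<in> carrier T"
  unfolding pure_conv_cls tensor_algebra_def by (intro T.cls_carrier single_carrier)

lemma pure_mult:
  assumes "a \<in> carrier A" "b \<in> carrier B" "a' \<in> carrier A" "b' \<in> carrier B"
  shows "pure a b \<otimes>\<^bsub>T\<^esub> pure a' b' = pure (a \<otimes>\<^bsub>A\<^esub> a') (b \<otimes>\<^bsub>B\<^esub> b')"
  unfolding pure_conv_cls tensor_algebra_def
  by (subst T.cls_mult) (use assms in \<open>simp_all add: DirProd_def\<close>)

lemma pure_one: "\<one>\<^bsub>T\<^esub> = pure \<one>\<^bsub>A\<^esub> \<one>\<^bsub>B\<^esub>"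
  unfolding pure_conv_cls tensor_algebra_def by (subst T.cls_one) (simp add: DirProd_def)

lemma MA_minus:
  assumes "f \<in> carrier MA" "g \<in> carrier MA"
  shows "f \<ominus>\<^bsub>MA\<^esub> g = f - g"
proof -
  have "\<ominus>\<^bsub>MA\<^esub> g = - g"
    using assms by (intro MA.minus_equality) auto
  then show ?thesis by (simp add: a_minus_def)
qed

lemma cls_eqI:
  assumes "f - g \<in> tensor_relators A B" "f \<in> carrier MA" "g \<in> carrier MA"
  shows "T.cls f = T.cls g"
  using assms T.cls_eq_iff[of f g] MA.genideal_self[OF relators_carrier]
  by (auto simp: MA_minus tensor_ideal_def simp del: monoid_algebra_simps)

text \<open>Moves the scalar into the coefficient of the basis element, which is the form in which
  the relators contain it.\<close>

lemma pure_smult: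
  assumes "a \<in> carrier A" "b \<in> carrier B"
  shows "c \<odot>\<^bsub>T\<^esub> pure a b = T.cls (Poly_Mapping.single (a, b) c)"
  unfolding pure_conv_cls tensor_algebra_def
  by (subst T.smult_cls) (use assms in \<open>simp_all add: DirProd_def scale_single\<close>)

lemma pure_smult_l:
  assumes "a \<in> carrier A" "b \<in> carrier B"
  shows "pure (c \<odot>\<^bsub>A\<^esub> a) b = c \<odot>\<^bsub>T\<^esub> pure a b"
  unfolding pure_smult[OF assms] unfolding pure_conv_cls
  using assms by (intro cls_eqI single_carrier) (auto simp: tensor_relators_def)

lemma pure_smult_r:
  assumes "a \<in> carrier A" "b \<in> carrier B"
  shows "pure a (c \<odot>\<^bsub>B\<^esub> b) = c \<odot>\<^bsub>T\<^esub> pure a b"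
  unfolding pure_smult[OF assms] unfolding pure_conv_cls
  using assms by (intro cls_eqI single_carrier) (auto simp: tensor_relators_def)

lemma pure_add_l:
  assumes "a \<in> carrier A" "a' \<in> carrier A" "b \<in> carrier B"
  shows "pure (a \<oplus>\<^bsub>A\<^esub> a') b = pure a b \<oplus>\<^bsub>T\<^esub> pure a' b"
  unfolding pure_conv_cls tensor_algebra_def
proof (subst T.cls_add)
  have "Poly_Mapping.single (a \<oplus>\<^bsub>A\<^esub> a', b) 1 - Poly_Mapping.single (a, b) 1 - Poly_Mapping.single (a', b) 1
      \<in> tensor_relators A B"
    using assms by (auto simp: tensor_relators_def)
  then show "T.cls (Poly_Mapping.single (a \<oplus>\<^bsub>A\<^esub> a', b) 1) =
      T.cls (Poly_Mapping.single (a, b) 1 \<oplus>\<^bsub>MA\<^esub> Poly_Mapping.single (a', b) 1)"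
    using assms by (intro cls_eqI single_carrier MA.add.m_closed) (simp_all add: diff_diff_eq)
qed (use assms in \<open>simp_all add: DirProd_def\<close>)

lemma pure_add_r:
  assumes "a \<in> carrier A" "b \<in> carrier B" "b' \<in> carrier B"
  shows "pure a (b \<oplus>\<^bsub>B\<^esub> b') = pure a b \<oplus>\<^bsub>T\<^esub> pure a b'"
  unfolding pure_conv_cls tensor_algebra_def
proof (subst T.cls_add)
  have "Poly_Mapping.single (a, b \<oplus>\<^bsub>B\<^esub> b') 1 - Poly_Mapping.single (a, b) 1 - Poly_Mapping.single (a, b') 1
      \<in> tensor_relators A B"
    using assms by (auto simp: tensor_relators_def)
  then show "T.cls (Poly_Mapping.single (a, b \<oplus>\<^bsub>B\<^esub> b') 1) =
      T.cls (Poly_Mapping.single (a, b) 1 \<oplus>\<^bsub>MA\<^esub> Poly_Mapping.single (a, b') 1)"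
    using assms by (intro cls_eqI single_carrier MA.add.m_closed) (simp_all add: diff_diff_eq)
qed (use assms in \<open>simp_all add: DirProd_def\<close>)

lemma pure_zero_l [simp]: "b \<in> carrier B \<Longrightarrow> pure \<zero>\<^bsub>A\<^esub> b = \<zero>\<^bsub>T\<^esub>"
  using pure_smult_l[of "\<zero>\<^bsub>A\<^esub>" b 0] by simp

lemma pure_zero_r [simp]: "a \<in> carrier A \<Longrightarrow> pure a \<zero>\<^bsub>B\<^esub> = \<zero>\<^bsub>T\<^esub>"
  using pure_smult_r[of a "\<zero>\<^bsub>B\<^esub>" 0] by simp

lemma pure_pow:
  assumes "a \<in> carrier A" "b \<in> carrier B"
  shows "pure a b [^]\<^bsub>T\<^esub> (n::nat) = pure (a [^]\<^bsub>A\<^esub> n) (b [^]\<^bsub>B\<^esub> n)"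
  using assms by (induction n) (simp_all add: pure_one pure_mult)

text \<open>
  Multiplicativity of \<open>g\<close> is what makes the linear extension vanish on the whole ideal, and not just
  on the bilinearity relators that generate it.
\<close>

lemma tensor_hom:
  fixes C :: "('k, 'c, 'x) module_scheme" and g :: "'a \<Rightarrow> 'b \<Rightarrow> 'c"
  assumes "field_algebra C"
    and cl: "\<And>a b. a \<in> carrier A \<Longrightarrow> b \<in> carrier B \<Longrightarrow> g a b \<in> carrier C"
    and one: "g \<one>\<^bsub>A\<^esub> \<one>\<^bsub>B\<^esub> = \<one>\<^bsub>C\<^esub>"
    and mult: "\<And>a b a' b'. a \<in> carrier A \<Longrightarrow> b \<in> carrier B \<Longrightarrow> a' \<in> carrier A \<Longrightarrow> b' \<in> carrier B \<Longrightarrow>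
      g (a \<otimes>\<^bsub>A\<^esub> a') (b \<otimes>\<^bsub>B\<^esub> b') = g a b \<otimes>\<^bsub>C\<^esub> g a' b'"
    and add_l: "\<And>a a' b. a \<in> carrier A \<Longrightarrow> a' \<in> carrier A \<Longrightarrow> b \<in> carrier B \<Longrightarrow>
      g (a \<oplus>\<^bsub>A\<^esub> a') b = g a b \<oplus>\<^bsub>C\<^esub> g a' b"
    and add_r: "\<And>a b b'. a \<in> carrier A \<Longrightarrow> b \<in> carrier B \<Longrightarrow> b' \<in> carrier B \<Longrightarrow>
      g a (b \<oplus>\<^bsub>B\<^esub> b') = g a b \<oplus>\<^bsub>C\<^esub> g a b'"
    and smult_l: "\<And>c a b. a \<in> carrier A \<Longrightarrow> b \<in> carrier B \<Longrightarrow> g (c \<odot>\<^bsub>A\<^esub> a) b = c \<odot>\<^bsub>C\<^esub> g a b"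
    and smult_r: "\<And>c a b. a \<in> carrier A \<Longrightarrow> b \<in> carrier B \<Longrightarrow> g a (c \<odot>\<^bsub>B\<^esub> b) = c \<odot>\<^bsub>C\<^esub> g a b"
  shows "\<exists>h. field_algebra_hom T C h \<and> (\<forall>a\<in>carrier A. \<forall>b\<in>carrier B. h (pure a b) = g a b)"
proof -
  interpret C: field_algebra C by fact
  let ?h = "lin_ext C (\<lambda>(a, b). g a b)"
  have "field_algebra_hom MA C ?h"
    by (rule C.lin_ext_hom[OF monoid_pair]) (auto simp: DirProd_def cl one mult)
  then interpret h: field_algebra_hom MA C ?h .
  have s: "?h (Poly_Mapping.single (a, b) c) = c \<odot>\<^bsub>C\<^esub> g a b" if "a \<in> carrier A" "b \<in> carrier B" for a b c
    using C.lin_ext_single[of "\<lambda>(a, b). g a b" "(a, b)" c] that cl by simp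
  have d: "?h (x - y) = ?h x \<ominus>\<^bsub>C\<^esub> ?h y" if "x \<in> carrier MA" "y \<in> carrier MA" for x y
    using h.hom_minus[OF that] MA_minus[OF that] by simp
  have k: "?h x = \<zero>\<^bsub>C\<^esub>" if "x \<in> tensor_ideal A B" for x
  proof (rule h.Idl_kernel[OF relators_carrier])
    show "x \<in> Idl\<^bsub>MA\<^esub> tensor_relators A B" using that by (simp add: tensor_ideal_def)
    have sc: "x - y \<in> carrier MA" if "x \<in> carrier MA" "y \<in> carrier MA" for x y
      using MA_minus[OF that] MA.minus_closed[OF that] by simp
    fix r assume "r \<in> tensor_relators A B"
    then consider
      (1) a a' b where "r = Poly_Mapping.single (a \<oplus>\<^bsub>A\<^esub> a', b) 1 - Poly_Mapping.single (a, b) 1 - Poly_Mapping.single (a', b) 1"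
        "a \<in> carrier A" "a' \<in> carrier A" "b \<in> carrier B"
    | (2) a b b' where "r = Poly_Mapping.single (a, b \<oplus>\<^bsub>B\<^esub> b') 1 - Poly_Mapping.single (a, b) 1 - Poly_Mapping.single (a, b') 1"
        "a \<in> carrier A" "b \<in> carrier B" "b' \<in> carrier B"
    | (3) c a b where "r = Poly_Mapping.single (c \<odot>\<^bsub>A\<^esub> a, b) 1 - Poly_Mapping.single (a, b) c"
        "a \<in> carrier A" "b \<in> carrier B"
    | (4) c a b where "r = Poly_Mapping.single (a, c \<odot>\<^bsub>B\<^esub> b) 1 - Poly_Mapping.single (a, b) c"
        "a \<in> carrier A" "b \<in> carrier B"
      unfolding tensor_relators_def by blast
    then show "?h r = \<zero>\<^bsub>C\<^esub>"
    proof cases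
      case 1
      then show ?thesis
        by (simp add: d sc single_carrier s add_l cl a_minus_def C.a_ac C.r_neg C.r_neg2 del: monoid_algebra_simps)
    next
      case 2
      then show ?thesis
        by (simp add: d sc single_carrier s add_r cl a_minus_def C.a_ac C.r_neg C.r_neg2 del: monoid_algebra_simps)
    next
      case 3
      then show ?thesis
        by (simp add: d sc single_carrier s smult_l cl a_minus_def C.r_neg del: monoid_algebra_simps)
    next
      case 4
      then show ?thesis
        by (simp add: d sc single_carrier s smult_r cl a_minus_def C.r_neg del: monoid_algebra_simps)
    qed
  qed
  show ?thesis
  proof (intro exI conjI ballI)
    show "field_algebra_hom T C (\<lambda>C. the_elem (?h ` C))"
      unfolding tensor_algebra_def by (rule T.induced_hom[OF h.field_algebra_hom_axioms k])
    show "the_elem (?h ` pure a b) = g a b" if "a \<in> carrier A" "b \<in> carrier B" for a b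
      unfolding pure_conv_cls
      using h.the_elem_coset[OF T.is_ideal k single_carrier[OF that]] s[OF that] cl[OF that] by simp
  qed
qed

end

section \<open>Powers of a sum of q-commuting elements\<close>

text \<open>The Gaussian binomial coefficient with parameter \<open>p\<close>. The Pascal recursion
  makes sense for every \<open>p\<close>, whereas the quotient of products of
  \<open>p ^ i - 1\<close> can become 0/0 at a root of unity.\<close>

fun q_binomial :: "'k::field \<Rightarrow> nat \<Rightarrow> nat \<Rightarrow> 'k" where
  "q_binomial p n 0 = 1"
| "q_binomial p 0 (Suc k) = 0"
| "q_binomial p (Suc n) (Suc k) = p ^ Suc k * q_binomial p n (Suc k) + q_binomial p n k"

text \<open>The Gaussian analogue of (k+1) C(n+1, k+1) = (n+1) C(n, k). It replaces the quotient
  formula without any division.\<close>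

lemma q_binomial_absorption:
  "(p ^ Suc k - 1) * q_binomial p (Suc n) (Suc k) = (p ^ Suc n - 1) * q_binomial p n k"
proof (induction n arbitrary: k)
  case 0
  then show ?case by (cases k) auto
next
  case (Suc m)
  show ?case
  proof (cases k)
    case 0
    then show ?thesis using Suc.IH[of 0] by (simp add: algebra_simps)
  next
    case (Suc j)
    let ?c = "q_binomial p (Suc m) k"
    have 1: "(p ^ Suc k - 1) * q_binomial p (Suc m) (Suc k) = (p ^ Suc m - 1) * q_binomial p m k"
      by (rule Suc.IH)
    have 2: "(p ^ k - 1) * ?c = (p ^ Suc m - 1) * q_binomial p m j"
      using Suc.IH[of j] by (simp only: Suc)
    have 3: "?c = p ^ k * q_binomial p m k + q_binomial p m j"
      by (simp add: Suc)
    have "(p ^ Suc k - 1) * q_binomial p (Suc (Suc m)) (Suc k) =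
        p ^ Suc k * ((p ^ Suc k - 1) * q_binomial p (Suc m) (Suc k)) + (p ^ Suc k - 1) * ?c"
      by (simp add: algebra_simps)
    \<comment> \<open>Here \<open>p ^ Suc k\<close> is split as \<open>p * p ^ k\<close>, and
      \<open>p ^ k\<close> is absorbed by 3, which says that \<open>p ^ k * q_binomial p m k\<close>
      equals \<open>?c - q_binomial p m j\<close>.\<close>
    also have "\<dots> = p * ((p ^ Suc m - 1) * (?c - q_binomial p m j)) + (p ^ Suc k - 1) * ?c"
      unfolding 1 3 by (simp add: algebra_simps)
    also have "\<dots> = p * ((p ^ Suc m - 1) * ?c - (p ^ k - 1) * ?c) + (p ^ Suc k - 1) * ?c"
      unfolding 2 by (simp add: algebra_simps)
    also have "\<dots> = (p ^ Suc (Suc m) - 1) * ?c"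
      by (simp add: algebra_simps)
    finally show ?thesis .
  qed
qed

lemma q_binomial_eq_0: "n < k \<Longrightarrow> q_binomial p n k = 0"
  by (induction p n k rule: q_binomial.induct) auto

lemma q_binomial_self [simp]: "q_binomial p n n = 1"
  by (induction n) (simp_all add: q_binomial_eq_0)

text \<open>In the absorption identity the right side vanishes because \<open>p ^ n = 1\<close>,
  while the factor \<open>p ^ k - 1\<close> on the left does not.\<close>

lemma q_binomial_root_of_unity:
  assumes "p ^ n = 1" "\<And>m. 0 < m \<Longrightarrow> m < n \<Longrightarrow> p ^ m \<noteq> 1" "0 < k" "k < n"
  shows "q_binomial p n k = 0"
proof -
  obtain j m where "k = Suc j" "n = Suc m"
    using assms(3,4) by (cases k; cases n) auto
  then show ?thesis
    using q_binomial_absorption[of p j m] assms(1) assms(2)[OF assms(3,4)] by simp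
qed

context field_algebra
begin

lemma q_commute_pow:
  assumes "x \<in> carrier R" "y \<in> carrier R" "x \<otimes> y = p \<odot> (y \<otimes> x)"
  shows "x \<otimes> y [^] (n::nat) = p ^ n \<odot> (y [^] n \<otimes> x)"
proof (induction n)
  case (Suc n)
  have "x \<otimes> y [^] Suc n = (p ^ n \<odot> (y [^] n \<otimes> x)) \<otimes> y"
    using assms(1,2) by (simp add: m_assoc[symmetric] Suc)
  also have "\<dots> = p ^ n \<odot> (y [^] n \<otimes> (p \<odot> (y \<otimes> x)))"
    using assms by (simp add: smult_mult_l m_assoc)
  also have "\<dots> = p ^ Suc n \<odot> (y [^] Suc n \<otimes> x)"
    using assms by (simp add: smult_mult_r smult_smult m_assoc mult.commute)
  finally show ?case .
qed (use assms in simp)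

text \<open>Multiplication by \<open>x\<close> on the left passes \<open>y [^] k\<close> at the cost
  of \<open>p ^ k\<close>, and multiplication by \<open>y\<close> raises \<open>k\<close>. The two
  contributions are the two terms of the Pascal recursion.\<close>

lemma q_binomial_expansion:
  assumes x: "x \<in> carrier R" and y: "y \<in> carrier R" and xy: "x \<otimes> y = p \<odot> (y \<otimes> x)"
  shows "(x \<oplus> y) [^] (n::nat) = (\<Oplus>k\<in>{..n}. q_binomial p n k \<odot> (y [^] k \<otimes> x [^] (n - k)))"
proof (induction n)
  case 0
  then show ?case using x y by simp
next
  case (Suc n)
  let ?c = "q_binomial p"
  define t where "t k = ?c n k \<odot> (y [^] k \<otimes> x [^] (n - k))" for k
  define u where "u k = (p ^ k * ?c n k) \<odot> (y [^] k \<otimes> x [^] (Suc n - k))" for k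
  define v where "v k = ?c n k \<odot> (y [^] Suc k \<otimes> x [^] (n - k))" for k
  have cl: "t k \<in> carrier R" "u k \<in> carrier R" "v k \<in> carrier R" for k
    using x y by (auto simp: t_def u_def v_def)
  have xt: "x \<otimes> t k = u k" if "k \<le> n" for k
  proof -
    have "x \<otimes> t k = ?c n k \<odot> ((x \<otimes> y [^] k) \<otimes> x [^] (n - k))"
      using x y by (simp add: t_def smult_mult_r m_assoc)
    also have "\<dots> = (p ^ k * ?c n k) \<odot> (y [^] k \<otimes> (x \<otimes> x [^] (n - k)))"
      using x y by (simp add: q_commute_pow[OF x y xy] smult_mult_l smult_smult m_assoc mult.commute)
    also have "x \<otimes> x [^] (n - k) = x [^] (Suc n - k)"
      using x that by (simp only: nat_pow_Suc2[symmetric] Suc_diff_le)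
    finally show ?thesis by (simp add: u_def)
  qed
  have yt: "y \<otimes> t k = v k" for k
    using x y unfolding t_def v_def nat_pow_Suc2[OF y] by (simp add: smult_mult_r m_assoc)
  have s: "?c (Suc n) (Suc k) \<odot> (y [^] Suc k \<otimes> x [^] (Suc n - Suc k)) = u (Suc k) \<oplus> v k" for k
    using x y by (simp add: u_def v_def smult_l_distr)
  have s0: "?c (Suc n) 0 \<odot> (y [^] (0::nat) \<otimes> x [^] (Suc n - 0)) = u 0"
    by (simp add: u_def)
  have un: "u (Suc n) = \<zero>"
    using x y by (simp add: u_def q_binomial_eq_0)
  have "(x \<oplus> y) [^] Suc n = (x \<oplus> y) \<otimes> (\<Oplus>k\<in>{..n}. t k)"
    using x y by (simp only: nat_pow_Suc2 add.m_closed Suc t_def)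
  also have "\<dots> = x \<otimes> (\<Oplus>k\<in>{..n}. t k) \<oplus> y \<otimes> (\<Oplus>k\<in>{..n}. t k)"
    using x y cl by (simp add: l_distr finsum_closed)
  also have "x \<otimes> (\<Oplus>k\<in>{..n}. t k) = (\<Oplus>k\<in>{..n}. u k)"
    using x cl by (subst finsum_rdistr) (auto intro!: add.finprod_cong' simp: xt)
  also have "(\<Oplus>k\<in>{..n}. u k) = (\<Oplus>k\<in>{..Suc n}. u k)"
    using cl by (subst finsum_Suc) (auto simp: un)
  also have "\<dots> = (\<Oplus>k\<in>{..n}. u (Suc k)) \<oplus> u 0"
    using cl by (subst finsum_Suc2) auto
  also have "y \<otimes> (\<Oplus>k\<in>{..n}. t k) = (\<Oplus>k\<in>{..n}. v k)"
    using y cl by (subst finsum_rdistr) (auto intro!: add.finprod_cong' simp: yt)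
  also have "(\<Oplus>k\<in>{..n}. u (Suc k)) \<oplus> u 0 \<oplus> (\<Oplus>k\<in>{..n}. v k) =
      (\<Oplus>k\<in>{..n}. u (Suc k) \<oplus> v k) \<oplus> u 0"
    using cl by (simp add: finsum_addf finsum_closed a_ac)
  also have "\<dots> = (\<Oplus>k\<in>{..Suc n}. ?c (Suc n) k \<odot> (y [^] k \<otimes> x [^] (Suc n - k)))"
    using x y cl by (subst finsum_Suc2) (auto simp only: s s0 smult_closed m_closed nat_pow_closed Pi_iff)
  finally show ?case .
qed

text \<open>All middle coefficients vanish at a primitive root of unity. With
  \<open>p = q ^ 2\<close> this makes the N-th powers of \<open>\<Delta>(E)\<close> and
  \<open>\<Delta>(F)\<close> zero.\<close>

lemma q_binomial_add_pow:
  assumes x: "x \<in> carrier R" and y: "y \<in> carrier R" and xy: "x \<otimes> y = p \<odot> (y \<otimes> x)"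
    and "0 < n" "p ^ n = 1" "\<And>m. 0 < m \<Longrightarrow> m < n \<Longrightarrow> p ^ m \<noteq> 1"
  shows "(x \<oplus> y) [^] (n::nat) = x [^] n \<oplus> y [^] n"
proof -
  have "(x \<oplus> y) [^] n = (\<Oplus>k\<in>{..n}. q_binomial p n k \<odot> (y [^] k \<otimes> x [^] (n - k)))"
    by (rule q_binomial_expansion[OF x y xy])
  also have "\<dots> = (\<Oplus>k\<in>{0, n}. q_binomial p n k \<odot> (y [^] k \<otimes> x [^] (n - k)))"
  proof (rule add.finprod_mono_neutral_cong_right)
    show "q_binomial p n k \<odot> (y [^] k \<otimes> x [^] (n - k)) = \<zero>" if "k \<in> {..n} - {0, n}" for k
      using x y assms(5,6) that by (auto simp: q_binomial_root_of_unity)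
  qed (use x y in auto)
  also have "\<dots> = x [^] n \<oplus> y [^] n"
    using x y \<open>0 < n\<close> by simp
  finally show ?thesis .
qed

end

section \<open>Solutions of the defining relations\<close>

locale uq_params =
  fixes N :: nat and q :: "'k::field"
  assumes N_gt_1: "N > 1" and odd_N: "odd N" and primitive: "primitive_root_of_unity N q"
begin

lemma q_pow_N [simp]: "q ^ N = 1"
  using primitive by (simp add: primitive_root_of_unity_def)

lemma q_nz [simp]: "q \<noteq> 0"
  using q_pow_N N_gt_1 by (metis zero_power less_trans zero_less_one zero_neq_one)

lemma q_pow_eq_1_iff: "q ^ m = 1 \<longleftrightarrow> N dvd m"
proof
  assume "q ^ m = 1"
  then have "q ^ (m mod N) = 1"
    using power_add[of q "N * (m div N)" "m mod N"] by (simp add: power_mult)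
  moreover have "m mod N < N" using N_gt_1 by simp
  ultimately have "m mod N = 0"
    using primitive by (auto simp: primitive_root_of_unity_def)
  then show "N dvd m" by auto
next
  assume "N dvd m"
  then show "q ^ m = 1" by (auto simp: dvd_def power_mult)
qed

text \<open>Oddness of \<open>N\<close> enters here: 2 is invertible modulo \<open>N\<close>, so
  squaring does not lower the order of \<open>q\<close>.\<close>

lemma q2_pow_eq_1_iff: "(q ^ 2) ^ m = 1 \<longleftrightarrow> N dvd m"
proof -
  have "coprime N 2" using odd_N by simp
  then show ?thesis
    unfolding power_mult[symmetric] q_pow_eq_1_iff by (simp add: coprime_dvd_mult_right_iff)
qed

lemma q2_neq_1: "q ^ 2 \<noteq> 1"
  using q2_pow_eq_1_iff[of 1] N_gt_1 by simp

lemma q_minus_inverse_nz: "q - inverse q \<noteq> 0"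
  using q2_neq_1 by (auto simp: power2_eq_square field_simps)

lemma q_pow_N_minus_1: "q ^ (N - 1) = inverse q"
  using N_gt_1 power_Suc[of q "N - 1"] by (simp add: field_simps)

end

text \<open>A solution of the defining relations in some algebra, which is the same as a
  homomorphism from \<open>U\<close>. The locale is instantiated with \<open>U\<close> itself, with
  its opposite (antipode), with its tensor square (comultiplication) and with scalar 2 by 2 matrices
  (\<open>\<rho>\<close>).\<close>

locale uq_rels = uq_params N q + field_algebra R
  for N :: nat and q :: "'k::field" and R :: "('k, 'b) module" (structure) +
  fixes \<phi> :: "uq_generator \<Rightarrow> 'b"
  assumes gen_closed [simp, intro]: "\<phi> g \<in> carrier R"
    and K_pow_N: "\<phi> gen_K [^] N = \<one>"
    and KE: "\<phi> gen_K \<otimes> \<phi> gen_E = q ^ 2 \<odot> (\<phi> gen_E \<otimes> \<phi> gen_K)"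
    and KF: "\<phi> gen_K \<otimes> \<phi> gen_F = (inverse q) ^ 2 \<odot> (\<phi> gen_F \<otimes> \<phi> gen_K)"
    and E_pow_N: "\<phi> gen_E [^] N = \<zero>"
    and F_pow_N: "\<phi> gen_F [^] N = \<zero>"
    and EF: "\<phi> gen_E \<otimes> \<phi> gen_F \<ominus> \<phi> gen_F \<otimes> \<phi> gen_E =
      inverse (q - inverse q) \<odot> (\<phi> gen_K \<ominus> \<phi> gen_K [^] (N - 1))"
begin

lemma range_gen: "range \<phi> \<subseteq> carrier R"
  by auto

sublocale lift: field_algebra_hom free_algebra R "free_lift R \<phi>"
  by (rule free_lift_hom[OF range_gen])

lemma lift_relator:
  assumes "x \<in> uq_ideal N q"
  shows "free_lift R \<phi> x = \<zero>"
proof (rule lift.Idl_kernel)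
  show "x \<in> Idl\<^bsub>free_algebra\<^esub> uq_relators N q"
    using assms by (simp add: uq_ideal_def)
  show "free_lift R \<phi> r = \<zero>" if "r \<in> uq_relators N q" for r
    using that unfolding uq_relators_def Let_def
    by (auto simp: free_lift_gen[OF range_gen] lift.hom_nat_pow K_pow_N KE KF E_pow_N F_pow_N EF)
qed simp

end

lemma algebra_ideal_uq_ideal: "algebra_ideal free_algebra (uq_ideal N q)"
  unfolding uq_ideal_def algebra_ideal_def
  by (intro conjI free_algebra.field_algebra_axioms free_algebra.genideal_ideal) simp

lemmas ideal_uq_ideal = algebra_ideal.axioms(2)[OF algebra_ideal_uq_ideal]

lemma (in uq_rels) induced_hom:
  "field_algebra_hom (uq_algebra N q) R (\<lambda>C. the_elem (free_lift R \<phi> ` C))"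
  unfolding uq_algebra_def
  by (rule algebra_ideal.induced_hom[OF algebra_ideal_uq_ideal lift.field_algebra_hom_axioms lift_relator])

lemma (in uq_rels) induced_hom_cls:
  "the_elem (free_lift R \<phi> ` (uq_ideal N q +>\<^bsub>free_algebra\<^esub> f)) = free_lift R \<phi> f"
  by (rule lift.the_elem_coset[OF ideal_uq_ideal lift_relator]) simp_all

lemma (in uq_rels) induced_hom_gen:
  "the_elem (free_lift R \<phi> ` uq_gen N q g) = \<phi> g"
  by (simp add: uq_gen_def induced_hom_cls free_lift_gen[OF range_gen])

interpretation uq_algebra: field_algebra "uq_algebra N q" for N :: nat and q :: "'k::field"
  unfolding uq_algebra_def by (rule algebra_ideal.field_algebra_quot[OF algebra_ideal_uq_ideal])

text \<open>The tautological solution: every relator lies in the ideal, so its class is zero. All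
  consequences of the relations derived in \<open>uq_rels\<close> thereby hold in
  \<open>U\<close>.\<close>

lemma (in uq_params) uq_rels_uq_algebra: "uq_rels N q (uq_algebra N q) (uq_gen N q)"
proof -
  let ?c = "\<lambda>x. uq_ideal N q +>\<^bsub>free_algebra\<^esub> x"
  interpret c: field_algebra_hom free_algebra "uq_algebra N q" ?c
    unfolding uq_algebra_def by (rule algebra_ideal.field_algebra_hom_cls[OF algebra_ideal_uq_ideal])
  have z: "?c r = \<zero>\<^bsub>uq_algebra N q\<^esub>" if "r \<in> uq_relators N q" for r
  proof -
    have "r \<in> uq_ideal N q"
      using that free_algebra.genideal_self[of "uq_relators N q"] by (auto simp: uq_ideal_def)
    then show ?thesis
      by (simp only: uq_algebra_def algebra_ideal.cls_ideal[OF algebra_ideal_uq_ideal])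
  qed
  note u = uq_gen_def uq_relators_def Let_def
  show ?thesis
  proof unfold_locales
    fix g show "uq_gen N q g \<in> carrier (uq_algebra N q)"
      unfolding uq_gen_def by simp
  next
    show "uq_gen N q gen_K [^]\<^bsub>uq_algebra N q\<^esub> N = \<one>\<^bsub>uq_algebra N q\<^esub>"
      using z[of "free_gen gen_K [^]\<^bsub>free_algebra\<^esub> N \<ominus>\<^bsub>free_algebra\<^esub> \<one>\<^bsub>free_algebra\<^esub>"]
      by (auto simp: u c.hom_nat_pow)
  next
    show "uq_gen N q gen_K \<otimes>\<^bsub>uq_algebra N q\<^esub> uq_gen N q gen_E =
        q ^ 2 \<odot>\<^bsub>uq_algebra N q\<^esub> (uq_gen N q gen_E \<otimes>\<^bsub>uq_algebra N q\<^esub> uq_gen N q gen_K)"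
      using z[of "free_gen gen_K \<otimes>\<^bsub>free_algebra\<^esub> free_gen gen_E \<ominus>\<^bsub>free_algebra\<^esub>
         q ^ 2 \<odot>\<^bsub>free_algebra\<^esub> (free_gen gen_E \<otimes>\<^bsub>free_algebra\<^esub> free_gen gen_K)"]
      by (auto simp: u)
  next
    show "uq_gen N q gen_K \<otimes>\<^bsub>uq_algebra N q\<^esub> uq_gen N q gen_F =
        (inverse q) ^ 2 \<odot>\<^bsub>uq_algebra N q\<^esub> (uq_gen N q gen_F \<otimes>\<^bsub>uq_algebra N q\<^esub> uq_gen N q gen_K)"
      using z[of "free_gen gen_K \<otimes>\<^bsub>free_algebra\<^esub> free_gen gen_F \<ominus>\<^bsub>free_algebra\<^esub>
         (inverse q) ^ 2 \<odot>\<^bsub>free_algebra\<^esub> (free_gen gen_F \<otimes>\<^bsub>free_algebra\<^esub> free_gen gen_K)"]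
      by (auto simp: u)
  next
    show "uq_gen N q gen_E [^]\<^bsub>uq_algebra N q\<^esub> N = \<zero>\<^bsub>uq_algebra N q\<^esub>"
      using z[of "free_gen gen_E [^]\<^bsub>free_algebra\<^esub> N"]
      by (auto simp: u c.hom_nat_pow)
  next
    show "uq_gen N q gen_F [^]\<^bsub>uq_algebra N q\<^esub> N = \<zero>\<^bsub>uq_algebra N q\<^esub>"
      using z[of "free_gen gen_F [^]\<^bsub>free_algebra\<^esub> N"]
      by (auto simp: u c.hom_nat_pow)
  next
    show "uq_gen N q gen_E \<otimes>\<^bsub>uq_algebra N q\<^esub> uq_gen N q gen_F
          \<ominus>\<^bsub>uq_algebra N q\<^esub> uq_gen N q gen_F \<otimes>\<^bsub>uq_algebra N q\<^esub> uq_gen N q gen_E =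
        inverse (q - inverse q) \<odot>\<^bsub>uq_algebra N q\<^esub>
          (uq_gen N q gen_K \<ominus>\<^bsub>uq_algebra N q\<^esub> uq_gen N q gen_K [^]\<^bsub>uq_algebra N q\<^esub> (N - 1))"
      using z[of "(free_gen gen_E \<otimes>\<^bsub>free_algebra\<^esub> free_gen gen_F \<ominus>\<^bsub>free_algebra\<^esub>
           free_gen gen_F \<otimes>\<^bsub>free_algebra\<^esub> free_gen gen_E) \<ominus>\<^bsub>free_algebra\<^esub>
         inverse (q - inverse q) \<odot>\<^bsub>free_algebra\<^esub>
           (free_gen gen_K \<ominus>\<^bsub>free_algebra\<^esub> free_gen gen_K [^]\<^bsub>free_algebra\<^esub> (N - 1))"]
      by (auto simp: u c.hom_nat_pow)
  qed
qed

section \<open>Relations for the antipode, the comultiplication and the two-dimensional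
  representation\<close>

context field_algebra
begin

text \<open>The scalar is \<open>p\<close> to the power n(n-1)/2. Its mere existence carries the
  nilpotency of \<open>E\<close> and \<open>F\<close> over to \<open>E \<otimes> Ki\<close> and
  \<open>K \<otimes> F\<close>.\<close>

lemma pow_q_commuting_product:
  assumes "x \<in> carrier R" "y \<in> carrier R" "y \<otimes> x = p \<odot> (x \<otimes> y)"
  shows "\<exists>s. (x \<otimes> y) [^] (n::nat) = s \<odot> (x [^] n \<otimes> y [^] n)"
proof (induction n)
  case 0
  show ?case by (rule exI[of _ 1]) simp
next
  case (Suc n)
  then obtain s where s: "(x \<otimes> y) [^] n = s \<odot> (x [^] n \<otimes> y [^] n)" by blast
  have "(x \<otimes> y) [^] Suc n = s \<odot> (x \<otimes> ((y \<otimes> x [^] n) \<otimes> y [^] n))"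
    using assms(1,2) unfolding nat_pow_Suc2[OF m_closed[OF assms(1,2)]] s
    by (simp add: smult_mult_r m_assoc)
  also have "\<dots> = (s * p ^ n) \<odot> (x [^] Suc n \<otimes> y [^] Suc n)"
    using assms(1,2) unfolding nat_pow_Suc2[OF assms(1)] nat_pow_Suc2[OF assms(2)]
    by (simp add: q_commute_pow[OF assms(2,1,3)] smult_mult_r smult_mult_l smult_smult m_assoc)
  finally show ?case by blast
qed

end

lemma opposite_pow: "x [^]\<^bsub>opposite_algebra A\<^esub> (n::nat) = x [^]\<^bsub>A\<^esub> n"
  if "field_algebra A" "x \<in> carrier A"
proof -
  interpret field_algebra A by fact
  show ?thesis
  proof (induction n)
    case (Suc n)
    have "x [^]\<^bsub>opposite_algebra A\<^esub> Suc n = x \<otimes>\<^bsub>A\<^esub> x [^]\<^bsub>opposite_algebra A\<^esub> n"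
      by (simp add: nat_pow_def)
    then show ?case by (simp only: Suc nat_pow_Suc2[OF that(2)])
  qed (simp add: nat_pow_def)
qed

context uq_rels
begin

abbreviation K where "K \<equiv> \<phi> gen_K"
abbreviation E where "E \<equiv> \<phi> gen_E"
abbreviation F where "F \<equiv> \<phi> gen_F"
text \<open>The inverse of \<open>K\<close>, in the form in which it occurs in the relator for
  \<open>E F - F E\<close>; \<open>inv_K\<close> links it to the inverse used in the structure
  maps.\<close>

definition Ki where "Ki = K [^] (N - 1)"

lemma Ki_closed [simp, intro]: "Ki \<in> carrier R"
  by (simp add: Ki_def)

lemma K_Ki [simp]: "K \<otimes> Ki = \<one>" and Ki_K [simp]: "Ki \<otimes> K = \<one>"
  using K_pow_N N_gt_1 Suc_diff_1[of N] nat_pow_Suc2[of K "N - 1"] nat_pow_Suc[of K "N - 1"]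
  by (simp_all del: nat_pow_Suc add: Ki_def)

lemma K_Ki_cancel [simp]:
  assumes "x \<in> carrier R"
  shows "K \<otimes> (Ki \<otimes> x) = x" "Ki \<otimes> (K \<otimes> x) = x"
  using assms by (simp_all add: m_assoc[symmetric])

lemma inv_K: "inv K = Ki"
  by (rule inv_unique'[symmetric]) simp_all

lemma Ki_commute:
  assumes "x \<in> carrier R" "K \<otimes> x = c \<odot> (x \<otimes> K)" "c \<noteq> 0"
  shows "Ki \<otimes> x = inverse c \<odot> (x \<otimes> Ki)"
proof -
  have "x \<otimes> Ki = Ki \<otimes> ((K \<otimes> x) \<otimes> Ki)"
    using assms(1) by (simp add: m_assoc)
  also have "\<dots> = c \<odot> (Ki \<otimes> x)"
    unfolding assms(2) using assms(1) by (simp add: m_assoc smult_mult_l smult_mult_r)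
  finally show ?thesis
    using assms(1,3) by (simp add: smult_smult)
qed

lemma Ki_E: "Ki \<otimes> E = (inverse q) ^ 2 \<odot> (E \<otimes> Ki)"
  using Ki_commute[OF _ KE] by (simp add: power_inverse)

lemma Ki_F: "Ki \<otimes> F = q ^ 2 \<odot> (F \<otimes> Ki)"
  using Ki_commute[OF _ KF] by (simp add: power_inverse)

lemma Ki_pow_N: "Ki [^] N = \<one>"
proof -
  have "Ki [^] N = (K [^] N) [^] (N - 1)"
    by (simp add: Ki_def nat_pow_pow mult.commute)
  then show ?thesis by (simp add: K_pow_N)
qed

lemma Ki_pow_N_minus_1: "Ki [^] (N - 1) = K"
proof -
  have "Ki [^] (N - 1) \<otimes> Ki = \<one>"
    using Ki_pow_N N_gt_1 nat_pow_Suc[of Ki "N - 1"] by (simp del: nat_pow_Suc)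
  then have "(Ki [^] (N - 1) \<otimes> Ki) \<otimes> K = K" by simp
  then show ?thesis by (simp add: m_assoc)
qed

lemma FK: "F \<otimes> K = q ^ 2 \<odot> (K \<otimes> F)"
  unfolding KF by (simp add: smult_smult power_mult_distrib[symmetric])

lemma EF_eq: "E \<otimes> F = F \<otimes> E \<oplus> inverse (q - inverse q) \<odot> (K \<ominus> Ki)"
  unfolding Ki_def EF[symmetric] by (simp add: minus_eq a_ac r_neg r_neg2 r_neg1)

lemma q2_inverse_cancel: "inverse q ^ 2 * q ^ 2 = 1" "q ^ 2 * inverse q ^ 2 = 1"
  by (simp_all add: power_mult_distrib[symmetric])

text \<open>Well-definedness of the antipode: its values on the generators satisfy the relations
  when products are reversed.\<close>

lemma uq_rels_opposite:
  assumes "\<psi> gen_K = Ki" "\<psi> gen_E = \<ominus> (E \<otimes> Ki)" "\<psi> gen_F = \<ominus> (K \<otimes> F)"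
  shows "uq_rels N q (opposite_algebra R) \<psi>"
proof -
  interpret O: field_algebra "opposite_algebra R"
    by (rule field_algebra_opposite) (rule field_algebra_axioms)
  note p = opposite_pow[OF field_algebra_axioms]
  have psi: "\<psi> gen_K = Ki" "\<psi> gen_E = (-1) \<odot> (E \<otimes> Ki)" "\<psi> gen_F = (-1) \<odot> (K \<otimes> F)"
    using assms by (simp_all add: a_inv_eq_smult)
  show ?thesis
  proof unfold_locales
    show "\<psi> g \<in> carrier (opposite_algebra R)" for g
      by (cases g) (simp_all add: psi)
    show "\<psi> gen_K [^]\<^bsub>opposite_algebra R\<^esub> N = \<one>\<^bsub>opposite_algebra R\<^esub>"
      by (simp add: psi p Ki_pow_N del: nat_pow_pow)
    show "\<psi> gen_K \<otimes>\<^bsub>opposite_algebra R\<^esub> \<psi> gen_E =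
        q ^ 2 \<odot>\<^bsub>opposite_algebra R\<^esub> (\<psi> gen_E \<otimes>\<^bsub>opposite_algebra R\<^esub> \<psi> gen_K)"
    proof -
      have "Ki \<otimes> (E \<otimes> Ki) = (inverse q) ^ 2 \<odot> ((E \<otimes> Ki) \<otimes> Ki)"
        by (simp add: m_assoc[symmetric] Ki_E smult_mult_l)
      then show ?thesis
        by (simp add: psi smult_mult_l smult_mult_r smult_smult q2_inverse_cancel)
    qed
    show "\<psi> gen_K \<otimes>\<^bsub>opposite_algebra R\<^esub> \<psi> gen_F =
        (inverse q) ^ 2 \<odot>\<^bsub>opposite_algebra R\<^esub> (\<psi> gen_F \<otimes>\<^bsub>opposite_algebra R\<^esub> \<psi> gen_K)"
    proof -
      have "K \<otimes> F \<otimes> Ki = (inverse q) ^ 2 \<odot> F"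
        by (simp add: KF smult_mult_l m_assoc)
      then show ?thesis
        by (simp add: psi smult_mult_l smult_mult_r smult_smult)
    qed
    have "\<exists>s. (E \<otimes> Ki) [^] N = s \<odot> (E [^] N \<otimes> Ki [^] N)"
      by (rule pow_q_commuting_product[OF _ _ Ki_E]) simp_all
    then show "\<psi> gen_E [^]\<^bsub>opposite_algebra R\<^esub> N = \<zero>\<^bsub>opposite_algebra R\<^esub>"
      by (auto simp: psi p smult_pow E_pow_N)
    have "\<exists>s. (K \<otimes> F) [^] N = s \<odot> (K [^] N \<otimes> F [^] N)"
      by (rule pow_q_commuting_product[OF _ _ FK]) simp_all
    then show "\<psi> gen_F [^]\<^bsub>opposite_algebra R\<^esub> N = \<zero>\<^bsub>opposite_algebra R\<^esub>"
      by (auto simp: psi p smult_pow F_pow_N)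
    have 1: "K \<otimes> F \<otimes> (E \<otimes> Ki) = F \<otimes> E"
    proof -
      have "K \<otimes> F \<otimes> (E \<otimes> Ki) = (inverse q) ^ 2 \<odot> (F \<otimes> ((K \<otimes> E) \<otimes> Ki))"
        by (simp add: KF m_assoc smult_mult_l)
      also have "\<dots> = F \<otimes> E"
        by (simp add: KE m_assoc smult_mult_l smult_mult_r smult_smult q2_inverse_cancel)
      finally show ?thesis .
    qed
    have 2: "E \<otimes> Ki \<otimes> (K \<otimes> F) = E \<otimes> F"
      by (simp add: m_assoc)
    show "\<psi> gen_E \<otimes>\<^bsub>opposite_algebra R\<^esub> \<psi> gen_F \<ominus>\<^bsub>opposite_algebra R\<^esub>
          \<psi> gen_F \<otimes>\<^bsub>opposite_algebra R\<^esub> \<psi> gen_E =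
        inverse (q - inverse q) \<odot>\<^bsub>opposite_algebra R\<^esub>
          (\<psi> gen_K \<ominus>\<^bsub>opposite_algebra R\<^esub> \<psi> gen_K [^]\<^bsub>opposite_algebra R\<^esub> (N - 1))"
    proof -
      have "\<psi> gen_K [^]\<^bsub>opposite_algebra R\<^esub> (N - 1) = K"
        by (simp only: psi p Ki_closed Ki_pow_N_minus_1)
      then show ?thesis
        unfolding psi
        by (simp add: p O.minus_eq_smult smult_mult_l smult_mult_r smult_smult 1 2 EF_eq
          minus_eq_smult smult_r_distr a_ac)
        (simp add: smult_uminus_l r_neg2)
    qed
  qed
qed

sublocale P: algebra_pair R R ..

text \<open>Well-definedness of the comultiplication. The nilpotency relations and the commutator of
  \<open>E\<close> and \<open>F\<close> are the ones that are not immediate.\<close>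

lemma uq_rels_tensor:
  assumes "\<psi> gen_K = pure_tensor R R K K"
    "\<psi> gen_E = pure_tensor R R E K \<oplus>\<^bsub>tensor_algebra R R\<^esub> pure_tensor R R \<one> E"
    "\<psi> gen_F = pure_tensor R R F \<one> \<oplus>\<^bsub>tensor_algebra R R\<^esub> pure_tensor R R Ki F"
  shows "uq_rels N q (tensor_algebra R R) \<psi>"
proof -
  let ?T = "tensor_algebra R R"
  note ps = P.pure_mult P.pure_smult_l P.pure_smult_r P.TA.l_distr P.TA.r_distr P.TA.smult_r_distr
    P.TA.smult_smult
  have prim: "(q ^ 2) ^ N = 1" "\<And>m. 0 < m \<Longrightarrow> m < N \<Longrightarrow> (q ^ 2) ^ m \<noteq> 1"
    by (auto simp: q2_pow_eq_1_iff dest: dvd_imp_le)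
  show ?thesis
  proof unfold_locales
    show "\<psi> g \<in> carrier ?T" for g
      by (cases g) (simp_all add: assms)
    show "\<psi> gen_K [^]\<^bsub>?T\<^esub> N = \<one>\<^bsub>?T\<^esub>"
      by (simp add: assms P.pure_pow K_pow_N P.pure_one)
    show "\<psi> gen_K \<otimes>\<^bsub>?T\<^esub> \<psi> gen_E = q ^ 2 \<odot>\<^bsub>?T\<^esub> (\<psi> gen_E \<otimes>\<^bsub>?T\<^esub> \<psi> gen_K)"
      by (simp add: assms ps KE)
    show "\<psi> gen_K \<otimes>\<^bsub>?T\<^esub> \<psi> gen_F = (inverse q) ^ 2 \<odot>\<^bsub>?T\<^esub> (\<psi> gen_F \<otimes>\<^bsub>?T\<^esub> \<psi> gen_K)"
      by (simp add: assms ps KF)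
    show "\<psi> gen_E [^]\<^bsub>?T\<^esub> N = \<zero>\<^bsub>?T\<^esub>"
      unfolding assms
    \<comment> \<open>The summands of \<open>\<Delta>(E)\<close> commute up to \<open>q ^ 2\<close>,
      since moving \<open>1 \<otimes> E\<close> past \<open>E \<otimes> K\<close> exchanges
      \<open>K\<close> and \<open>E\<close> in the second factor.\<close>
    proof (subst P.TA.q_binomial_add_pow[of _ _ "q ^ 2"])
      show "P.pure E K [^]\<^bsub>?T\<^esub> N \<oplus>\<^bsub>?T\<^esub> P.pure \<one> E [^]\<^bsub>?T\<^esub> N = \<zero>\<^bsub>?T\<^esub>"
        by (simp add: P.pure_pow E_pow_N)
    qed (use prim N_gt_1 in \<open>simp_all add: ps KE\<close>)
    show "\<psi> gen_F [^]\<^bsub>?T\<^esub> N = \<zero>\<^bsub>?T\<^esub>"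
      unfolding assms
    \<comment> \<open>The summands of \<open>\<Delta>(F)\<close> are swapped so that their
      commutation factor is \<open>q ^ 2\<close> and not its inverse.\<close>
    proof (subst P.TA.a_comm, goal_cases)
      case 3
      then show ?case
      proof (subst P.TA.q_binomial_add_pow[of _ _ "q ^ 2"])
        show "P.pure Ki F [^]\<^bsub>?T\<^esub> N \<oplus>\<^bsub>?T\<^esub> P.pure F \<one> [^]\<^bsub>?T\<^esub> N = \<zero>\<^bsub>?T\<^esub>"
          by (simp add: P.pure_pow F_pow_N)
      qed (use prim N_gt_1 in \<open>simp_all add: ps Ki_F\<close>)
    qed simp_all
    \<comment> \<open>The cross terms \<open>E Ki \<otimes> K F\<close> of
      \<open>\<Delta>(E) \<Delta>(F)\<close> and \<open>Ki E \<otimes> F K\<close> of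
      \<open>\<Delta>(F) \<Delta>(E)\<close> agree: the factors \<open>q ^ 2\<close> and its inverse
      cancel. The other cross term \<open>F \<otimes> E\<close> occurs in both products.\<close>
    have 1: "P.pure (Ki \<otimes> E) (F \<otimes> K) = P.pure (E \<otimes> Ki) (K \<otimes> F)"
      by (simp add: Ki_E FK ps q2_inverse_cancel)
    have 2: "\<psi> gen_K [^]\<^bsub>?T\<^esub> (N - 1) = P.pure Ki Ki"
      by (simp only: assms P.pure_pow gen_closed Ki_def)
    show "\<psi> gen_E \<otimes>\<^bsub>?T\<^esub> \<psi> gen_F \<ominus>\<^bsub>?T\<^esub> \<psi> gen_F \<otimes>\<^bsub>?T\<^esub> \<psi> gen_E =
        inverse (q - inverse q) \<odot>\<^bsub>?T\<^esub> (\<psi> gen_K \<ominus>\<^bsub>?T\<^esub> \<psi> gen_K [^]\<^bsub>?T\<^esub> (N - 1))"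
    proof -
      let ?c = "inverse (q - inverse q)"
      \<comment> \<open>The commutators in the first and in the second factor give
        \<open>(K - Ki) \<otimes> K\<close> and \<open>Ki \<otimes> (K - Ki)\<close>, which
        telescope to \<open>K \<otimes> K - Ki \<otimes> Ki\<close>.\<close>
      define u v where "u = ?c \<odot>\<^bsub>?T\<^esub> (P.pure K K \<ominus>\<^bsub>?T\<^esub> P.pure Ki K)"
        and "v = ?c \<odot>\<^bsub>?T\<^esub> (P.pure Ki K \<ominus>\<^bsub>?T\<^esub> P.pure Ki Ki)"
      have uv: "u \<in> carrier ?T" "v \<in> carrier ?T" by (simp_all add: u_def v_def)
      have m: "P.pure (x \<ominus> y) z = P.pure x z \<ominus>\<^bsub>?T\<^esub> P.pure y z"
        "P.pure z (x \<ominus> y) = P.pure z x \<ominus>\<^bsub>?T\<^esub> P.pure z y"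
        if "x \<in> carrier R" "y \<in> carrier R" "z \<in> carrier R" for x y z
        using that by (simp_all add: minus_eq_smult P.TA.minus_eq_smult P.pure_add_l P.pure_add_r
            P.pure_smult_l P.pure_smult_r)
      have a: "P.pure (E \<otimes> F) K = P.pure (F \<otimes> E) K \<oplus>\<^bsub>?T\<^esub> u"
        unfolding EF_eq by (simp add: P.pure_add_l P.pure_smult_l m u_def)
      have b: "P.pure Ki (E \<otimes> F) = P.pure Ki (F \<otimes> E) \<oplus>\<^bsub>?T\<^esub> v"
        unfolding EF_eq by (simp add: P.pure_add_r P.pure_smult_r m v_def)
      have "u \<oplus>\<^bsub>?T\<^esub> v = ?c \<odot>\<^bsub>?T\<^esub> (P.pure K K \<ominus>\<^bsub>?T\<^esub> P.pure Ki Ki)"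
        unfolding u_def v_def
        by (simp add: P.TA.smult_r_distr[symmetric] P.TA.minus_eq P.TA.a_assoc P.TA.r_neg1)
      moreover have "\<psi> gen_E \<otimes>\<^bsub>?T\<^esub> \<psi> gen_F = \<psi> gen_F \<otimes>\<^bsub>?T\<^esub> \<psi> gen_E \<oplus>\<^bsub>?T\<^esub> (u \<oplus>\<^bsub>?T\<^esub> v)"
        using uv by (simp add: assms P.pure_mult P.TA.l_distr P.TA.r_distr a b 1 P.TA.a_ac)
      ultimately show ?thesis
        using uv unfolding 2
        by (simp add: assms P.TA.minus_eq P.TA.a_ac P.TA.r_neg P.TA.r_neg1 P.TA.r_neg2)
    qed
  qed
qed

end

text \<open>The natural representation. Both sides of the commutator relation are the diagonal
  matrix with entries 1 and -1.\<close>

lemma (in uq_params) uq_rels_mat2: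
  assumes "\<psi> gen_K = (q, 0, 0, inverse q)" "\<psi> gen_E = (0, 1, 0, 0)" "\<psi> gen_F = (0, 0, 1, 0)"
  shows "uq_rels N q (mat2 base_algebra) \<psi>"
proof -
  interpret B: field_algebra "base_algebra :: ('k, 'k) module" by (rule field_algebra_base_algebra)
  let ?M = "mat2 (base_algebra :: ('k, 'k) module)"
  interpret M: field_algebra ?M by (rule B.field_algebra_mat2)
  have K: "\<psi> gen_K [^]\<^bsub>?M\<^esub> n = (q ^ n, 0, 0, inverse q ^ n)" for n :: nat
    by (induction n) (simp_all add: assms mult.commute)
  have nil: "x [^]\<^bsub>?M\<^esub> N = \<zero>\<^bsub>?M\<^esub>" if "x \<in> carrier ?M" "x \<otimes>\<^bsub>?M\<^esub> x = \<zero>\<^bsub>?M\<^esub>" for x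
  proof -
    obtain m where "N = Suc (Suc m)" using N_gt_1 by (metis less_imp_Suc_add add_Suc One_nat_def)
    then show ?thesis
      using that by (simp add: M.m_assoc del: mat2_simps)
  qed
  show ?thesis
  proof unfold_locales
    show "\<psi> g \<in> carrier ?M" for g
      by (cases g) (simp_all add: assms)
    show "\<psi> gen_K [^]\<^bsub>?M\<^esub> N = \<one>\<^bsub>?M\<^esub>"
      by (simp add: K power_inverse)
    show "\<psi> gen_K \<otimes>\<^bsub>?M\<^esub> \<psi> gen_E = q ^ 2 \<odot>\<^bsub>?M\<^esub> (\<psi> gen_E \<otimes>\<^bsub>?M\<^esub> \<psi> gen_K)"
      by (simp add: assms power2_eq_square)
    show "\<psi> gen_K \<otimes>\<^bsub>?M\<^esub> \<psi> gen_F = (inverse q) ^ 2 \<odot>\<^bsub>?M\<^esub> (\<psi> gen_F \<otimes>\<^bsub>?M\<^esub> \<psi> gen_K)"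
      by (simp add: assms power2_eq_square)
    show "\<psi> gen_E [^]\<^bsub>?M\<^esub> N = \<zero>\<^bsub>?M\<^esub>" "\<psi> gen_F [^]\<^bsub>?M\<^esub> N = \<zero>\<^bsub>?M\<^esub>"
      by (rule nil; simp add: assms)+
    show "\<psi> gen_E \<otimes>\<^bsub>?M\<^esub> \<psi> gen_F \<ominus>\<^bsub>?M\<^esub> \<psi> gen_F \<otimes>\<^bsub>?M\<^esub> \<psi> gen_E =
        inverse (q - inverse q) \<odot>\<^bsub>?M\<^esub> (\<psi> gen_K \<ominus>\<^bsub>?M\<^esub> \<psi> gen_K [^]\<^bsub>?M\<^esub> (N - 1))"
    proof -
      have "inverse q ^ (N - 1) = q"
        by (simp only: power_inverse q_pow_N_minus_1 inverse_inverse_eq)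
      then have "\<psi> gen_K [^]\<^bsub>?M\<^esub> (N - 1) = (inverse q, 0, 0, q)"
        by (simp only: K q_pow_N_minus_1)
      then show ?thesis
        using q_minus_inverse_nz by (simp add: assms M.minus_eq_smult nonzero_inverse_eq_divide[of "q - inverse q"]
          divide_eq_eq eq_divide_eq)
    qed
  qed
qed

section \<open>Spanning by monomials\<close>

definition linear_map :: "('k::field, 'b, 'z) module_scheme \<Rightarrow> ('b \<Rightarrow> 'b) \<Rightarrow> bool" where
  "linear_map R L \<longleftrightarrow> (\<forall>x\<in>carrier R. L x \<in> carrier R) \<and>
    (\<forall>x\<in>carrier R. \<forall>y\<in>carrier R. L (x \<oplus>\<^bsub>R\<^esub> y) = L x \<oplus>\<^bsub>R\<^esub> L y) \<and>
    (\<forall>c. \<forall>x\<in>carrier R. L (c \<odot>\<^bsub>R\<^esub> x) = c \<odot>\<^bsub>R\<^esub> L x)"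

lemma linear_map_funpow: "linear_map R L \<Longrightarrow> linear_map R (L ^^ n)"
  by (induction n) (auto simp: linear_map_def)

context field_algebra
begin

lemma linear_map_zero: "linear_map R L \<Longrightarrow> L \<zero> = \<zero>"
  unfolding linear_map_def by (metis smult_zero_l zero_closed)

lemma linear_map_finsum:
  assumes "linear_map R L" "f \<in> I \<rightarrow> carrier R"
  shows "L (\<Oplus>i\<in>I. f i) = (\<Oplus>i\<in>I. L (f i))"
  using assms(2)
proof (induction I rule: infinite_finite_induct)
  case (insert i I)
  then have "f i \<in> carrier R" "f \<in> I \<rightarrow> carrier R" "(\<lambda>i. L (f i)) \<in> I \<rightarrow> carrier R" "L (f i) \<in> carrier R"
    using assms(1) by (auto simp: linear_map_def)
  with insert show ?case
    using assms(1) by (simp add: linear_map_def finsum_closed)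
qed (simp_all add: linear_map_zero[OF assms(1)])

end

section \<open>Quantum integers\<close>

context uq_params
begin

text \<open>The symmetric quantum integer. It is the coefficient that appears when
  \<open>D_E\<close> lowers \<open>E [^] n\<close>.\<close>

definition q_int :: "nat \<Rightarrow> 'k" where
  "q_int n = (q ^ n - inverse q ^ n) / (q - inverse q)"

lemma q_int_Suc: "q_int (Suc n) = q * q_int n + inverse q ^ n"
proof -
  have "(q - inverse q) * (q * q_int n + inverse q ^ n) = q * (q ^ n - inverse q ^ n) + (q - inverse q) * inverse q ^ n"
    using q_minus_inverse_nz by (simp add: q_int_def distrib_left)
  also have "\<dots> = q ^ Suc n - inverse q ^ Suc n"
    by (simp add: algebra_simps)
  finally show ?thesis
    using q_minus_inverse_nz unfolding q_int_def[of "Suc n"]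
    by (metis nonzero_mult_div_cancel_left)
qed

lemma q_int_0 [simp]: "q_int 0 = 0"
  by (simp add: q_int_def)

lemma q_int_nz:
  assumes "0 < n" "n < N"
  shows "q_int n \<noteq> 0"
proof
  assume "q_int n = 0"
  then have "q ^ n = inverse q ^ n"
    using q_minus_inverse_nz by (simp add: q_int_def)
  then have "(q ^ 2) ^ n = (q * inverse q) ^ n"
    unfolding power2_eq_square power_mult_distrib by simp
  then show False
    using q2_pow_eq_1_iff[of n] assms by (auto dest: dvd_imp_le)
qed

text \<open>The geometric sum 1 + q^2 + ... + q^(2(n-1)). It is the coefficient that appears when
  \<open>D_F\<close> lowers \<open>F [^] n\<close>.\<close>

definition q2_int :: "nat \<Rightarrow> 'k" where
  "q2_int n = ((q ^ 2) ^ n - 1) / (q ^ 2 - 1)"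

lemma q2_int_Suc: "q2_int (Suc n) = (q ^ 2) ^ n + q2_int n"
  using q2_neq_1 by (simp add: q2_int_def field_simps)

lemma q2_int_0 [simp]: "q2_int 0 = 0"
  by (simp add: q2_int_def)

lemma q2_int_nz:
  assumes "0 < n" "n < N"
  shows "q2_int n \<noteq> 0"
  using q2_pow_eq_1_iff[of n] assms q2_neq_1 by (auto simp: q2_int_def dest: dvd_imp_le)

end

section \<open>Reduction to the monomials \<open>F^a E^b K^c\<close>\<close>

context uq_rels
begin

fun mon :: "nat \<times> nat \<times> nat \<Rightarrow> 'b" where
  "mon (a, b, c) = F [^] a \<otimes> (E [^] b \<otimes> K [^] c)"

definition idx :: "(nat \<times> nat \<times> nat) set" where
  "idx = {..<N} \<times> {..<N} \<times> {..<N}"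

definition comb :: "(nat \<times> nat \<times> nat \<Rightarrow> 'k) \<Rightarrow> 'b" where
  "comb f = (\<Oplus>i\<in>idx. f i \<odot> mon i)"

lemma finite_idx [simp]: "finite idx"
  by (simp add: idx_def)

lemma mon_closed [simp]: "mon i \<in> carrier R"
  by (cases i) simp

lemma comb_closed [simp]: "comb f \<in> carrier R"
  unfolding comb_def by (intro finsum_closed) auto

lemma comb_add: "comb f \<oplus> comb g = comb (\<lambda>i. f i + g i)"
  unfolding comb_def by (subst finsum_addf[symmetric]) (auto simp: smult_l_distr)

lemma comb_smult: "c \<odot> comb f = comb (\<lambda>i. c * f i)"
  unfolding comb_def by (subst smult_finsum) (auto simp: smult_smult)

lemma comb_delta: "i \<in> idx \<Longrightarrow> mon i = comb (\<lambda>j. if j = i then 1 else 0)"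
  unfolding comb_def
  by (subst add.finprod_mono_neutral_cong_right[of idx "{i}"]) auto

lemma K_pow_mod: "K [^] (n mod N) = K [^] n"
proof -
  have "K [^] n = (K [^] N) [^] (n div N) \<otimes> K [^] (n mod N)"
    by (simp add: nat_pow_pow nat_pow_mult)
  then show ?thesis by (simp add: K_pow_N)
qed

lemma pow_eq_zero:
  assumes "x \<in> carrier R" "x [^] N = \<zero>" "N \<le> n"
  shows "x [^] n = \<zero>"
proof -
  have "x [^] n = x [^] N \<otimes> x [^] (n - N)"
    using assms(1,3) by (simp add: nat_pow_mult)
  then show ?thesis using assms by simp
qed

lemma mon_in_span: "\<exists>f. mon (a, b, c) = comb f"
proof (cases "a < N \<and> b < N")
  case True
  have "mon (a, b, c) = mon (a, b, c mod N)"
    by (simp add: K_pow_mod)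
  also have "(a, b, c mod N) \<in> idx"
    using True N_gt_1 by (simp add: idx_def)
  note comb_delta[OF this]
  finally show ?thesis by blast
next
  case False
  then have "mon (a, b, c) = \<zero>"
    using pow_eq_zero[OF _ F_pow_N, of a] pow_eq_zero[OF _ E_pow_N, of b] by auto
  moreover have "comb (\<lambda>_. 0) = \<zero>"
    by (simp add: comb_def)
  ultimately show ?thesis by metis
qed

lemma span_add:
  assumes "\<exists>f. x = comb f" "\<exists>f. y = comb f"
  shows "\<exists>f. x \<oplus> y = comb f"
  using assms comb_add by blast

lemma span_smult:
  assumes "\<exists>f. x = comb f"
  shows "\<exists>f. c \<odot> x = comb f"
  using assms comb_smult by blast

lemma span_finsum:
  assumes "\<And>i. i \<in> I \<Longrightarrow> \<exists>f. x i = comb f"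
  shows "\<exists>f. (\<Oplus>i\<in>I. x i) = comb f"
  using assms
proof (induction I rule: infinite_finite_induct)
  case (insert i I)
  have "x j \<in> carrier R" if "j \<in> insert i I" for j
    using insert.prems[OF that] by auto
  then have "x i \<in> carrier R" "x \<in> I \<rightarrow> carrier R" by auto
  with insert show ?case by (auto intro!: span_add)
qed (use comb_smult[of 0 "\<lambda>_. 0"] in auto)

lemma K_E_pow: "K \<otimes> E [^] (n::nat) = (q ^ 2) ^ n \<odot> (E [^] n \<otimes> K)"
  by (rule q_commute_pow[OF _ _ KE]) simp_all

lemma K_F_pow: "K \<otimes> F [^] (n::nat) = (inverse q ^ 2) ^ n \<odot> (F [^] n \<otimes> K)"
  by (rule q_commute_pow[OF _ _ KF]) simp_all

lemma Ki_E_pow: "Ki \<otimes> E [^] (n::nat) = (inverse q ^ 2) ^ n \<odot> (E [^] n \<otimes> Ki)"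
  by (rule q_commute_pow[OF _ _ Ki_E]) simp_all

lemma Ki_F_pow: "Ki \<otimes> F [^] (n::nat) = (q ^ 2) ^ n \<odot> (F [^] n \<otimes> Ki)"
  by (rule q_commute_pow[OF _ _ Ki_F]) simp_all

lemma K_mult_K_pow: "K \<otimes> K [^] n = K [^] Suc n"
  by (rule nat_pow_Suc2[symmetric]) simp

lemma Ki_mult_K_pow: "Ki \<otimes> K [^] n = K [^] (N - 1 + n)"
  unfolding Ki_def by (rule nat_pow_mult) simp

text \<open>Induction on the exponent: each new \<open>F\<close> contributes one commutator, and
  \<open>K\<close>, \<open>Ki\<close> pass \<open>F\<close> up to a scalar. Existence of the
  coefficients is enough for a spanning statement.\<close>

lemma E_F_pow:
  "\<exists>\<alpha> \<beta>. E \<otimes> F [^] Suc a = F [^] Suc a \<otimes> E \<oplus> F [^] a \<otimes> (\<alpha> \<odot> K \<oplus> \<beta> \<odot> Ki)"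
proof (induction a)
  case 0
  show ?case
    by (rule exI[of _ "inverse (q - inverse q)"], rule exI[of _ "- inverse (q - inverse q)"])
      (simp add: EF_eq minus_eq_smult smult_r_distr smult_smult)
next
  case (Suc a)
  define c d where "c = inverse (q - inverse q)" and "d = - c"
  obtain \<alpha> \<beta> where IH: "E \<otimes> F [^] Suc a = F [^] Suc a \<otimes> E \<oplus> F [^] a \<otimes> (\<alpha> \<odot> K \<oplus> \<beta> \<odot> Ki)"
    using Suc.IH by blast
  have "E \<otimes> F [^] Suc (Suc a) = (E \<otimes> F [^] Suc a) \<otimes> F"
    by (simp add: m_assoc)
  also have "\<dots> = F [^] Suc a \<otimes> (E \<otimes> F) \<oplus> F [^] a \<otimes> ((\<alpha> \<odot> K \<oplus> \<beta> \<odot> Ki) \<otimes> F)"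
    unfolding IH by (simp add: l_distr m_assoc del: nat_pow_Suc)
  also have "(\<alpha> \<odot> K \<oplus> \<beta> \<odot> Ki) \<otimes> F = F \<otimes> ((\<alpha> * inverse q ^ 2) \<odot> K \<oplus> (\<beta> * q ^ 2) \<odot> Ki)"
    by (simp add: l_distr r_distr smult_mult_l smult_mult_r KF Ki_F smult_smult)
  also have "F [^] a \<otimes> \<dots> = F [^] Suc a \<otimes> ((\<alpha> * inverse q ^ 2) \<odot> K \<oplus> (\<beta> * q ^ 2) \<odot> Ki)"
    by (simp add: m_assoc)
  also have "E \<otimes> F = F \<otimes> E \<oplus> (c \<odot> K \<oplus> d \<odot> Ki)"
    by (simp add: c_def d_def EF_eq minus_eq_smult smult_r_distr smult_smult)
  also have "F [^] Suc a \<otimes> (F \<otimes> E \<oplus> (c \<odot> K \<oplus> d \<odot> Ki)) \<oplus>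
      F [^] Suc a \<otimes> ((\<alpha> * inverse q ^ 2) \<odot> K \<oplus> (\<beta> * q ^ 2) \<odot> Ki) =
      F [^] Suc (Suc a) \<otimes> E \<oplus> F [^] Suc a \<otimes> ((c + \<alpha> * inverse q ^ 2) \<odot> K \<oplus> (d + \<beta> * q ^ 2) \<odot> Ki)"
    by (simp add: m_assoc r_distr smult_l_distr smult_mult_r a_ac)
  finally show ?case by blast
qed

text \<open>The substantial case is \<open>E\<close> times a monomial that contains
  \<open>F\<close>: the correction term of \<open>E_F_pow\<close> gives two further monomials, after
  \<open>K\<close> and \<open>Ki\<close> have passed \<open>E [^] b\<close>. A factor
  \<open>Ki\<close> adds \<open>N - 1\<close> to the exponent of \<open>K\<close>.\<close>

lemma gen_mult_mon: "\<exists>f. \<phi> g \<otimes> mon i = comb f"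
proof -
  obtain a b c where i: "i = (a, b, c)" by (cases i)
  show ?thesis
  proof (cases g)
    case gen_F
    have "F \<otimes> mon i = mon (Suc a, b, c)"
      unfolding i mon.simps nat_pow_Suc2[OF gen_closed] by (simp add: m_assoc)
    then show ?thesis using mon_in_span gen_F by metis
  next
    case gen_K
    have "K \<otimes> mon i = (K \<otimes> F [^] a) \<otimes> (E [^] b \<otimes> K [^] c)"
      by (simp add: i m_assoc)
    also have "\<dots> = (inverse q ^ 2) ^ a \<odot> (F [^] a \<otimes> ((K \<otimes> E [^] b) \<otimes> K [^] c))"
      unfolding K_F_pow by (simp add: smult_mult_l m_assoc)
    also have "\<dots> = ((inverse q ^ 2) ^ a * (q ^ 2) ^ b) \<odot> mon (a, b, Suc c)"
      unfolding K_E_pow mon.simps K_mult_K_pow[symmetric]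
      by (simp add: smult_mult_l smult_mult_r m_assoc smult_smult)
    finally show ?thesis using span_smult[OF mon_in_span] gen_K by metis
  next
    case gen_E
    show ?thesis
    proof (cases a)
      case 0
      have "E \<otimes> mon i = mon (0, Suc b, c)"
        unfolding i mon.simps nat_pow_Suc2[OF gen_closed] 0 by (simp add: m_assoc)
      then show ?thesis using mon_in_span gen_E by metis
    next
      case (Suc a')
      obtain \<alpha> \<beta> where e: "E \<otimes> F [^] a = F [^] a \<otimes> E \<oplus> F [^] a' \<otimes> (\<alpha> \<odot> K \<oplus> \<beta> \<odot> Ki)"
        using E_F_pow[of a'] Suc by blast
      have "E \<otimes> mon i = (E \<otimes> F [^] a) \<otimes> (E [^] b \<otimes> K [^] c)"
        by (simp add: i m_assoc)
      also have "\<dots> = F [^] a \<otimes> ((E \<otimes> E [^] b) \<otimes> K [^] c) \<oplus>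
          (\<alpha> \<odot> (F [^] a' \<otimes> ((K \<otimes> E [^] b) \<otimes> K [^] c)) \<oplus>
           \<beta> \<odot> (F [^] a' \<otimes> ((Ki \<otimes> E [^] b) \<otimes> K [^] c)))"
        unfolding e by (simp add: l_distr r_distr smult_mult_l smult_mult_r m_assoc smult_r_distr)
      also have "F [^] a \<otimes> ((E \<otimes> E [^] b) \<otimes> K [^] c) = mon (a, Suc b, c)"
        unfolding mon.simps nat_pow_Suc2[OF gen_closed] ..
      also have "\<alpha> \<odot> (F [^] a' \<otimes> ((K \<otimes> E [^] b) \<otimes> K [^] c)) = (\<alpha> * (q ^ 2) ^ b) \<odot> mon (a', b, Suc c)"
        unfolding K_E_pow mon.simps K_mult_K_pow[symmetric]
        by (simp add: smult_mult_l smult_mult_r m_assoc smult_smult)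
      also have "\<beta> \<odot> (F [^] a' \<otimes> ((Ki \<otimes> E [^] b) \<otimes> K [^] c)) =
          (\<beta> * (inverse q ^ 2) ^ b) \<odot> mon (a', b, N - 1 + c)"
        unfolding Ki_E_pow mon.simps Ki_mult_K_pow[symmetric]
        by (simp add: smult_mult_l smult_mult_r m_assoc smult_smult)
      finally show ?thesis
        using span_add[OF mon_in_span span_add[OF span_smult[OF mon_in_span] span_smult[OF mon_in_span]]]
          gen_E by metis
    qed
  qed
qed

lemma gen_mult_comb: "\<exists>f'. \<phi> g \<otimes> comb f = comb f'"
proof -
  have "\<phi> g \<otimes> comb f = (\<Oplus>i\<in>idx. f i \<odot> (\<phi> g \<otimes> mon i))"
    unfolding comb_def by (subst finsum_rdistr) (auto simp: smult_mult_r intro!: add.finprod_cong')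
  also have "\<exists>f'. \<dots> = comb f'"
    by (intro span_finsum span_smult gen_mult_mon)
  finally show ?thesis .
qed

end

section \<open>Subalgebras stable under the coaction and the adjoint action\<close>

text \<open>
  \<open>\<Psi>\<close> plays the role of \<open>(id \<otimes> \<rho>) \<circ> \<Delta>\<close>, and the expressions in \<open>A_adK\<close>, \<open>A_adE\<close> and \<open>A_adF\<close> are
  \<open>S(h\<^sub>(\<^sub>1\<^sub>)) x h\<^sub>(\<^sub>2\<^sub>)\<close> for \<open>h = K, E, F\<close>.
\<close>

locale uq_normal = uq_rels +
  fixes A :: "'b set" and \<Psi> :: "'b \<Rightarrow> 'b \<times> 'b \<times> 'b \<times> 'b"
  assumes generated: "\<And>S. S \<subseteq> carrier R \<Longrightarrow> \<one> \<in> S \<Longrightarrow> (\<And>x y. x \<in> S \<Longrightarrow> y \<in> S \<Longrightarrow> x \<oplus> y \<in> S) \<Longrightarrow>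
      (\<And>c x. x \<in> S \<Longrightarrow> c \<odot> x \<in> S) \<Longrightarrow> (\<And>g x. x \<in> S \<Longrightarrow> \<phi> g \<otimes> x \<in> S) \<Longrightarrow> S = carrier R"
    and A_carrier: "A \<subseteq> carrier R"
    and A_one: "\<one> \<in> A"
    and A_add: "x \<in> A \<Longrightarrow> y \<in> A \<Longrightarrow> x \<oplus> y \<in> A"
    and A_mult: "x \<in> A \<Longrightarrow> y \<in> A \<Longrightarrow> x \<otimes> y \<in> A"
    and A_smult: "x \<in> A \<Longrightarrow> c \<odot> x \<in> A"
    and A_adK: "x \<in> A \<Longrightarrow> Ki \<otimes> x \<otimes> K \<in> A"
    and A_adE: "x \<in> A \<Longrightarrow> \<ominus> (E \<otimes> Ki) \<otimes> x \<otimes> K \<oplus> x \<otimes> E \<in> A"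
    and A_adF: "x \<in> A \<Longrightarrow> \<ominus> (K \<otimes> F) \<otimes> x \<oplus> K \<otimes> x \<otimes> F \<in> A"
    and Psi_hom: "field_algebra_hom R (mat2 R) \<Psi>"
    and Psi_K: "\<Psi> K = (q \<odot> K, \<zero>, \<zero>, inverse q \<odot> K)"
    and Psi_E: "\<Psi> E = (q \<odot> E, \<one>, \<zero>, inverse q \<odot> E)"
    and Psi_F: "\<Psi> F = (F, \<zero>, Ki, F)"
    and A_Psi: "x \<in> A \<Longrightarrow> fst (\<Psi> x) \<in> A \<and> fst (snd (\<Psi> x)) \<in> A \<and> fst (snd (snd (\<Psi> x))) \<in> A"
begin

sublocale Psi: field_algebra_hom R "mat2 R" \<Psi>
  by (rule Psi_hom)

definition D_K where "D_K x = fst (\<Psi> x)"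
definition D_E where "D_E x = fst (snd (\<Psi> x))"
definition D_F where "D_F x = fst (snd (snd (\<Psi> x)))"

lemma A_in_carrier [simp]: "x \<in> A \<Longrightarrow> x \<in> carrier R"
  using A_carrier by blast

lemma A_pow: "x \<in> A \<Longrightarrow> x [^] (n::nat) \<in> A"
  by (induction n) (auto simp: A_one A_mult)

lemma A_smult_cancel:
  assumes "c \<odot> x \<in> A" "c \<noteq> 0" "x \<in> carrier R"
  shows "x \<in> A"
  using A_smult[OF assms(1), of "inverse c"] assms(2,3) by (simp add: smult_smult)

lemma A_diff: "x \<oplus> y \<in> A \<Longrightarrow> y \<in> A \<Longrightarrow> x \<in> carrier R \<Longrightarrow> x \<in> A"
  using A_add[of "x \<oplus> y" "(- 1) \<odot> y"] A_smult[of y "- 1"]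
  by (simp add: a_assoc smult_uminus_l r_neg)

section \<open>Elements of \<open>A\<close> whose presence forces \<open>A\<close> to be the whole
  algebra\<close>

lemma A_eq_carrierI:
  assumes "K \<in> A" "E \<in> A" "F \<in> A"
  shows "A = carrier R"
proof (rule generated)
  show "\<phi> g \<otimes> x \<in> A" if "x \<in> A" for g x
    using that assms by (cases g) (auto intro: A_mult)
qed (simp_all add: A_carrier A_one A_add A_smult)

text \<open>The adjoint action of \<open>F\<close> on \<open>K\<close> gives \<open>K F K\<close>
  times \<open>inverse q ^ 2 - 1\<close>, which is nonzero. Then \<open>F\<close> is recovered
  because \<open>Ki\<close> is a power of \<open>K\<close>.\<close>

lemma A_eq_carrierI_K:
  assumes "K \<in> A" "E \<in> A"
  shows "A = carrier R"
proof -
  have Ki: "Ki \<in> A"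
    unfolding Ki_def by (rule A_pow) fact
  have "\<ominus> (K \<otimes> F) \<otimes> K \<oplus> K \<otimes> K \<otimes> F = (inverse q ^ 2 - 1) \<odot> (K \<otimes> (F \<otimes> K))"
  proof -
    have "K \<otimes> K \<otimes> F = inverse q ^ 2 \<odot> (K \<otimes> (F \<otimes> K))"
      by (simp add: m_assoc KF smult_mult_r)
    moreover have "\<ominus> (K \<otimes> F) \<otimes> K = (- 1) \<odot> (K \<otimes> (F \<otimes> K))"
      by (simp add: a_inv_eq_smult smult_mult_l m_assoc)
    ultimately show ?thesis
      by (simp add: smult_l_distr[symmetric])
  qed
  then have "(inverse q ^ 2 - 1) \<odot> (K \<otimes> (F \<otimes> K)) \<in> A"
    using A_adF[OF assms(1)] by simp
  moreover have "inverse q ^ 2 - 1 \<noteq> 0"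
    using q2_neq_1 by (simp add: power_inverse)
  ultimately have "K \<otimes> (F \<otimes> K) \<in> A"
    by (rule A_smult_cancel) simp
  then have "Ki \<otimes> (K \<otimes> (F \<otimes> K)) \<otimes> Ki \<in> A"
    using Ki A_mult by blast
  then have "F \<in> A" by (simp add: m_assoc)
  with assms show ?thesis by (rule A_eq_carrierI)
qed

text \<open>The product is \<open>K^2 - 1\<close>, so \<open>K^2\<close> lies in \<open>A\<close>.
  For odd \<open>N\<close> the power \<open>(K^2)^((N+1)/2) = K^(N+1)\<close> is
  \<open>K\<close>.\<close>

lemma K_in_A:
  assumes "c \<odot> (K \<otimes> (K \<ominus> Ki)) \<in> A" "c \<noteq> 0"
  shows "K \<in> A"
proof -
  have "K \<otimes> (K \<ominus> Ki) \<in> A"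
    using assms by (rule A_smult_cancel) simp
  moreover have "K \<otimes> (K \<ominus> Ki) = K \<otimes> K \<oplus> (- 1) \<odot> \<one>"
    by (simp add: minus_eq_smult r_distr smult_mult_r)
  ultimately have "K \<otimes> K \<in> A"
    using A_diff[of "K \<otimes> K" "(- 1) \<odot> \<one>"] A_smult[OF A_one] by simp
  then have "(K \<otimes> K) [^] ((N + 1) div 2) \<in> A"
    by (rule A_pow)
  moreover have "(K \<otimes> K) [^] ((N + 1) div 2) = K [^] (2 * ((N + 1) div 2))"
    using nat_pow_pow[of K 2 "(N + 1) div 2"] by (simp add: numeral_2_eq_2)
  moreover have "2 * ((N + 1) div 2) = Suc N"
    using odd_N by (auto elim!: oddE)
  ultimately show ?thesis
    by (simp add: K_pow_N)
qed

text \<open>The adjoint action of \<open>F\<close> on \<open>E\<close> gives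
  \<open>K (E F - F E)\<close>, a nonzero multiple of \<open>K (K - Ki)\<close>.\<close>

lemma A_eq_carrier_if_E:
  assumes "E \<in> A"
  shows "A = carrier R"
proof -
  let ?c = "inverse (q - inverse q)"
  have "\<ominus> (K \<otimes> F) \<otimes> E \<oplus> K \<otimes> E \<otimes> F = K \<otimes> (E \<otimes> F) \<oplus> (- 1) \<odot> (K \<otimes> (F \<otimes> E))"
    by (simp add: a_inv_eq_smult smult_mult_l m_assoc a_comm)
  also have "\<dots> = ?c \<odot> (K \<otimes> (K \<ominus> Ki))"
    unfolding EF_eq
    by (simp add: r_distr smult_uminus_l a_ac r_neg r_neg1 r_neg2 smult_mult_r)
  finally have "?c \<odot> (K \<otimes> (K \<ominus> Ki)) \<in> A"
    using A_adF[OF assms] by simp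
  then have "K \<in> A"
    by (rule K_in_A) (use q_minus_inverse_nz in auto)
  then show ?thesis using assms by (rule A_eq_carrierI_K)
qed

text \<open>For \<open>g = K^m\<close> the adjoint action of \<open>E\<close> gives
  \<open>(q^(2m) - 1) E g\<close>. The scalar is nonzero because \<open>N\<close> does not divide
  \<open>m\<close>, and \<open>g\<close> is then stripped off with its inverse
  \<open>g^(N-1)\<close>.\<close>

lemma A_eq_carrier_if_group_like:
  assumes "K [^] m \<in> A" "\<not> N dvd m"
  shows "A = carrier R"
proof -
  define g where "g = K [^] m"
  have g: "g \<in> A" "g \<in> carrier R" using assms by (simp_all add: g_def)
  have gE: "g \<otimes> E = (q ^ 2) ^ m \<odot> (E \<otimes> g)"
    unfolding g_def
  proof (induction m)
    case (Suc m)
    have "K [^] Suc m \<otimes> E = K [^] m \<otimes> (K \<otimes> E)" by (simp add: m_assoc)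
    also have "\<dots> = q ^ 2 \<odot> ((K [^] m \<otimes> E) \<otimes> K)" by (simp add: KE smult_mult_r m_assoc)
    also have "\<dots> = (q ^ 2) ^ Suc m \<odot> (E \<otimes> K [^] Suc m)"
      unfolding Suc by (simp add: smult_mult_l smult_smult m_assoc)
    finally show ?case .
  qed simp
  have Kg: "Ki \<otimes> (g \<otimes> K) = g"
    unfolding g_def nat_pow_Suc[symmetric] nat_pow_Suc2[OF gen_closed] by simp
  have "\<ominus> (E \<otimes> Ki) \<otimes> g \<otimes> K \<oplus> g \<otimes> E = ((q ^ 2) ^ m - 1) \<odot> (E \<otimes> g)"
  proof -
    have "\<ominus> (E \<otimes> Ki) \<otimes> g \<otimes> K = (- 1) \<odot> (E \<otimes> g)"
      using g by (simp add: a_inv_eq_smult smult_mult_l m_assoc Kg)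
    then show ?thesis
      using g by (simp add: gE smult_l_distr[symmetric])
  qed
  then have "((q ^ 2) ^ m - 1) \<odot> (E \<otimes> g) \<in> A"
    using A_adE[OF g(1)] by simp
  moreover have "(q ^ 2) ^ m - 1 \<noteq> 0"
    using assms(2) q2_pow_eq_1_iff[of m] by simp
  ultimately have "E \<otimes> g \<in> A"
    by (rule A_smult_cancel) (use g in simp)
  then have "(E \<otimes> g) \<otimes> g [^] (N - 1) \<in> A"
    using A_pow[OF g(1)] A_mult by blast
  moreover have "g \<otimes> g [^] (N - 1) = \<one>"
  proof -
    have "g \<otimes> g [^] (N - 1) = g [^] N"
      using g N_gt_1 nat_pow_Suc2[of g "N - 1"] by (simp del: nat_pow_Suc)
    also have "\<dots> = (K [^] N) [^] m"
      by (simp add: g_def nat_pow_pow mult.commute)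
    finally show ?thesis by (simp add: K_pow_N)
  qed
  ultimately have "E \<in> A"
    using g by (simp add: m_assoc)
  then show ?thesis by (rule A_eq_carrier_if_E)
qed

text \<open>The factor \<open>K\<close> is what makes the adjoint action of \<open>E\<close> on
  \<open>F K\<close> a commutator: the result is \<open>- q^2 (E F - F E) K\<close>, a nonzero
  multiple of \<open>K (K - Ki)\<close>.\<close>

lemma A_eq_carrier_if_FK:
  assumes "F \<otimes> K \<in> A"
  shows "A = carrier R"
proof -
  let ?c = "inverse (q - inverse q)"
  have 1: "\<ominus> (E \<otimes> Ki) \<otimes> (F \<otimes> K) \<otimes> K = (- (q ^ 2)) \<odot> (E \<otimes> F \<otimes> K)"
  proof -
    have "\<ominus> (E \<otimes> Ki) \<otimes> (F \<otimes> K) \<otimes> K = (- 1) \<odot> (E \<otimes> ((Ki \<otimes> F) \<otimes> (K \<otimes> K)))"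
      by (simp add: a_inv_eq_smult smult_mult_l m_assoc)
    also have "\<dots> = (- (q ^ 2)) \<odot> (E \<otimes> F \<otimes> K)"
      unfolding Ki_F by (simp add: smult_mult_l smult_mult_r smult_smult m_assoc)
    finally show ?thesis .
  qed
  have 2: "F \<otimes> K \<otimes> E = q ^ 2 \<odot> (F \<otimes> E \<otimes> K)"
    by (simp add: m_assoc KE smult_mult_r)
  have K_c: "(K \<ominus> Ki) \<otimes> K = K \<otimes> (K \<ominus> Ki)"
    by (simp add: minus_eq_smult l_distr r_distr smult_mult_l smult_mult_r)
  have "\<ominus> (E \<otimes> Ki) \<otimes> (F \<otimes> K) \<otimes> K \<oplus> F \<otimes> K \<otimes> E =
      (- (q ^ 2)) \<odot> (F \<otimes> E \<otimes> K) \<oplus> (- (q ^ 2)) \<odot> (?c \<odot> ((K \<ominus> Ki) \<otimes> K)) \<oplus> q ^ 2 \<odot> (F \<otimes> E \<otimes> K)"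
    unfolding 1 2 EF_eq by (simp add: l_distr smult_r_distr smult_mult_l)
  also have "\<dots> = (- (q ^ 2 * ?c)) \<odot> (K \<otimes> (K \<ominus> Ki))"
    unfolding K_c by (simp add: smult_uminus_l a_ac r_neg r_neg1 r_neg2 l_neg smult_smult)
  finally have "(- (q ^ 2 * ?c)) \<odot> (K \<otimes> (K \<ominus> Ki)) \<in> A"
    using A_adE[OF assms] by simp
  then have "K \<in> A"
    by (rule K_in_A) (use q_minus_inverse_nz in auto)
  then show ?thesis
    using A_eq_carrier_if_group_like[of 1] N_gt_1 by simp
qed

end

section \<open>The entries of \<open>\<Psi>\<close> and conjugation by \<open>K\<close> on
  monomials\<close>

context uq_normal
begin

lemma Psi_closed: "x \<in> carrier R \<Longrightarrow> \<Psi> x \<in> carrier R \<times> carrier R \<times> carrier R \<times> carrier R"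
  using Psi.hom_closed[of x] by simp

lemma linear_D: "linear_map R D_K" "linear_map R D_E" "linear_map R D_F"
proof -
  have "\<exists>a b c d. \<Psi> x = (a, b, c, d) \<and> a \<in> carrier R \<and> b \<in> carrier R \<and> c \<in> carrier R \<and> d \<in> carrier R"
    if "x \<in> carrier R" for x
    using Psi_closed[OF that] by (cases "\<Psi> x") auto
  note * = this
  have "fst (\<Psi> (x \<oplus> y)) = fst (\<Psi> x) \<oplus> fst (\<Psi> y) \<and>
      fst (snd (\<Psi> (x \<oplus> y))) = fst (snd (\<Psi> x)) \<oplus> fst (snd (\<Psi> y)) \<and>
      fst (snd (snd (\<Psi> (x \<oplus> y)))) = fst (snd (snd (\<Psi> x))) \<oplus> fst (snd (snd (\<Psi> y)))"
    if "x \<in> carrier R" "y \<in> carrier R" for x y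
    using *[OF that(1)] *[OF that(2)] that by auto
  moreover have "fst (\<Psi> (c \<odot> x)) = c \<odot> fst (\<Psi> x) \<and>
      fst (snd (\<Psi> (c \<odot> x))) = c \<odot> fst (snd (\<Psi> x)) \<and>
      fst (snd (snd (\<Psi> (c \<odot> x)))) = c \<odot> fst (snd (snd (\<Psi> x)))"
    if "x \<in> carrier R" for x c
    using *[OF that(1)] that by auto
  moreover have "fst (\<Psi> x) \<in> carrier R \<and> fst (snd (\<Psi> x)) \<in> carrier R \<and> fst (snd (snd (\<Psi> x))) \<in> carrier R"
    if "x \<in> carrier R" for x
    using *[OF that] by auto
  ultimately show "linear_map R D_K" "linear_map R D_E" "linear_map R D_F"
    by (simp_all add: linear_map_def D_K_def D_E_def D_F_def)
qed

lemma A_D: "x \<in> A \<Longrightarrow> D_K x \<in> A" "x \<in> A \<Longrightarrow> D_E x \<in> A" "x \<in> A \<Longrightarrow> D_F x \<in> A"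
  using A_Psi by (simp_all add: D_K_def D_E_def D_F_def)

lemma A_D_pow: "x \<in> A \<Longrightarrow> (D_E ^^ n) x \<in> A" "x \<in> A \<Longrightarrow> (D_F ^^ n) x \<in> A"
  by (induction n) (simp_all add: A_D)

lemma Psi_K_pow: "\<Psi> (K [^] (n::nat)) = (q ^ n \<odot> K [^] n, \<zero>, \<zero>, inverse q ^ n \<odot> K [^] n)"
  by (induction n) (simp_all add: Psi_K smult_mult_l smult_mult_r smult_smult mult.commute)

text \<open>The upper right entry of \<open>\<Psi> E\<close> times \<open>\<Psi> (E [^] n)\<close>
  follows the recursion \<open>q_int_Suc\<close>.\<close>

lemma Psi_E_pow: "\<Psi> (E [^] (n::nat)) =
    (q ^ n \<odot> E [^] n, q_int n \<odot> E [^] (n - 1), \<zero>, inverse q ^ n \<odot> E [^] n)"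
proof (induction n)
  case (Suc n)
  \<comment> \<open>The truncated exponent \<open>n - 1\<close> is wrong only for
    \<open>n = 0\<close>, where \<open>q_int 0 = 0\<close> removes the term.\<close>
  have e: "(c * q_int n) \<odot> (E \<otimes> E [^] (n - 1)) = (c * q_int n) \<odot> (E [^] n)" for c
  proof (cases n)
    case (Suc m)
    then show ?thesis
      using nat_pow_Suc2[of E m] by (simp del: nat_pow_Suc)
  qed simp
  have "\<Psi> (E [^] Suc n) = \<Psi> E \<otimes>\<^bsub>mat2 R\<^esub> \<Psi> (E [^] n)"
    unfolding nat_pow_Suc2[OF gen_closed] by (rule Psi.hom_mult) simp_all
  also have "\<dots> = (q ^ Suc n \<odot> E [^] Suc n, (q * q_int n) \<odot> (E \<otimes> E [^] (n - 1)) \<oplus> inverse q ^ n \<odot> E [^] n,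
      \<zero>, inverse q ^ Suc n \<odot> E [^] Suc n)"
    unfolding Suc Psi_E nat_pow_Suc2[OF gen_closed]
    by (simp add: smult_mult_l smult_mult_r smult_smult mult.commute del: nat_pow_Suc)
  finally show ?case
    unfolding e by (simp add: q_int_Suc smult_l_distr)
qed simp

text \<open>In the lower left entry \<open>Ki\<close> has to pass \<open>F [^] n\<close>, which
  produces the summand \<open>(q ^ 2) ^ n\<close> of \<open>q2_int_Suc\<close>.\<close>

lemma Psi_F_pow: "\<Psi> (F [^] (n::nat)) =
    (F [^] n, \<zero>, q2_int n \<odot> (F [^] (n - 1) \<otimes> Ki), F [^] n)"
proof (induction n)
  case (Suc n)
  have "F \<otimes> (q2_int n \<odot> (F [^] (n - 1) \<otimes> Ki)) = q2_int n \<odot> (F [^] n \<otimes> Ki)"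
  proof (cases n)
    case (Suc m)
    then show ?thesis
      using nat_pow_Suc2[of F m] by (simp add: smult_mult_r m_assoc[symmetric] del: nat_pow_Suc)
  qed simp
  note f = this
  have "\<Psi> (F [^] Suc n) = \<Psi> F \<otimes>\<^bsub>mat2 R\<^esub> \<Psi> (F [^] n)"
    unfolding nat_pow_Suc2[OF gen_closed] by (rule Psi.hom_mult) simp_all
  also have "\<dots> = (F [^] Suc n, \<zero>, Ki \<otimes> F [^] n \<oplus> q2_int n \<odot> (F [^] n \<otimes> Ki), F [^] Suc n)"
    unfolding Suc Psi_F nat_pow_Suc2[OF gen_closed] by (simp only: mat2_simps f) simp
  finally show ?case
    unfolding Ki_F_pow by (simp add: q2_int_Suc smult_l_distr)
qed simp

text \<open>\<open>\<Psi>\<close> of \<open>F [^] a\<close> is lower triangular,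
  \<open>\<Psi>\<close> of \<open>E [^] b\<close> and \<open>K [^] c\<close> upper triangular. Hence
  all entries but the lower right one are single products, that is, multiples of a monomial up to
  the position of \<open>Ki\<close>.\<close>

lemma Psi_mon: "\<exists>w. \<Psi> (mon (a, b, c)) =
    (q ^ (b + c) \<odot> mon (a, b, c),
     (q_int b * inverse q ^ c) \<odot> (F [^] a \<otimes> (E [^] (b - 1) \<otimes> K [^] c)),
     (q2_int a * q ^ (b + c)) \<odot> (F [^] (a - 1) \<otimes> (Ki \<otimes> (E [^] b \<otimes> K [^] c))), w)"
proof -
  have "\<Psi> (mon (a, b, c)) = \<Psi> (F [^] a) \<otimes>\<^bsub>mat2 R\<^esub> (\<Psi> (E [^] b) \<otimes>\<^bsub>mat2 R\<^esub> \<Psi> (K [^] c))"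
    by simp
  then show ?thesis
    unfolding Psi_F_pow Psi_E_pow Psi_K_pow
    by (simp add: smult_mult_l smult_mult_r smult_smult m_assoc power_add mult.commute)
qed

lemma D_K_mon: "D_K (mon (a, b, c)) = q ^ (b + c) \<odot> mon (a, b, c)"
  using Psi_mon[of a b c] by (auto simp: D_K_def)

lemma D_E_mon_0: "D_E (mon (a, 0, c)) = \<zero>"
  using Psi_mon[of a 0 c] by (auto simp: D_E_def)

lemma D_E_mon_Suc: "D_E (mon (a, Suc b, c)) = (q_int (Suc b) * inverse q ^ c) \<odot> mon (a, b, c)"
  using Psi_mon[of a "Suc b" c] by (auto simp: D_E_def)

lemma D_F_mon_0: "D_F (mon (0, b, c)) = \<zero>"
  using Psi_mon[of 0 b c] by (auto simp: D_F_def)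

text \<open>Moving \<open>Ki\<close> to the right past \<open>E [^] b\<close> gives the last scalar.
  Adding \<open>N - 1\<close> to the exponent of \<open>K\<close> means subtracting 1 modulo
  \<open>N\<close>, so \<open>D_F\<close> preserves the difference of the exponents of
  \<open>F\<close> and \<open>K\<close> modulo \<open>N\<close>.\<close>

lemma D_F_mon_Suc:
  "D_F (mon (Suc a, b, c)) =
    (q2_int (Suc a) * q ^ (b + c) * (inverse q ^ 2) ^ b) \<odot> mon (a, b, c + (N - 1))"
proof -
  have "Ki \<otimes> (E [^] b \<otimes> K [^] c) = (inverse q ^ 2) ^ b \<odot> (E [^] b \<otimes> K [^] (c + (N - 1)))"
  proof -
    have "Ki \<otimes> (E [^] b \<otimes> K [^] c) = (Ki \<otimes> E [^] b) \<otimes> K [^] c" by (simp add: m_assoc)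
    also have "\<dots> = (inverse q ^ 2) ^ b \<odot> (E [^] b \<otimes> (Ki \<otimes> K [^] c))"
      unfolding Ki_E_pow by (simp add: m_assoc smult_mult_l)
    finally show ?thesis by (simp only: Ki_mult_K_pow add.commute)
  qed
  then show ?thesis
    using Psi_mon[of "Suc a" b c] by (auto simp: D_F_def smult_mult_r smult_smult)
qed

lemma D_E_pow_mon_eq_0: "b < n \<Longrightarrow> (D_E ^^ n) (mon (a, b, c)) = \<zero>"
proof (induction n arbitrary: b)
  case (Suc n)
  show ?case
  proof (cases b)
    case 0
    then show ?thesis
      using linear_map_zero[OF linear_map_funpow[OF linear_D(2)]]
      by (simp only: funpow_Suc_right comp_apply D_E_mon_0)
  next
    case (Suc b')
    then show ?thesis
      using Suc.prems Suc.IH[of b'] linear_map_funpow[OF linear_D(2), of n]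
      by (simp only: funpow_Suc_right comp_apply D_E_mon_Suc linear_map_def mon_closed) simp
  qed
qed simp

text \<open>The scalar is a product of powers of \<open>q\<close> and of quantum integers with
  arguments between 1 and \<open>N - 1\<close>, none of which vanishes.\<close>

lemma D_E_pow_mon:
  assumes "b + n < N"
  shows "\<exists>\<kappa>. \<kappa> \<noteq> 0 \<and> (D_E ^^ n) (mon (a, b + n, c)) = \<kappa> \<odot> mon (a, b, c)"
  using assms
proof (induction n)
  case 0
  show ?case by (rule exI[of _ 1]) (simp del: mon.simps)
next
  case (Suc n)
  then obtain \<kappa> where k: "\<kappa> \<noteq> 0" "(D_E ^^ n) (mon (a, b + n, c)) = \<kappa> \<odot> mon (a, b, c)"
    by auto
  let ?d = "q_int (Suc (b + n)) * inverse q ^ c"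
  have "(D_E ^^ Suc n) (mon (a, b + Suc n, c)) = ?d \<odot> (D_E ^^ n) (mon (a, b + n, c))"
    using linear_map_funpow[OF linear_D(2), of n]
    by (simp only: funpow_Suc_right comp_apply add_Suc_right D_E_mon_Suc linear_map_def mon_closed)
  also have "\<dots> = (?d * \<kappa>) \<odot> mon (a, b, c)"
    unfolding k(2) by (simp add: smult_smult del: mon.simps)
  moreover have "?d * \<kappa> \<noteq> 0"
    using k(1) q_int_nz[of "Suc (b + n)"] Suc.prems by simp
  ultimately show ?case by metis
qed

lemma D_F_pow_mon:
  assumes "a + n < N"
  shows "\<exists>\<kappa>. \<kappa> \<noteq> 0 \<and> (D_F ^^ n) (mon (a + n, b, c)) = \<kappa> \<odot> mon (a, b, c + n * (N - 1))"
  using assms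
proof (induction n arbitrary: c)
  case 0
  show ?case by (rule exI[of _ 1]) (simp del: mon.simps)
next
  case (Suc n)
  obtain \<kappa> where k: "\<kappa> \<noteq> 0"
    "(D_F ^^ n) (mon (a + n, b, c + (N - 1))) = \<kappa> \<odot> mon (a, b, c + (N - 1) + n * (N - 1))"
    using Suc.IH[of "c + (N - 1)"] Suc.prems by auto
  let ?d = "q2_int (Suc (a + n)) * q ^ (b + c) * (inverse q ^ 2) ^ b"
  have "(D_F ^^ Suc n) (mon (a + Suc n, b, c)) = ?d \<odot> (D_F ^^ n) (mon (a + n, b, c + (N - 1)))"
    using linear_map_funpow[OF linear_D(3), of n]
    by (simp only: funpow_Suc_right comp_apply add_Suc_right D_F_mon_Suc linear_map_def mon_closed)
  also have "\<dots> = (?d * \<kappa>) \<odot> mon (a, b, c + Suc n * (N - 1))"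
    unfolding k(2) by (simp add: smult_smult add.assoc del: mon.simps)
  moreover have "?d * \<kappa> \<noteq> 0"
    using k(1) q2_int_nz[of "Suc (a + n)"] Suc.prems by simp
  ultimately show ?case by metis
qed

text \<open>The eigenvalue is \<open>q^(2(a-b))\<close>, independent of \<open>c\<close>; it is
  written with powers of the inverse to avoid negative exponents.\<close>

lemma adK_mon:
  "Ki \<otimes> mon (a, b, c) \<otimes> K = ((q ^ 2) ^ a * (inverse q ^ 2) ^ b) \<odot> mon (a, b, c)"
proof -
  have "Ki \<otimes> mon (a, b, c) \<otimes> K = (Ki \<otimes> F [^] a) \<otimes> (E [^] b \<otimes> (K [^] c \<otimes> K))"
    by (simp add: m_assoc)
  also have "\<dots> = (q ^ 2) ^ a \<odot> (F [^] a \<otimes> ((Ki \<otimes> E [^] b) \<otimes> (K \<otimes> K [^] c)))"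
    unfolding Ki_F_pow nat_pow_Suc[symmetric] nat_pow_Suc2[OF gen_closed[of gen_K], of c]
    by (simp add: smult_mult_l m_assoc)
  also have "\<dots> = ((q ^ 2) ^ a * (inverse q ^ 2) ^ b) \<odot> mon (a, b, c)"
    unfolding Ki_E_pow by (simp add: smult_mult_l smult_mult_r smult_smult m_assoc)
  finally show ?thesis .
qed

lemma linear_adK: "linear_map R (\<lambda>x. Ki \<otimes> x \<otimes> K)"
  by (auto simp: linear_map_def l_distr r_distr smult_mult_l smult_mult_r)

lemma linear_comb:
  assumes "linear_map R L"
  shows "L (comb f) = (\<Oplus>i\<in>idx. f i \<odot> L (mon i))"
proof -
  have "L (comb f) = (\<Oplus>i\<in>idx. L (f i \<odot> mon i))"
    unfolding comb_def by (rule linear_map_finsum[OF assms]) simp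
  also have "\<dots> = (\<Oplus>i\<in>idx. f i \<odot> L (mon i))"
    using assms by (intro add.finprod_cong') (auto simp: linear_map_def)
  finally show ?thesis .
qed

text \<open>The components for the other eigenvalues \<open>\<nu>\<close> are killed one after the other by applying \<open>L - \<nu>\<close>.\<close>

lemma eigenspace_projection:
  assumes L: "linear_map R L" "\<And>x. x \<in> A \<Longrightarrow> L x \<in> A"
    and mon: "\<And>i. L (mon i) = ev i \<odot> mon i"
    and f: "comb f \<in> A"
  shows "comb (\<lambda>i. if ev i = \<mu> then f i else 0) \<in> A"
proof -
  have "\<exists>g. comb g \<in> A \<and> (\<forall>i. ev i \<in> V \<longrightarrow> g i = 0) \<and> (\<forall>i. ev i = \<mu> \<longrightarrow> g i = f i)"
    if "finite V" "\<mu> \<notin> V" for V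
    using that
  proof (induction V)
    case empty
    show ?case using f by blast
  next
    case (insert \<nu> V)
    then obtain g where g: "comb g \<in> A" "\<And>i. ev i \<in> V \<Longrightarrow> g i = 0" "\<And>i. ev i = \<mu> \<Longrightarrow> g i = f i"
      by auto
    have "L (comb g) = comb (\<lambda>i. g i * ev i)"
      unfolding linear_comb[OF L(1)] mon by (simp add: comb_def smult_smult del: mon.simps)
    then have "comb (\<lambda>i. g i * ev i) \<oplus> (- \<nu>) \<odot> comb g \<in> A"
      using L(2)[OF g(1)] A_add A_smult[OF g(1)] by simp
    \<comment> \<open>The factor \<open>inverse (\<mu> - \<nu>)\<close> normalizes
      \<open>L - \<nu>\<close> so that the coefficients at the eigenvalue \<open>\<mu>\<close> stay
      unchanged.\<close>
    then have "comb (\<lambda>i. inverse (\<mu> - \<nu>) * (g i * ev i + - \<nu> * g i)) \<in> A"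
      unfolding comb_smult comb_add using A_smult comb_smult by metis
    moreover have "inverse (\<mu> - \<nu>) * (g i * ev i + - \<nu> * g i) = 0" if "ev i \<in> insert \<nu> V" for i
      using that g(2)[of i] by auto
    moreover have "inverse (\<mu> - \<nu>) * (g i * ev i + - \<nu> * g i) = f i" if "ev i = \<mu>" for i
      using that g(3)[of i] insert.prems by (auto simp: field_simps)
    ultimately show ?case by blast
  qed
  from this[of "ev ` idx - {\<mu>}"] obtain g where g: "comb g \<in> A"
    "\<And>i. ev i \<in> ev ` idx - {\<mu>} \<Longrightarrow> g i = 0" "\<And>i. ev i = \<mu> \<Longrightarrow> g i = f i"
    by auto
  have "comb g = comb (\<lambda>i. if ev i = \<mu> then f i else 0)"
    unfolding comb_def using g(2,3) by (intro add.finprod_cong') auto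
  with g(1) show ?thesis by simp
qed

end

section \<open>From a nonscalar element to the whole algebra\<close>

context uq_normal
begin

text \<open>The vectors \<open>x j\<close> are arbitrary so that the lemma also applies to the
  images of the monomials under a power of \<open>D_E\<close>.\<close>

lemma comb_single:
  assumes "i \<in> idx" "\<And>j. j \<in> idx \<Longrightarrow> j \<noteq> i \<Longrightarrow> f j \<odot> x j = \<zero>" "\<And>j. x j \<in> carrier R"
  shows "(\<Oplus>j\<in>idx. f j \<odot> x j) = f i \<odot> x i"
  using assms by (subst add.finprod_mono_neutral_cong_right[of idx "{i}" _ "\<lambda>j. f j \<odot> x j"]) auto

lemma comb_two:
  assumes "i \<in> idx" "i' \<in> idx" "i \<noteq> i'" "\<And>j. j \<in> idx \<Longrightarrow> j \<noteq> i \<Longrightarrow> j \<noteq> i' \<Longrightarrow> f j \<odot> x j = \<zero>"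
    "\<And>j. x j \<in> carrier R"
  shows "(\<Oplus>j\<in>idx. f j \<odot> x j) = f i \<odot> x i \<oplus> f i' \<odot> x i'"
  using assms by (subst add.finprod_mono_neutral_cong_right[of idx "{i, i'}" _ "\<lambda>j. f j \<odot> x j"]) auto

lemma root_of_unity_pow_inj:
  assumes "p \<noteq> (0::'a)" "\<And>m. p ^ m = 1 \<longleftrightarrow> N dvd m" "p ^ m = p ^ n" "m < N" "n < N"
  shows "m = n"
proof -
  have "j \<le> i" if "p ^ i = p ^ j" "j < N" for i j
  proof (rule ccontr)
    assume "\<not> j \<le> i"
    then have "p ^ j = p ^ i * p ^ (j - i)" by (simp flip: power_add)
    then have "p ^ (j - i) = 1" using that(1) assms(1) by simp
    then have "N dvd j - i" using assms(2) by simp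
    then show False using \<open>\<not> j \<le> i\<close> that(2) by (auto dest: dvd_imp_le)
  qed
  from this[of m n] this[of n m] show ?thesis using assms(3-5) by simp
qed

lemmas q_pow_inj = root_of_unity_pow_inj[OF q_nz q_pow_eq_1_iff]
lemmas q2_pow_inj = root_of_unity_pow_inj[OF power_not_zero[OF q_nz] q2_pow_eq_1_iff]

text \<open>Clears the inverse powers: a - b = a' - b' modulo \<open>N\<close> becomes a + b' = a' +
  b.\<close>

lemma weight_eq:
  assumes "(q ^ 2) ^ a * (inverse q ^ 2) ^ b = (q ^ 2) ^ a' * (inverse q ^ 2) ^ b'"
  shows "(q ^ 2) ^ (a + b') = (q ^ 2) ^ (a' + b)"
proof -
  have 1: "(inverse q ^ 2) ^ n * (q ^ 2) ^ n = 1" for n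
    by (simp flip: power_mult_distrib)
  have "(q ^ 2) ^ (a + b') = (q ^ 2) ^ a * (inverse q ^ 2) ^ b * ((q ^ 2) ^ b * (q ^ 2) ^ b')"
    using 1[of b] by (simp add: power_add mult.assoc)
  also have "\<dots> = (q ^ 2) ^ (a' + b) * ((inverse q ^ 2) ^ b' * (q ^ 2) ^ b')"
    unfolding assms power_add by (simp only: ac_simps)
  finally show ?thesis by (simp only: 1 mult_1_right)
qed

text \<open>In a homogeneous combination the exponent b determines a and c, because a - b and b + c
  are fixed modulo \<open>N\<close>. The top value of b can therefore be isolated by
  \<open>D_E\<close>. What remains is a case distinction on whether a and c agree.\<close>

lemma A_eq_carrier_if_not_scalar:
  assumes f: "comb f \<in> A" and i0: "i\<^sub>0 \<in> idx" "i\<^sub>0 \<noteq> (0, 0, 0)" "f i\<^sub>0 \<noteq> 0"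
  shows "A = carrier R"
proof -
  define wt where "wt = (\<lambda>(a, b, c :: nat). (q ^ 2) ^ a * (inverse q ^ 2) ^ b :: 'a)"
  define dg where "dg = (\<lambda>(a :: nat, b, c). q ^ (b + c) :: 'a)"
  \<comment> \<open>Both projections use the eigenvalues of \<open>i\<^sub>0\<close>, so that the
    coefficient of this nonscalar monomial survives.\<close>
  define g where "g i = (if dg i = dg i\<^sub>0 then if wt i = wt i\<^sub>0 then f i else 0 else 0)" for i
  have "comb (\<lambda>i. if wt i = wt i\<^sub>0 then f i else 0) \<in> A"
    using linear_adK A_adK _ f by (rule eigenspace_projection) (auto simp: wt_def adK_mon simp del: mon.simps)
  with linear_D(1) A_D(1) _ have gA: "comb g \<in> A"
    unfolding g_def by (rule eigenspace_projection) (auto simp: dg_def D_K_mon simp del: mon.simps)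
  have g0: "g i\<^sub>0 \<noteq> 0" using i0(3) by (simp add: g_def)
  define supp where "supp = {i \<in> idx. g i \<noteq> 0}"
  have same: "(q ^ 2) ^ (a + b') = (q ^ 2) ^ (a' + b)" "q ^ (b + c) = q ^ (b' + c')"
    if "(a, b, c) \<in> supp" "(a', b', c') \<in> supp" for a b c a' b' c'
  proof -
    have "wt (a, b, c) = wt (a', b', c')" "dg (a, b, c) = dg (a', b', c')"
      using that by (auto simp: supp_def g_def split: if_splits)
    then show "(q ^ 2) ^ (a + b') = (q ^ 2) ^ (a' + b)" "q ^ (b + c) = q ^ (b' + c')"
      by (auto simp: wt_def dg_def intro: weight_eq)
  qed
  have lt: "a < N \<and> b < N \<and> c < N" if "(a, b, c) \<in> supp" for a b c
    using that by (simp add: supp_def idx_def)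
  have unique: "(a', b', c') = (a, b, c)" if "(a, b, c) \<in> supp" "(a', b', c') \<in> supp" "b = b'"
    for a b c a' b' c'
    using same[OF that(1,2)] lt[OF that(1)] lt[OF that(2)] that(3) q2_pow_inj[of a a'] q_pow_inj[of c c']
    by (simp add: power_add)
  have "i\<^sub>0 \<in> supp" using g0 i0(1) by (simp add: supp_def)
  then have fin: "finite supp" "supp \<noteq> {}"
    by (simp add: supp_def, blast)
  let ?B = "(\<lambda>i. fst (snd i)) ` supp"
  have "Max ?B \<in> ?B" using fin by (intro Max_in) auto
  then obtain i\<^sub>1 where i1: "i\<^sub>1 \<in> supp" "fst (snd i\<^sub>1) = Max ?B" by auto
  obtain a b c where abc: "i\<^sub>1 = (a, b, c)" by (cases i\<^sub>1)
  have s: "(a, b, c) \<in> supp" "(a, b, c) \<in> idx" "g (a, b, c) \<noteq> 0"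
    using i1(1) by (auto simp: abc supp_def)
  have mx: "b' \<le> b" if "(a', b', c') \<in> supp" for a' b' c'
    proof -
    have "fst (snd (a', b', c')) \<in> ?B" using that by (rule imageI)
    then have "b' \<le> Max ?B" using fin(1) by (intro Max_ge) simp_all
    then show ?thesis using i1(2) by (simp add: abc)
  qed
  have lt1: "a < N" "b < N" "c < N" using lt[OF s(1)] by auto
  \<comment> \<open>By maximality of \<open>b\<close> and by \<open>unique\<close>, every other
    monomial of the support has a smaller exponent of \<open>E\<close> and is killed by
    \<open>D_E ^^ b\<close>.\<close>
  have FaKc: "mon (a, 0, c) \<in> A"
  proof -
    have "(D_E ^^ b) (comb g) = (\<Oplus>j\<in>idx. g j \<odot> (D_E ^^ b) (mon j))"
      by (rule linear_comb) (rule linear_map_funpow[OF linear_D(2)])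
    also have "\<dots> = g (a, b, c) \<odot> (D_E ^^ b) (mon (a, b, c))"
    proof (rule comb_single[OF s(2)])
      fix j assume j: "j \<in> idx" "j \<noteq> (a, b, c)"
      obtain a' b' c' where j': "j = (a', b', c')" by (cases j)
      show "g j \<odot> (D_E ^^ b) (mon j) = \<zero>"
      proof (cases "g j = 0")
        case False
        then have "j \<in> supp" using j by (simp add: supp_def)
        then have "b' < b" using mx[of a' b' c'] unique[OF s(1), of a' b' c'] j j' by fastforce
        then show ?thesis by (simp add: j' D_E_pow_mon_eq_0 del: mon.simps)
      qed (use linear_map_funpow[OF linear_D(2), of b] in \<open>simp add: linear_map_def\<close>)
    qed (use linear_map_funpow[OF linear_D(2), of b] in \<open>simp add: linear_map_def del: mon.simps\<close>)
    finally have "g (a, b, c) \<odot> (D_E ^^ b) (mon (a, b, c)) \<in> A"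
      using A_D_pow(1)[OF gA, of b] by simp
    moreover obtain \<kappa> where "\<kappa> \<noteq> 0" "(D_E ^^ b) (mon (a, b, c)) = \<kappa> \<odot> mon (a, 0, c)"
      using D_E_pow_mon[of 0 b a c] lt1 by auto
    ultimately show ?thesis
      using s(3) A_smult_cancel[of "g (a, b, c) * \<kappa>" "mon (a, 0, c)"]
      by (simp add: smult_smult del: mon.simps)
  qed
  show ?thesis
  \<comment> \<open>Lowering \<open>a\<close> times turns \<open>mon (a, 0, c)\<close> into a
    multiple of this power of \<open>K\<close>. Its exponent is c - a modulo
    \<open>N\<close>.\<close>
  proof (cases "N dvd c + a * (N - 1)")
    case False
    obtain \<kappa> where "\<kappa> \<noteq> 0" "(D_F ^^ a) (mon (a, 0, c)) = \<kappa> \<odot> mon (0, 0, c + a * (N - 1))"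
      using D_F_pow_mon[of 0 a 0 c] lt1 by auto
    then have "mon (0, 0, c + a * (N - 1)) \<in> A"
      using A_D_pow(2)[OF FaKc, of a] A_smult_cancel by (metis mon_closed)
    then show ?thesis
      using A_eq_carrier_if_group_like[OF _ False] by simp
  next
    case True
    \<comment> \<open>Adding \<open>a\<close> shows without subtraction that the exponent is c - a
      modulo \<open>N\<close>. Divisibility then yields \<open>q ^ a = q ^ c\<close>, hence
      \<open>a = c\<close>, as both are below \<open>N\<close>.\<close>
    have e: "c + a * (N - 1) + a = c + N * a"
      using N_gt_1 by (cases N) simp_all
    have "q ^ a = q ^ (c + a * (N - 1) + a)"
      using True unfolding power_add[of q "c + a * (N - 1)"] by (simp add: q_pow_eq_1_iff del: One_nat_def)
    also have "\<dots> = q ^ c"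
      unfolding e by (simp add: power_add power_mult)
    finally have ac: "a = c" using q_pow_inj lt1 by blast
    show ?thesis
    proof (cases a)
      case (Suc a')
      \<comment> \<open>One lowering fewer than \<open>a\<close> keeps a factor \<open>F\<close>;
        since \<open>c = a\<close>, the exponent of \<open>K\<close> that is left is 1 modulo
        \<open>N\<close>.\<close>
      obtain \<kappa> where k: "\<kappa> \<noteq> 0" "(D_F ^^ a') (mon (a, 0, c)) = \<kappa> \<odot> mon (1, 0, c + a' * (N - 1))"
        using D_F_pow_mon[of 1 a' 0 c] lt1 Suc by auto
      have e: "c + a' * (N - 1) = a' * N + 1"
        using N_gt_1 Suc ac by (simp add: algebra_simps)
      have "(a' * N + 1) mod N = 1"
        using N_gt_1 by (subst mod_mult_self3) simp
      then have "K [^] (c + a' * (N - 1)) = K"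
        unfolding e by (metis K_pow_mod gen_closed nat_pow_eone)
      then have "mon (1, 0, c + a' * (N - 1)) = F \<otimes> K" by simp
      then have "F \<otimes> K \<in> A"
        using k A_D_pow(2)[OF FaKc, of a'] A_smult_cancel[of \<kappa> "F \<otimes> K"] by simp
      then show ?thesis by (rule A_eq_carrier_if_FK)
    next
      case 0
      \<comment> \<open>If a = b = c = 0 with \<open>b\<close> maximal, then \<open>unique\<close>
        leaves (0, 0, 0) as the only element of the support, which contains
        \<open>i\<^sub>0\<close>.\<close>
      have "b \<noteq> 0"
      proof
        assume "b = 0"
        obtain a0 b0 c0 where j: "i\<^sub>0 = (a0, b0, c0)" by (cases i\<^sub>0)
        have "i\<^sub>0 \<in> supp" using i0 g0 by (simp add: supp_def)
        then show False
          using mx[of a0 b0 c0] unique[OF s(1), of a0 b0 c0] \<open>b = 0\<close> 0 ac i0(2) j by simp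
      qed
      then obtain b' where b': "b = Suc b'" by (cases b) auto
      let ?L = "D_E ^^ b'"
      have L: "linear_map R ?L" by (rule linear_map_funpow[OF linear_D(2)])
      \<comment> \<open>The one possible companion of (0, b, 0) with exponent of \<open>E\<close>
        equal to b - 1: equal weight forces a + 1 = 0 and equal degree forces c = 1 modulo
        \<open>N\<close>.\<close>
      let ?j = "(N - 1, b', 1)"
      have jidx: "?j \<in> idx" using lt1 b' N_gt_1 by (simp add: idx_def)
      have "?L (comb g) = (\<Oplus>j\<in>idx. g j \<odot> ?L (mon j))"
        using L by (rule linear_comb)
      also have "\<dots> = g (a, b, c) \<odot> ?L (mon (a, b, c)) \<oplus> g ?j \<odot> ?L (mon ?j)"
      proof (rule comb_two[OF s(2) jidx])
        show "(a, b, c) \<noteq> ?j" using b' by simp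
        fix j assume j: "j \<in> idx" "j \<noteq> (a, b, c)" "j \<noteq> ?j"
        obtain a1 b1 c1 where j1: "j = (a1, b1, c1)" by (cases j)
        show "g j \<odot> ?L (mon j) = \<zero>"
        proof (cases "g j = 0")
          case False
          then have js: "(a1, b1, c1) \<in> supp" using j j1 by (simp add: supp_def)
          have "b1 < b" using mx[OF js] unique[OF s(1) js] j j1 by fastforce
          moreover have "b1 \<noteq> b'"
          proof
            assume "b1 = b'"
            have "(q ^ 2) ^ b' = (q ^ 2) ^ b' * (q ^ 2) ^ Suc a1" "q ^ b' * q ^ 1 = q ^ b' * q ^ c1"
              using same[OF s(1) js] 0 ac b' \<open>b1 = b'\<close> by (simp_all add: power_add mult.commute mult.left_commute)
            then have "N dvd Suc a1" "q ^ 1 = q ^ c1"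
              using q2_pow_eq_1_iff[of "Suc a1"] by simp_all
            moreover have "a1 < N" "c1 < N" using lt[OF js] by auto
            ultimately have "Suc a1 = N" "c1 = 1"
              using q_pow_inj[of 1 c1] N_gt_1 by (auto dest: dvd_imp_le)
            then show False using j(3) j1 \<open>b1 = b'\<close> by auto
          qed
          ultimately have "b1 < b'" using b' by simp
          then show ?thesis by (simp add: j1 D_E_pow_mon_eq_0 del: mon.simps)
        qed (use L in \<open>simp add: linear_map_def\<close>)
      qed (use L in \<open>simp_all add: linear_map_def del: mon.simps\<close>)
      finally have LA: "g (a, b, c) \<odot> ?L (mon (a, b, c)) \<oplus> g ?j \<odot> ?L (mon ?j) \<in> A"
        using A_D_pow(1)[OF gA, of b'] by simp
      obtain \<kappa> where k: "\<kappa> \<noteq> 0" "?L (mon (a, b, c)) = \<kappa> \<odot> mon (0, 1, 0)"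
        using D_E_pow_mon[of 1 b' a c] lt1 b' 0 ac by auto
      obtain \<kappa>' where k': "\<kappa>' \<noteq> 0" "?L (mon ?j) = \<kappa>' \<odot> mon (N - 1, 0, 1)"
        using D_E_pow_mon[of 0 b' "N - 1" 1] lt1 b' by auto
      define \<alpha> \<beta> where "\<alpha> = g (a, b, c) * \<kappa>" and "\<beta> = g ?j * \<kappa>'"
      have y: "\<alpha> \<odot> mon (0, 1, 0) \<oplus> \<beta> \<odot> mon (N - 1, 0, 1) \<in> A"
        using LA unfolding k k' \<alpha>_def \<beta>_def by (simp only: smult_smult mon_closed)
      have "\<alpha> \<noteq> 0" using s(3) k(1) by (simp add: \<alpha>_def)
      show ?thesis
      proof (cases "\<beta> = 0")
        case True
        then have "\<alpha> \<odot> E \<in> A" using y by simp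
        then have "E \<in> A" using \<open>\<alpha> \<noteq> 0\<close> by (rule A_smult_cancel) simp
        then show ?thesis by (rule A_eq_carrier_if_E)
      next
        \<comment> \<open>\<open>D_F\<close> kills \<open>E\<close>, so \<open>N - 1\<close>
          lowerings leave only a multiple of a power of \<open>K\<close>, coming from
          \<open>F^(N-1) K\<close>. Its exponent is 1 + (N-1)^2, which is 2 modulo \<open>N\<close>
          and hence not divisible by the odd number \<open>N\<close>.\<close>
        case False
        let ?M = "D_F ^^ (N - 1)"
        have M: "linear_map R ?M" by (rule linear_map_funpow[OF linear_D(3)])
        obtain m where m: "N - 1 = Suc m" using N_gt_1 by (cases "N - 1") auto
        have "?M (mon (0, 1, 0)) = \<zero>"
          unfolding m funpow_Suc_right comp_apply D_F_mon_0
          by (rule linear_map_zero[OF linear_map_funpow[OF linear_D(3)]])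
        moreover obtain \<kappa> where k: "\<kappa> \<noteq> 0" "?M (mon (N - 1, 0, 1)) = \<kappa> \<odot> mon (0, 0, 1 + (N - 1) * (N - 1))"
          using D_F_pow_mon[of 0 "N - 1" 0 1] lt1 by auto
        ultimately have "?M (\<alpha> \<odot> mon (0, 1, 0) \<oplus> \<beta> \<odot> mon (N - 1, 0, 1)) =
            (\<beta> * \<kappa>) \<odot> mon (0, 0, 1 + (N - 1) * (N - 1))"
          using M by (simp add: linear_map_def smult_smult del: mon.simps)
        then have "mon (0, 0, 1 + (N - 1) * (N - 1)) \<in> A"
          using A_D_pow(2)[OF y, of "N - 1"] A_smult_cancel[of "\<beta> * \<kappa>"] k(1) False by simp
        then have "K [^] (1 + (N - 1) * (N - 1)) \<in> A" by simp
        moreover have "\<not> N dvd 1 + (N - 1) * (N - 1)"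
        proof
          assume d: "N dvd 1 + (N - 1) * (N - 1)"
          have "1 + (N - 1) * (N - 1) + 2 * N = N * N + 2"
            using N_gt_1 by (cases N) (simp_all add: algebra_simps)
          then have "N dvd N * N + 2"
            using d by (metis dvd_add dvd_triv_right)
          then have "N dvd 2" by (metis dvd_add_right_iff dvd_triv_left)
          then show False using N_gt_1 odd_N by (auto dest!: dvd_imp_le simp: le_Suc_eq numeral_2_eq_2)
        qed
        ultimately show ?thesis by (rule A_eq_carrier_if_group_like)
      qed
    qed
  qed
qed

text \<open>If \<open>A\<close> is not everything, then every expression of an element of
  \<open>A\<close> in the monomials has zero coefficients away from (0, 0, 0).\<close>

theorem A_trivial: "trivial_subalgebra R A"
proof (cases "A = carrier R")
  case False
  have "A \<subseteq> scalars R"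
  proof
    fix x assume x: "x \<in> A"
    have "{comb f | f. True} = carrier R"
    proof (rule generated)
      show "\<one> \<in> {comb f | f. True}" using mon_in_span[of 0 0 0] by auto
      show "\<phi> g \<otimes> x \<in> {comb f | f. True}" if "x \<in> {comb f | f. True}" for g x
        using that gen_mult_comb by auto
    qed (use comb_add comb_smult in auto)
    then obtain f where f: "x = comb f" using A_in_carrier[OF x] by blast
    have z: "f i = 0" if "i \<in> idx" "i \<noteq> (0, 0, 0)" for i
      using A_eq_carrier_if_not_scalar[of f i] x f that False by auto
    have "x = f (0, 0, 0) \<odot> mon (0, 0, 0)"
      unfolding f comb_def
      by (rule comb_single) (use z N_gt_1 in \<open>auto simp: idx_def\<close>)
    then show "x \<in> scalars R" by (simp add: scalars_def)
  qed
  moreover have "scalars R \<subseteq> A"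
    using A_smult[OF A_one] by (auto simp: scalars_def)
  ultimately show ?thesis by (auto simp: trivial_subalgebra_def)
qed (simp add: trivial_subalgebra_def)

end

section \<open>The small quantum group\<close>

lemma field_algebra_hom_comp:
  assumes "field_algebra_hom A B h" "field_algebra_hom B C h'"
  shows "field_algebra_hom A C (h' \<circ> h)"
proof (rule field_algebra_hom.intro)
  show "field_algebra A" "field_algebra C"
    using assms by (simp_all add: field_algebra_hom_def)
  have h: "h \<in> ring_hom A B" "h' \<in> ring_hom B C"
    using assms by (simp_all add: field_algebra_hom_def field_algebra_hom_axioms_def)
  moreover have "h' (h (c \<odot>\<^bsub>A\<^esub> x)) = c \<odot>\<^bsub>C\<^esub> h' (h x)" if "x \<in> carrier A" for c x
    using that ring_hom_closed[OF h(1) that] field_algebra_hom.hom_smult[OF assms(1)]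
      field_algebra_hom.hom_smult[OF assms(2)] by simp
  ultimately show "field_algebra_hom_axioms A C (h' \<circ> h)"
    by (intro field_algebra_hom_axioms.intro ring_hom_trans) simp_all
qed

lemma uq_sl2_simps [simp]:
  "carrier (uq_sl2 N q) = carrier (uq_algebra N q)"
  "monoid.mult (uq_sl2 N q) = monoid.mult (uq_algebra N q)"
  "one (uq_sl2 N q) = one (uq_algebra N q)"
  "ring.zero (uq_sl2 N q) = ring.zero (uq_algebra N q)"
  "add (uq_sl2 N q) = add (uq_algebra N q)"
  "smult (uq_sl2 N q) = smult (uq_algebra N q)"
  "comult (uq_sl2 N q) =
    (\<lambda>C. the_elem (free_lift (tensor_algebra (uq_algebra N q) (uq_algebra N q)) (uq_comult_gen N q) ` C))"
  "antipode (uq_sl2 N q) =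
    (\<lambda>C. the_elem (free_lift (opposite_algebra (uq_algebra N q)) (uq_antipode_gen N q) ` C))"
  by (simp_all add: uq_sl2_def Let_def module.extend_def hopf_algebra.fields_def)

lemma finsum_uq_sl2 [simp]: "finsum (uq_sl2 N q) = finsum (uq_algebra N q)"
  by (simp add: finsum_def finprod_def fun_eq_iff)

text \<open>The tensor constructions read only the algebra fields of the record, so the Hopf
  structure may be dropped.\<close>

lemma tensor_uq_sl2 [simp]:
  "tensor_algebra (uq_sl2 N q) (uq_sl2 N q) = tensor_algebra (uq_algebra N q) (uq_algebra N q)"
  "pure_tensor (uq_sl2 N q) (uq_sl2 N q) = pure_tensor (uq_algebra N q) (uq_algebra N q)"
proof -
  have p: "uq_sl2 N q \<times>\<times> uq_sl2 N q = uq_algebra N q \<times>\<times> uq_algebra N q"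
    by (simp add: DirProd_def)
  have r: "tensor_relators (uq_sl2 N q) (uq_sl2 N q) = tensor_relators (uq_algebra N q) (uq_algebra N q)"
    by (simp add: tensor_relators_def)
  show
    "tensor_algebra (uq_sl2 N q) (uq_sl2 N q) = tensor_algebra (uq_algebra N q) (uq_algebra N q)"
    "pure_tensor (uq_sl2 N q) (uq_sl2 N q) = pure_tensor (uq_algebra N q) (uq_algebra N q)"
    unfolding tensor_algebra_def tensor_ideal_def pure_tensor_def fun_eq_iff p r by simp_all
qed

text \<open>The classes of words span the quotient, and each word arises from the empty one by
  multiplication with generators on the left.\<close>

lemma uq_algebra_generated:
  fixes N :: nat and q :: "'k::field"
  defines "U \<equiv> uq_algebra N q"
  assumes S: "S \<subseteq> carrier U" "\<one>\<^bsub>U\<^esub> \<in> S"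
    and add: "\<And>x y. x \<in> S \<Longrightarrow> y \<in> S \<Longrightarrow> x \<oplus>\<^bsub>U\<^esub> y \<in> S"
    and smult: "\<And>c x. x \<in> S \<Longrightarrow> c \<odot>\<^bsub>U\<^esub> x \<in> S"
    and gen: "\<And>g x. x \<in> S \<Longrightarrow> uq_gen N q g \<otimes>\<^bsub>U\<^esub> x \<in> S"
  shows "S = carrier U"
proof -
  let ?c = "\<lambda>f. uq_ideal N q +>\<^bsub>free_algebra\<^esub> f"
  interpret c: field_algebra_hom free_algebra U ?c
    unfolding U_def uq_algebra_def
    by (rule algebra_ideal.field_algebra_hom_cls[OF algebra_ideal_uq_ideal])
  have word: "?c (Poly_Mapping.single w 1) \<in> S" for w
  proof (induction w)
    case Nil
    have "\<one>\<^bsub>free_algebra\<^esub> = Poly_Mapping.single [] (1 :: 'k)"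
      by (simp add: free_algebra_def free_monoid_def)
    then show ?case using S(2) c.hom_one by metis
  next
    case (Cons g w)
    have "Poly_Mapping.single (g # w) (1 :: 'k) = free_gen g \<otimes>\<^bsub>free_algebra\<^esub> Poly_Mapping.single w 1"
      by (simp add: free_algebra_def free_gen_def) (simp add: free_monoid_def)
    then have "?c (Poly_Mapping.single (g # w) 1) = uq_gen N q g \<otimes>\<^bsub>U\<^esub> ?c (Poly_Mapping.single w 1)"
      by (simp add: uq_gen_def)
    then show ?case using Cons gen by simp
  qed
  have all: "?c f \<in> S" for f
    using subset_UNIV[of "Poly_Mapping.keys f"]
  proof (induction f rule: poly_mapping_single_induct)
    case zero
    \<comment> \<open>Zero is reached as a scalar multiple of the empty word, whose class is already
      in \<open>S\<close>.\<close>
    have "(0 :: uq_generator list \<Rightarrow>\<^sub>0 'k) = 0 \<odot>\<^bsub>free_algebra\<^esub> Poly_Mapping.single [] 1"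
      by (simp add: free_algebra_def scale_single)
    then have "?c 0 = 0 \<odot>\<^bsub>U\<^esub> ?c (Poly_Mapping.single [] 1)"
      by (metis c.hom_smult carrier_free_algebra UNIV_I)
    then show ?case by (simp only: smult[OF word])
  next
    case (single w k)
    have "Poly_Mapping.single w k = k \<odot>\<^bsub>free_algebra\<^esub> Poly_Mapping.single w 1"
      by (simp add: free_algebra_def scale_single)
    then have "?c (Poly_Mapping.single w k) = k \<odot>\<^bsub>U\<^esub> ?c (Poly_Mapping.single w 1)"
      by (metis c.hom_smult carrier_free_algebra UNIV_I)
    then show ?case using smult[OF word] by simp
  next
    case (add f f')
    have "f + f' = f \<oplus>\<^bsub>free_algebra\<^esub> f'" by (simp add: free_algebra_def)
    then have "?c (f + f') = ?c f \<oplus>\<^bsub>U\<^esub> ?c f'"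
      by (metis c.hom_add carrier_free_algebra UNIV_I)
    then show ?case using add \<open>\<And>x y. x \<in> S \<Longrightarrow> y \<in> S \<Longrightarrow> x \<oplus>\<^bsub>U\<^esub> y \<in> S\<close> by simp
  qed
  have "carrier U = range ?c"
    unfolding U_def uq_algebra_def algebra_ideal.carrier_quot[OF algebra_ideal_uq_ideal] by simp
  then have "carrier U \<subseteq> S"
    using all by (simp only: image_subset_iff) simp
  with S(1) show ?thesis by (rule equalityI)
qed

section \<open>The structure maps of \<open>uq_sl2\<close> and the reduction to
  \<open>uq_normal\<close>\<close>

context uq_params
begin

abbreviation U where "U \<equiv> uq_algebra N q"

sublocale U: uq_rels N q U "uq_gen N q"
  by (rule uq_rels_uq_algebra)

abbreviation \<Delta> where "\<Delta> \<equiv> comult (uq_sl2 N q)"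
abbreviation \<S> where "\<S> \<equiv> antipode (uq_sl2 N q)"

lemma uq_rels_comult: "uq_rels N q (tensor_algebra U U) (uq_comult_gen N q)"
  by (rule U.uq_rels_tensor) (simp_all add: Let_def U.inv_K)

lemma comult_hom: "field_algebra_hom U (tensor_algebra U U) \<Delta>"
  using uq_rels.induced_hom[OF uq_rels_comult] by simp

lemma comult_gen: "\<Delta> (uq_gen N q g) = uq_comult_gen N q g"
  using uq_rels.induced_hom_gen[OF uq_rels_comult] by simp

lemma uq_rels_antipode: "uq_rels N q (opposite_algebra U) (uq_antipode_gen N q)"
  by (rule U.uq_rels_opposite) (simp_all add: Let_def U.inv_K)

lemma antipode_hom: "field_algebra_hom U (opposite_algebra U) \<S>"
  using uq_rels.induced_hom[OF uq_rels_antipode] by simp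

text \<open>The values at \<open>\<one>\<close> and \<open>Ki\<close> are included because these
  elements are first tensor factors in \<open>\<Delta>(E)\<close> and \<open>\<Delta>(F)\<close>.
  The value at \<open>Ki\<close> follows from \<open>Ki = K [^] (N - 1)\<close>.\<close>

lemma antipode_values:
  "\<S> U.K = U.Ki" "\<S> U.E = \<ominus>\<^bsub>U\<^esub> (U.E \<otimes>\<^bsub>U\<^esub> U.Ki)" "\<S> U.F = \<ominus>\<^bsub>U\<^esub> (U.K \<otimes>\<^bsub>U\<^esub> U.F)"
  "\<S> \<one>\<^bsub>U\<^esub> = \<one>\<^bsub>U\<^esub>" "\<S> U.Ki = U.K"
proof -
  interpret S: field_algebra_hom U "opposite_algebra U" \<S> by (rule antipode_hom)
  show K: "\<S> U.K = U.Ki" and "\<S> U.E = \<ominus>\<^bsub>U\<^esub> (U.E \<otimes>\<^bsub>U\<^esub> U.Ki)" "\<S> U.F = \<ominus>\<^bsub>U\<^esub> (U.K \<otimes>\<^bsub>U\<^esub> U.F)"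
    using uq_rels.induced_hom_gen[OF uq_rels_antipode] by (simp_all add: Let_def U.inv_K)
  show "\<S> \<one>\<^bsub>U\<^esub> = \<one>\<^bsub>U\<^esub>" using S.hom_one by (simp del: uq_sl2_simps)
  have "\<S> U.Ki = \<S> U.K [^]\<^bsub>opposite_algebra U\<^esub> (N - 1)"
    unfolding U.Ki_def by (rule S.hom_nat_pow) simp
  then show "\<S> U.Ki = U.K"
    unfolding K opposite_pow[OF uq_algebra.field_algebra_axioms U.Ki_closed] U.Ki_pow_N_minus_1 .
qed

definition natural_rep_gen :: "uq_generator \<Rightarrow> 'k \<times> 'k \<times> 'k \<times> 'k" where
  "natural_rep_gen = case_uq_generator (q, 0, 0, inverse q) (0, 1, 0, 0) (0, 0, 1, 0)"

lemma ex_natural_rep: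
  "\<exists>\<rho>. field_algebra_hom U (mat2 base_algebra) \<rho> \<and> \<rho> U.K = (q, 0, 0, inverse q) \<and>
    \<rho> U.E = (0, 1, 0, 0) \<and> \<rho> U.F = (0, 0, 1, 0)"
proof -
  interpret M: uq_rels N q "mat2 base_algebra" natural_rep_gen
    by (rule uq_rels_mat2) (simp_all add: natural_rep_gen_def)
  show ?thesis
    by (rule exI[of _ "\<lambda>C. the_elem (free_lift (mat2 base_algebra) natural_rep_gen ` C)"])
      (simp only: M.induced_hom M.induced_hom_gen, simp add: natural_rep_gen_def)
qed

text \<open>\<open>\<Phi>\<close> is \<open>id \<otimes> \<rho>\<close>. The clause on pure tensors
  is what keeps \<open>A\<close> stable, and the three values come from inserting the matrices of
  \<open>\<rho>\<close> into the coproducts of the generators.\<close>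

lemma ex_Psi:
  "\<exists>\<Phi>. field_algebra_hom (tensor_algebra U U) (mat2 U) \<Phi> \<and>
    (\<forall>a\<in>carrier U. \<forall>b\<in>carrier U. \<exists>p r s t. \<Phi> (pure_tensor U U a b) =
      (p \<odot>\<^bsub>U\<^esub> a, r \<odot>\<^bsub>U\<^esub> a, s \<odot>\<^bsub>U\<^esub> a, t \<odot>\<^bsub>U\<^esub> a)) \<and>
    \<Phi> (\<Delta> U.K) = (q \<odot>\<^bsub>U\<^esub> U.K, \<zero>\<^bsub>U\<^esub>, \<zero>\<^bsub>U\<^esub>, inverse q \<odot>\<^bsub>U\<^esub> U.K) \<and>
    \<Phi> (\<Delta> U.E) = (q \<odot>\<^bsub>U\<^esub> U.E, \<one>\<^bsub>U\<^esub>, \<zero>\<^bsub>U\<^esub>, inverse q \<odot>\<^bsub>U\<^esub> U.E) \<and>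
    \<Phi> (\<Delta> U.F) = (U.F, \<zero>\<^bsub>U\<^esub>, U.Ki, U.F)"
proof -
  obtain \<rho> where rho: "field_algebra_hom U (mat2 base_algebra) \<rho>"
    "\<rho> U.K = (q, 0, 0, inverse q)" "\<rho> U.E = (0, 1, 0, 0)" "\<rho> U.F = (0, 0, 1, 0)"
    using ex_natural_rep by blast
  interpret rho: field_algebra_hom U "mat2 base_algebra" \<rho> by (rule rho(1))
  \<comment> \<open>The matrix \<open>\<rho> b\<close> with each entry multiplied by
    \<open>a\<close>. It is multiplicative in the pair because the entries of
    \<open>\<rho> b\<close> are scalars and commute with \<open>a\<close>.\<close>
  define g where "g a b = (case \<rho> b of (p, r, s, t) \<Rightarrow> (p \<odot>\<^bsub>U\<^esub> a, r \<odot>\<^bsub>U\<^esub> a, s \<odot>\<^bsub>U\<^esub> a, t \<odot>\<^bsub>U\<^esub> a))" for a b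
  have "\<exists>\<Phi>. field_algebra_hom U.P.T (mat2 U) \<Phi> \<and>
      (\<forall>a\<in>carrier U. \<forall>b\<in>carrier U. \<Phi> (U.P.pure a b) = g a b)"
  proof (rule U.P.tensor_hom)
    show "field_algebra (mat2 U)" by (rule uq_algebra.field_algebra_mat2)
    show "g \<one>\<^bsub>U\<^esub> \<one>\<^bsub>U\<^esub> = \<one>\<^bsub>mat2 U\<^esub>"
      using rho.hom_one by (simp add: g_def)
    fix a b assume ab: "a \<in> carrier U" "b \<in> carrier U"
    obtain p r s t where b: "\<rho> b = (p, r, s, t)" by (cases "\<rho> b")
    show "g a b \<in> carrier (mat2 U)"
      using ab by (simp add: g_def b)
    fix c
    show "g (c \<odot>\<^bsub>U\<^esub> a) b = c \<odot>\<^bsub>mat2 U\<^esub> g a b"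
      using ab by (simp add: g_def b uq_algebra.smult_smult mult.commute)
    show "g a (c \<odot>\<^bsub>U\<^esub> b) = c \<odot>\<^bsub>mat2 U\<^esub> g a b"
      using ab by (simp add: g_def b uq_algebra.smult_smult)
    fix b' assume b': "b' \<in> carrier U"
    obtain p' r' s' t' where b'': "\<rho> b' = (p', r', s', t')" by (cases "\<rho> b'")
    show "g a (b \<oplus>\<^bsub>U\<^esub> b') = g a b \<oplus>\<^bsub>mat2 U\<^esub> g a b'"
      using ab b' by (simp add: g_def b b'' uq_algebra.smult_l_distr)
    fix a' assume a': "a' \<in> carrier U"
    show "g (a \<otimes>\<^bsub>U\<^esub> a') (b \<otimes>\<^bsub>U\<^esub> b') = g a b \<otimes>\<^bsub>mat2 U\<^esub> g a' b'"
      using ab b' a'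
      by (simp add: g_def b b'' uq_algebra.smult_l_distr uq_algebra.smult_mult_l uq_algebra.smult_mult_r uq_algebra.smult_smult mult.commute)
  next
    fix a a' b assume "a \<in> carrier U" "a' \<in> carrier U" "b \<in> carrier U"
    then show "g (a \<oplus>\<^bsub>U\<^esub> a') b = g a b \<oplus>\<^bsub>mat2 U\<^esub> g a' b"
      by (cases "\<rho> b") (simp add: g_def uq_algebra.smult_r_distr)
  qed
  then obtain \<Phi> where Phi: "field_algebra_hom U.P.T (mat2 U) \<Phi>"
    "\<And>a b. a \<in> carrier U \<Longrightarrow> b \<in> carrier U \<Longrightarrow> \<Phi> (U.P.pure a b) = g a b"
    by blast
  interpret Phi: field_algebra_hom U.P.T "mat2 U" \<Phi> by (rule Phi(1))
  have rho1: "\<rho> \<one>\<^bsub>U\<^esub> = (1, 0, 0, 1)" using rho.hom_one by simp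
  show ?thesis
  proof (intro exI[of _ \<Phi>] conjI ballI)
    show "\<exists>p r s t. \<Phi> (U.P.pure a b) = (p \<odot>\<^bsub>U\<^esub> a, r \<odot>\<^bsub>U\<^esub> a, s \<odot>\<^bsub>U\<^esub> a, t \<odot>\<^bsub>U\<^esub> a)"
      if "a \<in> carrier U" "b \<in> carrier U" for a b
      unfolding Phi(2)[OF that] g_def by (cases "\<rho> b") auto
  qed (simp_all only: comult_gen uq_comult_gen.simps Let_def U.inv_K Phi(1),
      simp_all add: Phi(2) g_def rho rho1)
qed

text \<open>The coideal condition supplies stability under the entries of
  \<open>\<Phi> \<circ> \<Delta>\<close>; normality, applied to \<open>K\<close>, \<open>E\<close>
  and \<open>F\<close> only, supplies the three adjoint actions.\<close>

theorem normal_right_coideal_subalgebra_trivial: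
  assumes "normal_right_coideal_subalgebra (uq_sl2 N q) A"
  shows "trivial_subalgebra (uq_sl2 N q) A"
proof -
  obtain \<Phi> where Phi: "field_algebra_hom U.P.T (mat2 U) \<Phi>"
    "\<And>a b. a \<in> carrier U \<Longrightarrow> b \<in> carrier U \<Longrightarrow> \<exists>p r s t. \<Phi> (U.P.pure a b) =
      (p \<odot>\<^bsub>U\<^esub> a, r \<odot>\<^bsub>U\<^esub> a, s \<odot>\<^bsub>U\<^esub> a, t \<odot>\<^bsub>U\<^esub> a)"
    and Phi_gen: "\<Phi> (\<Delta> U.K) = (q \<odot>\<^bsub>U\<^esub> U.K, \<zero>\<^bsub>U\<^esub>, \<zero>\<^bsub>U\<^esub>, inverse q \<odot>\<^bsub>U\<^esub> U.K)"
    "\<Phi> (\<Delta> U.E) = (q \<odot>\<^bsub>U\<^esub> U.E, \<one>\<^bsub>U\<^esub>, \<zero>\<^bsub>U\<^esub>, inverse q \<odot>\<^bsub>U\<^esub> U.E)"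
    "\<Phi> (\<Delta> U.F) = (U.F, \<zero>\<^bsub>U\<^esub>, U.Ki, U.F)"
    using ex_Psi by blast
  interpret Phi: field_algebra_hom U.P.T "mat2 U" \<Phi> by (rule Phi(1))
  have sub: "subring A (uq_sl2 N q)" and smult: "\<And>c a. a \<in> A \<Longrightarrow> c \<odot>\<^bsub>U\<^esub> a \<in> A"
    and coideal: "\<Delta> ` A \<subseteq> tensor_left_sub (uq_sl2 N q) A"
    and normal: "\<And>a h n x y. a \<in> A \<Longrightarrow> h \<in> carrier U \<Longrightarrow> sweedler (uq_sl2 N q) h n x y \<Longrightarrow>
       (\<Oplus>\<^bsub>U\<^esub>i\<in>{..<n}. \<S> (x i) \<otimes>\<^bsub>U\<^esub> a \<otimes>\<^bsub>U\<^esub> y i) \<in> A"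
    using assms
    unfolding normal_right_coideal_subalgebra_def right_coideal_subalgebra_def is_subalgebra_def
    by (auto simp del: uq_sl2_simps(7,8))
  note subE = subringE[OF sub, unfolded uq_sl2_simps]
  have A_carrier: "A \<subseteq> carrier U" by (rule subE(1))
  \<comment> \<open>Normality for an element whose coproduct is given as two pure tensors, as is the
    case for \<open>E\<close> and \<open>F\<close>.\<close>
  have ad2: "\<S> x0 \<otimes>\<^bsub>U\<^esub> a \<otimes>\<^bsub>U\<^esub> y0 \<oplus>\<^bsub>U\<^esub> \<S> x1 \<otimes>\<^bsub>U\<^esub> a \<otimes>\<^bsub>U\<^esub> y1 \<in> A"
    if "a \<in> A" "h \<in> carrier U" "\<Delta> h = U.P.pure x0 y0 \<oplus>\<^bsub>U.P.T\<^esub> U.P.pure x1 y1"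
      "x0 \<in> carrier U" "x1 \<in> carrier U" "y0 \<in> carrier U" "y1 \<in> carrier U" for a h x0 x1 y0 y1
  proof -
    let ?x = "\<lambda>i::nat. if i = 0 then x0 else x1" and ?y = "\<lambda>i::nat. if i = 0 then y0 else y1"
    interpret S: field_algebra_hom U "opposite_algebra U" \<S> by (rule antipode_hom)
    have Sc: "\<S> x0 \<in> carrier U" "\<S> x1 \<in> carrier U"
      using S.hom_closed[OF that(4)] S.hom_closed[OF that(5)] by (simp_all del: uq_sl2_simps)
    have two: "{..<2::nat} = {0, 1}" by auto
    have "sweedler (uq_sl2 N q) h 2 ?x ?y"
      using that(3-) unfolding sweedler_def two
      by (simp add: Pi_iff U.P.TA.a_comm del: uq_sl2_simps(7,8))
    from normal[OF that(1,2) this] show ?thesis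
      using that Sc A_carrier unfolding two
      by (simp add: subset_iff uq_algebra.a_comm del: uq_sl2_simps(7,8))
  qed
  have "uq_normal N q U (uq_gen N q) A (\<Phi> \<circ> \<Delta>)"
  proof (intro uq_normal.intro uq_normal_axioms.intro)
    show "uq_rels N q U (uq_gen N q)" by (rule uq_rels_uq_algebra)
    show "S = carrier U" if "S \<subseteq> carrier U" "\<one>\<^bsub>U\<^esub> \<in> S" "\<And>x y. x \<in> S \<Longrightarrow> y \<in> S \<Longrightarrow> x \<oplus>\<^bsub>U\<^esub> y \<in> S"
      "\<And>c x. x \<in> S \<Longrightarrow> c \<odot>\<^bsub>U\<^esub> x \<in> S" "\<And>g x. x \<in> S \<Longrightarrow> uq_gen N q g \<otimes>\<^bsub>U\<^esub> x \<in> S" for S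
      by (rule uq_algebra_generated[OF that])
    show "A \<subseteq> carrier U" by fact
    show "\<one>\<^bsub>U\<^esub> \<in> A" by (rule subE(3))
    show "x \<oplus>\<^bsub>U\<^esub> y \<in> A" if "x \<in> A" "y \<in> A" for x y using subE(7) that by blast
    show "x \<otimes>\<^bsub>U\<^esub> y \<in> A" if "x \<in> A" "y \<in> A" for x y using subE(6) that by blast
    show "c \<odot>\<^bsub>U\<^esub> x \<in> A" if "x \<in> A" for c x using smult that .
    show "U.Ki \<otimes>\<^bsub>U\<^esub> x \<otimes>\<^bsub>U\<^esub> U.K \<in> A" if "x \<in> A" for x
    proof -
      have one: "{..<1::nat} = {0}" by auto
      have x: "x \<in> carrier U" using A_carrier that by blast
      have "sweedler (uq_sl2 N q) U.K 1 (\<lambda>_. U.K) (\<lambda>_. U.K)"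
        unfolding sweedler_def comult_gen one by (simp add: Let_def)
      from normal[OF that U.gen_closed this]
      have "(\<Oplus>\<^bsub>U\<^esub>i\<in>{0::nat}. U.Ki \<otimes>\<^bsub>U\<^esub> x \<otimes>\<^bsub>U\<^esub> U.K) \<in> A"
        unfolding one antipode_values .
      then show ?thesis using x by simp
    qed
    show "\<ominus>\<^bsub>U\<^esub> (U.E \<otimes>\<^bsub>U\<^esub> U.Ki) \<otimes>\<^bsub>U\<^esub> x \<otimes>\<^bsub>U\<^esub> U.K \<oplus>\<^bsub>U\<^esub> x \<otimes>\<^bsub>U\<^esub> U.E \<in> A" if "x \<in> A" for x
      using ad2[OF that, of U.E U.E U.K "\<one>\<^bsub>U\<^esub>" U.E] A_carrier that
      unfolding comult_gen antipode_values by (auto simp: Let_def)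
    show "\<ominus>\<^bsub>U\<^esub> (U.K \<otimes>\<^bsub>U\<^esub> U.F) \<otimes>\<^bsub>U\<^esub> x \<oplus>\<^bsub>U\<^esub> U.K \<otimes>\<^bsub>U\<^esub> x \<otimes>\<^bsub>U\<^esub> U.F \<in> A" if "x \<in> A" for x
      using ad2[OF that, of U.F U.F "\<one>\<^bsub>U\<^esub>" U.Ki U.F] A_carrier that
      unfolding comult_gen antipode_values by (auto simp: Let_def U.inv_K)
    show "field_algebra_hom U (mat2 U) (\<Phi> \<circ> \<Delta>)"
      by (rule field_algebra_hom_comp[OF comult_hom Phi(1)])
    show "(\<Phi> \<circ> \<Delta>) U.K = (q \<odot>\<^bsub>U\<^esub> U.K, \<zero>\<^bsub>U\<^esub>, \<zero>\<^bsub>U\<^esub>, inverse q \<odot>\<^bsub>U\<^esub> U.K)"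
      "(\<Phi> \<circ> \<Delta>) U.E = (q \<odot>\<^bsub>U\<^esub> U.E, \<one>\<^bsub>U\<^esub>, \<zero>\<^bsub>U\<^esub>, inverse q \<odot>\<^bsub>U\<^esub> U.E)"
      "(\<Phi> \<circ> \<Delta>) U.F = (U.F, \<zero>\<^bsub>U\<^esub>, U.Ki, U.F)"
      using Phi_gen by (simp_all only: comp_apply)
    show "fst ((\<Phi> \<circ> \<Delta>) x) \<in> A \<and> fst (snd ((\<Phi> \<circ> \<Delta>) x)) \<in> A \<and> fst (snd (snd ((\<Phi> \<circ> \<Delta>) x))) \<in> A"
      if "x \<in> A" for x
    proof -
      have "\<Delta> x \<in> tensor_left_sub (uq_sl2 N q) A"
        by (rule subsetD[OF coideal imageI[OF that]])
      then obtain n x' y' where xy: "x' \<in> {..<n::nat} \<rightarrow> A" "y' \<in> {..<n} \<rightarrow> carrier U"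
        "\<Delta> x = (\<Oplus>\<^bsub>U.P.T\<^esub>i\<in>{..<n}. U.P.pure (x' i) (y' i))"
        unfolding tensor_left_sub_def tensor_uq_sl2 uq_sl2_simps(1) mem_Collect_eq by (elim exE conjE)
      \<comment> \<open>Induction on the number of pure tensors: each adds scalar multiples of its
        first factor, an element of \<open>A\<close>, to all four entries.\<close>
      have "\<exists>u v w z. \<Phi> (\<Oplus>\<^bsub>U.P.T\<^esub>i\<in>{..<n}. U.P.pure (x' i) (y' i)) = (u, v, w, z) \<and>
          u \<in> A \<and> v \<in> A \<and> w \<in> A \<and> z \<in> A"
        using xy(1,2)
      proof (induction n)
        case 0
        then show ?case using Phi.hom_zero subE(2) by simp
      next
        case (Suc n)
        then have x: "x' n \<in> A" "y' n \<in> carrier U" and cl: "\<And>i. i < Suc n \<Longrightarrow> x' i \<in> carrier U \<and> y' i \<in> carrier U"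
          using A_carrier by auto
        obtain u v w z where IH: "\<Phi> (\<Oplus>\<^bsub>U.P.T\<^esub>i\<in>{..<n}. U.P.pure (x' i) (y' i)) = (u, v, w, z)"
          "u \<in> A" "v \<in> A" "w \<in> A" "z \<in> A"
        proof -
          have "x' \<in> {..<n} \<rightarrow> A" "y' \<in> {..<n} \<rightarrow> carrier U"
            using Suc.prems by auto
          from Suc.IH[OF this] show ?thesis using that by blast
        qed
        obtain p r s t where "\<Phi> (U.P.pure (x' n) (y' n)) =
            (p \<odot>\<^bsub>U\<^esub> x' n, r \<odot>\<^bsub>U\<^esub> x' n, s \<odot>\<^bsub>U\<^esub> x' n, t \<odot>\<^bsub>U\<^esub> x' n)"
          using Phi(2)[of "x' n" "y' n"] cl[of n] by auto
        moreover have "(\<Oplus>\<^bsub>U.P.T\<^esub>i\<in>{..<Suc n}. U.P.pure (x' i) (y' i)) =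
            U.P.pure (x' n) (y' n) \<oplus>\<^bsub>U.P.T\<^esub> (\<Oplus>\<^bsub>U.P.T\<^esub>i\<in>{..<n}. U.P.pure (x' i) (y' i))"
          unfolding lessThan_Suc using cl by (subst U.P.TA.finsum_insert) auto
        moreover have "(\<Oplus>\<^bsub>U.P.T\<^esub>i\<in>{..<n}. U.P.pure (x' i) (y' i)) \<in> carrier U.P.T"
          using cl by (intro U.P.TA.finsum_closed) auto
        ultimately show ?case
          using IH x cl[of n] subE(7) smult by simp
      qed
      then show ?thesis unfolding comp_apply xy(3) by auto
    qed
  qed
  then have "trivial_subalgebra U A"
    by (rule uq_normal.A_trivial)
  then show ?thesis
    by (simp add: trivial_subalgebra_def scalars_def)
qed

end

theorem proposition6p1:
  fixes N :: nat and q :: "'k :: {alg_closed_field, field_char_0}"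
  assumes "N > 1" and "odd N" and "primitive_root_of_unity N q"
  shows "\<not> (\<exists>A. normal_right_coideal_subalgebra (uq_sl2 N q) A \<and>
                \<not> trivial_subalgebra (uq_sl2 N q) A)"
proof -
  interpret uq_params N q
    using assms by unfold_locales
  show ?thesis
    using normal_right_coideal_subalgebra_trivial by blast
qed

end
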